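(* For every pattern $\beta\in\mathcal A$: there is an ultrafilter $\mathcal G\in\beta\mathbb N$ with $\alpha_{\mathcal G}=\beta$ if and only if $\beta$ is $\mathcal C$-closed.
   Context: Divisibility of ultrafilters. $\mathbb N=\{1,2,3,\dots\}$, $\mathbb P$ is the set of primes, $\beta\mathbb N$ is the set of ultrafilters on $\mathbb N$, with $n\in\mathbb N$ identified with the principal ultrafilter at $n$. For $A\subseteq\mathbb N$ let $A\uparrow=\{n\in\mathbb N:(\exists a\in A)\,a\mid n\}$, and $\mathcal U=\{A\subseteq\mathbb N: A\ne\emptyset,\ A=A\uparrow\}$. For $\mathcal F,\mathcal G\in\beta\mathbb N$: $\mathcal F\,\widetilde{\mid}\,\mathcal G$ iff $\mathcal F\cap\mathcal U\subseteq\mathcal G$; $\mathcal F=_\sim\mathcal G$ iff $\mathcal F\,\widetilde{\mid}\,\mathcal G$ and $\mathcal G\,\widetilde{\mid}\,\mathcal F$. Nonstandard extension. Standing assumption: we work in a fixed nonstandard extension ${}^*$ (of a superstructure over $\mathbb N$) which is $\mathfrak c^+$-saturated and satisfies Henson's isomorphism property (any two elementarily equivalent internally presented structures, for a finite first-order language, are isomorphic). In particular all sets $[1,z]=\{a\in{}^*\mathbb N:a\le z\}$ with $z\in{}^*\mathbb N\setminus\mathbb N$ have the same cardinality, denoted $\infty$. For $x\in{}^*\mathbb N$, $tp(x/\mathbb N)=\{A\subseteq\mathbb N:x\in{}^*A\}\in\beta\mathbb N$; $x\models\mathcal F$ ($x$ is a generator of $\mathcal F$) means $tp(x/\mathbb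 N)=\mathcal F$. ${}^*\!\mid$ is the extension of divisibility to ${}^*\mathbb N$. Basic classes. $\overline{\mathbb P}=\{\mathcal P\in\beta\mathbb N:\mathbb P\in\mathcal P\}$. For $\mathcal P\in\overline{\mathbb P}$, on pairs $(p,a)$ with $p\models\mathcal P$, $a\in{}^*\mathbb N$, put $(p,a)\approx_{\mathcal P}(q,b)$ iff $tp(p^a/\mathbb N)=_\sim tp(q^b/\mathbb N)$; $\mathcal E_{\mathcal P}$ is the set of $\approx_{\mathcal P}$-classes. For $u\in\mathcal E_{\mathcal P}$ the set $\mathcal P^u=\{tp(p^a/\mathbb N):(p,a)\in u\}$ is called a basic class, and $\mathcal B$ is the set of all basic classes. $p^a\models\mathcal P^u$ means $(p,a)\in u$. For $A\subseteq\mathbb N$, $A\in\mathcal P^u$ means $A\in\mathcal F$ for all $\mathcal F\in\mathcal P^u$. For a standard prime $p$ the basic classes are $p^k$ ($k\in\mathbb N$) and a single further one, $p^\omega$ (generated by $p^a$ with $a$ infinite). Patterns. $\mathbb N_\infty=\{0,1,2,\dots\}\cup\{\infty\}$. $\mathcal A$ is the set of all functions $\alpha:\mathcal B\to\mathbb N_\infty$ such that $\sum_{k\in\mathbb N\cup\{\omega\}}\alpha(p^k)\le1$ for every $p\in\mathbb P$; its elements are called patterns. For $x\in{}^*\mathbb N$, $p\in{}^*\mathbb P$, $a\in{}^*\mathbb N$, $p^a\,{}^*\!\!\parallel x$ means $x=p^ax'$ with $p$ not dividing $x'$. The pattern of $x$ is $\alpha_x\in\mathcal A$, $\alpha_x(\mathcal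 P^u)=|\{(p,a):p^a\models\mathcal P^u,\ p^a\,{}^*\!\!\parallel x\}|$ (this cardinality is known to lie in $\mathbb N_\infty$). For $\mathcal F\in\beta\mathbb N$, $\alpha_{\mathcal F}:=\alpha_x$ for any $x\models\mathcal F$ (known to be independent of $x$). $\mathcal C$-closedness. $\mathbb P^{exp}=\{p^n:p\in\mathbb P,n\in\mathbb N\}$. $A\subseteq\mathbb N$ is convex if $a,b\in A$, $a\mid c$, $c\mid b$ imply $c\in A$. $\mathcal C$ is the family of nonempty convex subsets of $\mathbb P^{exp}$; $\mathcal P^u\cap\mathcal C=\{A\in\mathcal C:A\in\mathcal P^u\}$. For $A\in\mathcal C$, $\overline A=\{\mathcal Q^v\in\mathcal B:A\in\mathcal Q^v\}$. Sums are sums of cardinals. $\alpha\in\mathcal A$ is $\mathcal C$-closed if: (C1) for every $A\in\mathcal C$ the value $\sum_{\mathcal Q^v\in\overline A}\alpha(\mathcal Q^v)$ belongs to $\mathbb N_\infty$ (i.e. is finite or equal to $\infty$); and (C2) whenever $\mathcal P^u\in\mathcal B$ and $n\in\mathbb N$ satisfy $\sum_{\mathcal Q^v\in\overline A}\alpha(\mathcal Q^v)\ge n$ for every $A\in\mathcal P^u\cap\mathcal C$, then $\alpha(\mathcal P^u)\ge n$. *)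

theory Defs
  imports
    "HOL-Computational_Algebra.Primes"
    "HOL-Library.Equipollence"
    "HOL-Library.Extended_Nat"
begin

text \<open>The mathematical set \<open>{1, 2, 3, \<dots>}\<close> is the subset \<open>posnats\<close> of the type \<open>nat\<close>.\<close>

abbreviation posnats :: "nat set" where
  "posnats \<equiv> {1..}"


section \<open>Superstructures\<close>

text \<open>
  A superstructure over a set \<open>X\<close> of atoms is a type with a membership relation \<open>mem\<close>, all of
  whose elements occur in the cumulative hierarchy \<open>V\<^sub>0 = X\<close>, \<open>V\<^sub>n\<^sub>+\<^sub>1 = V\<^sub>n \<union> Pow V\<^sub>n\<close>.

  The superstructure proper is the case of height \<open>h = \<infinity>\<close>.  A finite height \<open>h\<close> gives the
  truncation \<open>V\<^sub>h\<close>.  Truncations are admitted because HOL does not prove that there is a type as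
  large as a full superstructure, whereas every \<open>V\<^sub>h\<close> with \<open>h\<close> finite lives on a type of HOL.
\<close>

primrec level :: "('v \<Rightarrow> 'v \<Rightarrow> bool) \<Rightarrow> 'v set \<Rightarrow> nat \<Rightarrow> 'v set" where
  "level mem X 0 = X"
| "level mem X (Suc n) =
     level mem X n \<union> {v. v \<notin> X \<and> (\<forall>u. mem u v \<longrightarrow> u \<in> level mem X n)}"

definition is_set_of :: "('v \<Rightarrow> 'v \<Rightarrow> bool) \<Rightarrow> 'v set \<Rightarrow> 'v \<Rightarrow> 'v set \<Rightarrow> bool" where
  "is_set_of mem X v S \<longleftrightarrow> v \<notin> X \<and> (\<forall>u. mem u v \<longleftrightarrow> u \<in> S)"

definition superstructure :: "enat \<Rightarrow> ('v \<Rightarrow> 'v \<Rightarrow> bool) \<Rightarrow> 'v set \<Rightarrow> bool" where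
  "superstructure h mem X \<longleftrightarrow>
     (\<forall>x\<in>X. \<forall>u. \<not> mem u x) \<and>
     (\<forall>v w. v \<notin> X \<longrightarrow> w \<notin> X \<longrightarrow> (\<forall>u. mem u v \<longleftrightarrow> mem u w) \<longrightarrow> v = w) \<and>
     (\<forall>n. enat n < h \<longrightarrow> (\<forall>S \<subseteq> level mem X n. \<exists>v. is_set_of mem X v S)) \<and>
     (\<forall>v. \<exists>n. enat n \<le> h \<and> v \<in> level mem X n)"

text \<open>Kuratowski pairs and right-nested tuples; the tuple of length 1 is its only component.\<close>

definition is_pair :: "('v \<Rightarrow> 'v \<Rightarrow> bool) \<Rightarrow> 'v set \<Rightarrow> 'v \<Rightarrow> 'v \<Rightarrow> 'v \<Rightarrow> bool" where
  "is_pair mem X p x y \<longleftrightarrow>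
     (\<exists>a b. is_set_of mem X a {x} \<and> is_set_of mem X b {x, y} \<and> is_set_of mem X p {a, b})"

fun is_tuple :: "('v \<Rightarrow> 'v \<Rightarrow> bool) \<Rightarrow> 'v set \<Rightarrow> 'v \<Rightarrow> 'v list \<Rightarrow> bool" where
  "is_tuple mem X t [] \<longleftrightarrow> is_set_of mem X t {}"
| "is_tuple mem X t [x] \<longleftrightarrow> t = x"
| "is_tuple mem X t (x # y # ys) \<longleftrightarrow> (\<exists>s. is_tuple mem X s (y # ys) \<and> is_pair mem X t x s)"

text \<open>The element \<open>r\<close> is the set of all tuples in \<open>R\<close>. The last conjunct matters for finite
  heights only, where long tuples need not exist.\<close>

definition is_relation_of :: "('v \<Rightarrow> 'v \<Rightarrow> bool) \<Rightarrow> 'v set \<Rightarrow> 'v \<Rightarrow> 'v list set \<Rightarrow> bool" where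
  "is_relation_of mem X r R \<longleftrightarrow>
     is_set_of mem X r {t. \<exists>xs\<in>R. is_tuple mem X t xs} \<and>
     (\<forall>xs\<in>R. \<exists>t. is_tuple mem X t xs)"


section \<open>Nonstandard extensions\<close>

text \<open>Formulas of set theory with bounded quantifiers only: \<open>BAll i j \<phi>\<close> is
  \<open>\<forall>x\<^sub>i \<in> x\<^sub>j. \<phi>\<close>.\<close>

datatype bounded_formula =
    BEq nat nat
  | BMem nat nat
  | BNeg bounded_formula
  | BConj bounded_formula bounded_formula
  | BAll nat nat bounded_formula

primrec bsat :: "('v \<Rightarrow> 'v \<Rightarrow> bool) \<Rightarrow> bounded_formula \<Rightarrow> (nat \<Rightarrow> 'v) \<Rightarrow> bool" where
  "bsat mem (BEq i j) e \<longleftrightarrow> e i = e j"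
| "bsat mem (BMem i j) e \<longleftrightarrow> mem (e i) (e j)"
| "bsat mem (BNeg \<phi>) e \<longleftrightarrow> \<not> bsat mem \<phi> e"
| "bsat mem (BConj \<phi> \<psi>) e \<longleftrightarrow> bsat mem \<phi> e \<and> bsat mem \<psi> e"
| "bsat mem (BAll i j \<phi>) e \<longleftrightarrow> (\<forall>v. mem v (e j) \<longrightarrow> bsat mem \<phi> (e(i := v)))"

text \<open>The data of a nonstandard extension: the membership relation of the standard universe and
  the numbers \<open>1, 2, 3, \<dots>\<close> as its atoms (the value of \<open>std_nat\<close> at 0 is never used), the
  membership relation of the nonstandard universe, and the map \<open>*\<close>.\<close>

record ('s, 't) ns_universe =
  std_mem :: "'s \<Rightarrow> 's \<Rightarrow> bool"
  std_nat :: "nat \<Rightarrow> 's"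
  ext_mem :: "'t \<Rightarrow> 't \<Rightarrow> bool"
  star :: "'s \<Rightarrow> 't"

definition std_atoms :: "('s, 't) ns_universe \<Rightarrow> 's set" where
  "std_atoms V = std_nat V ` posnats"

definition star_set :: "('s, 't) ns_universe \<Rightarrow> nat set \<Rightarrow> 't set" where
  "star_set V A =
     {x. ext_mem V x (star V (THE v. is_set_of (std_mem V) (std_atoms V) v (std_nat V ` A)))}"

text \<open>The hypernaturals are at the same time the atoms of the nonstandard universe.\<close>

abbreviation hypernats :: "('s, 't) ns_universe \<Rightarrow> 't set" where
  "hypernats V \<equiv> star_set V posnats"

definition star_rel :: "('s, 't) ns_universe \<Rightarrow> nat list set \<Rightarrow> 't list set" where
  "star_rel V R =
     {xs. \<exists>t. is_tuple (ext_mem V) (hypernats V) t xs \<and>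
        ext_mem V t
          (star V (THE r. is_relation_of (std_mem V) (std_atoms V) r (map (std_nat V) ` R)))}"

definition nonstandard_extension :: "enat \<Rightarrow> ('s, 't) ns_universe \<Rightarrow> bool" where
  "nonstandard_extension h V \<longleftrightarrow>
     inj_on (std_nat V) posnats \<and>
     superstructure h (std_mem V) (std_atoms V) \<and>
     superstructure h (ext_mem V) (hypernats V) \<and>
     (\<forall>\<phi> e. bsat (std_mem V) \<phi> e \<longleftrightarrow> bsat (ext_mem V) \<phi> (star V \<circ> e))"

definition internal :: "('s, 't) ns_universe \<Rightarrow> 't \<Rightarrow> bool" where
  "internal V v \<longleftrightarrow> (\<exists>A. ext_mem V v (star V A))"

definition continuum_plus_saturated :: "('s, 't) ns_universe \<Rightarrow> bool" where
  "continuum_plus_saturated V \<longleftrightarrow>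
     (\<forall>F. (\<forall>A\<in>F. internal V A \<and> A \<notin> hypernats V) \<longrightarrow>
          F \<lesssim> (UNIV :: real set) \<longrightarrow>
          (\<forall>G \<subseteq> F. finite G \<longrightarrow> (\<exists>x. \<forall>A\<in>G. ext_mem V x A)) \<longrightarrow>
          (\<exists>x. \<forall>A\<in>F. ext_mem V x A))"


section \<open>Henson's isomorphism property\<close>

datatype fo_term = FVar nat | FApp nat "fo_term list"

datatype fo_formula =
    FRel nat "fo_term list"
  | FEq fo_term fo_term
  | FNeg fo_formula
  | FConj fo_formula fo_formula
  | FAll nat fo_formula

text \<open>A finite language: the lists of the arities of its relation and function symbols
  (constants are function symbols of arity 0).\<close>

record fo_language =
  rel_arities :: "nat list"
  fun_arities :: "nat list"

record 'a fo_structure =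
  dom :: "'a set"
  rel :: "nat \<Rightarrow> 'a list \<Rightarrow> bool"
  fn :: "nat \<Rightarrow> 'a list \<Rightarrow> 'a"

fun term_ok :: "fo_language \<Rightarrow> fo_term \<Rightarrow> bool" where
  "term_ok L (FVar i) \<longleftrightarrow> True"
| "term_ok L (FApp f ts) \<longleftrightarrow>
     f < length (fun_arities L) \<and> length ts = fun_arities L ! f \<and> (\<forall>t\<in>set ts. term_ok L t)"

fun formula_ok :: "fo_language \<Rightarrow> fo_formula \<Rightarrow> bool" where
  "formula_ok L (FRel r ts) \<longleftrightarrow>
     r < length (rel_arities L) \<and> length ts = rel_arities L ! r \<and> (\<forall>t\<in>set ts. term_ok L t)"
| "formula_ok L (FEq s t) \<longleftrightarrow> term_ok L s \<and> term_ok L t"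
| "formula_ok L (FNeg \<phi>) \<longleftrightarrow> formula_ok L \<phi>"
| "formula_ok L (FConj \<phi> \<psi>) \<longleftrightarrow> formula_ok L \<phi> \<and> formula_ok L \<psi>"
| "formula_ok L (FAll i \<phi>) \<longleftrightarrow> formula_ok L \<phi>"

fun term_val :: "'a fo_structure \<Rightarrow> (nat \<Rightarrow> 'a) \<Rightarrow> fo_term \<Rightarrow> 'a" where
  "term_val M e (FVar i) = e i"
| "term_val M e (FApp f ts) = fn M f (map (term_val M e) ts)"

fun fo_sat :: "'a fo_structure \<Rightarrow> fo_formula \<Rightarrow> (nat \<Rightarrow> 'a) \<Rightarrow> bool" where
  "fo_sat M (FRel r ts) e \<longleftrightarrow> rel M r (map (term_val M e) ts)"
| "fo_sat M (FEq s t) e \<longleftrightarrow> term_val M e s = term_val M e t"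
| "fo_sat M (FNeg \<phi>) e \<longleftrightarrow> \<not> fo_sat M \<phi> e"
| "fo_sat M (FConj \<phi> \<psi>) e \<longleftrightarrow> fo_sat M \<phi> e \<and> fo_sat M \<psi> e"
| "fo_sat M (FAll i \<phi>) e \<longleftrightarrow> (\<forall>x\<in>dom M. fo_sat M \<phi> (e(i := x)))"

definition fo_structure_for :: "fo_language \<Rightarrow> 'a fo_structure \<Rightarrow> bool" where
  "fo_structure_for L M \<longleftrightarrow>
     dom M \<noteq> {} \<and>
     (\<forall>i < length (fun_arities L). \<forall>xs \<in> lists (dom M).
        length xs = fun_arities L ! i \<longrightarrow> fn M i xs \<in> dom M)"

text \<open>A formula holds in a structure iff its universal closure does, so that quantifying over
  all formulas amounts to quantifying over all sentences.\<close>

definition holds_in :: "'a fo_structure \<Rightarrow> fo_formula \<Rightarrow> bool" where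
  "holds_in M \<phi> \<longleftrightarrow> (\<forall>e. range e \<subseteq> dom M \<longrightarrow> fo_sat M \<phi> e)"

definition elementarily_equivalent ::
    "fo_language \<Rightarrow> 'a fo_structure \<Rightarrow> 'b fo_structure \<Rightarrow> bool" where
  "elementarily_equivalent L M N \<longleftrightarrow>
     (\<forall>\<phi>. formula_ok L \<phi> \<longrightarrow> (holds_in M \<phi> \<longleftrightarrow> holds_in N \<phi>))"

definition fo_isomorphic :: "fo_language \<Rightarrow> 'a fo_structure \<Rightarrow> 'b fo_structure \<Rightarrow> bool" where
  "fo_isomorphic L M N \<longleftrightarrow>
     (\<exists>f. bij_betw f (dom M) (dom N) \<and>
       (\<forall>i < length (rel_arities L). \<forall>xs \<in> lists (dom M).
          length xs = rel_arities L ! i \<longrightarrow> rel M i xs = rel N i (map f xs)) \<and>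
       (\<forall>i < length (fun_arities L). \<forall>xs \<in> lists (dom M).
          length xs = fun_arities L ! i \<longrightarrow> f (fn M i xs) = fn N i (map f xs)))"

text \<open>The domain, the relations and the graphs of the functions are internal sets.\<close>

definition internally_presented ::
    "('s, 't) ns_universe \<Rightarrow> fo_language \<Rightarrow> 't fo_structure \<Rightarrow> bool" where
  "internally_presented V L M \<longleftrightarrow>
     fo_structure_for L M \<and>
     (\<exists>d. internal V d \<and> is_set_of (ext_mem V) (hypernats V) d (dom M)) \<and>
     (\<forall>i < length (rel_arities L). \<exists>r. internal V r \<and>
        is_relation_of (ext_mem V) (hypernats V) r
          {xs \<in> lists (dom M). length xs = rel_arities L ! i \<and> rel M i xs}) \<and>
     (\<forall>i < length (fun_arities L). \<exists>g. internal V g \<and>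
        is_relation_of (ext_mem V) (hypernats V) g
          {xs @ [fn M i xs] |xs. xs \<in> lists (dom M) \<and> length xs = fun_arities L ! i})"

definition isomorphism_property :: "('s, 't) ns_universe \<Rightarrow> bool" where
  "isomorphism_property V \<longleftrightarrow>
     (\<forall>L M N. internally_presented V L M \<longrightarrow> internally_presented V L N \<longrightarrow>
        elementarily_equivalent L M N \<longrightarrow> fo_isomorphic L M N)"


section \<open>Arithmetic of hypernaturals\<close>

definition hnat :: "('s, 't) ns_universe \<Rightarrow> nat \<Rightarrow> 't" where
  "hnat V n = star V (std_nat V n)"

definition infinite_hypernats :: "('s, 't) ns_universe \<Rightarrow> 't set" where
  "infinite_hypernats V = hypernats V - hnat V ` posnats"

definition hle :: "('s, 't) ns_universe \<Rightarrow> 't \<Rightarrow> 't \<Rightarrow> bool" where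
  "hle V x y \<longleftrightarrow> [x, y] \<in> star_rel V {[m, n] |m n. m \<in> posnats \<and> n \<in> posnats \<and> m \<le> n}"

definition hdvd :: "('s, 't) ns_universe \<Rightarrow> 't \<Rightarrow> 't \<Rightarrow> bool" where
  "hdvd V x y \<longleftrightarrow> [x, y] \<in> star_rel V {[m, n] |m n. m \<in> posnats \<and> n \<in> posnats \<and> m dvd n}"

definition hmult :: "('s, 't) ns_universe \<Rightarrow> 't \<Rightarrow> 't \<Rightarrow> 't" where
  "hmult V x y =
     (THE z. [x, y, z] \<in> star_rel V {[m, n, m * n] |m n. m \<in> posnats \<and> n \<in> posnats})"

definition hpow :: "('s, 't) ns_universe \<Rightarrow> 't \<Rightarrow> 't \<Rightarrow> 't" where
  "hpow V x y =
     (THE z. [x, y, z] \<in> star_rel V {[m, n, m ^ n] |m n. m \<in> posnats \<and> n \<in> posnats})"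

definition hprimes :: "('s, 't) ns_universe \<Rightarrow> 't set" where
  "hprimes V = star_set V {p. prime p}"

definition exactly_divides :: "('s, 't) ns_universe \<Rightarrow> 't \<Rightarrow> 't \<Rightarrow> 't \<Rightarrow> bool" where
  "exactly_divides V p a x \<longleftrightarrow>
     p \<in> hprimes V \<and> a \<in> hypernats V \<and>
     (\<exists>x'\<in>hypernats V. x = hmult V (hpow V p a) x' \<and> \<not> hdvd V p x')"


section \<open>Ultrafilters and their divisibility\<close>

definition ultrafilters :: "nat set set set" where
  "ultrafilters = {F. F \<subseteq> Pow posnats \<and> posnats \<in> F \<and> {} \<notin> F \<and>
     (\<forall>A\<in>F. \<forall>B\<in>F. A \<inter> B \<in> F) \<and>
     (\<forall>A\<in>F. \<forall>B. A \<subseteq> B \<and> B \<subseteq> posnats \<longrightarrow> B \<in> F) \<and>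
     (\<forall>A \<subseteq> posnats. A \<in> F \<or> posnats - A \<in> F)}"

definition up_closure :: "nat set \<Rightarrow> nat set" where
  "up_closure A = {n \<in> posnats. \<exists>a\<in>A. a dvd n}"

definition up_sets :: "nat set set" where
  "up_sets = {A. A \<subseteq> posnats \<and> A \<noteq> {} \<and> A = up_closure A}"

definition uf_dvd :: "nat set set \<Rightarrow> nat set set \<Rightarrow> bool" where
  "uf_dvd F G \<longleftrightarrow> F \<inter> up_sets \<subseteq> G"

definition uf_equiv :: "nat set set \<Rightarrow> nat set set \<Rightarrow> bool" where
  "uf_equiv F G \<longleftrightarrow> uf_dvd F G \<and> uf_dvd G F"

definition tp :: "('s, 't) ns_universe \<Rightarrow> 't \<Rightarrow> nat set set" where
  "tp V x = {A. A \<subseteq> posnats \<and> x \<in> star_set V A}"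

definition generates :: "('s, 't) ns_universe \<Rightarrow> 't \<Rightarrow> nat set set \<Rightarrow> bool" where
  "generates V x F \<longleftrightarrow> x \<in> hypernats V \<and> tp V x = F"


section \<open>Basic classes\<close>

definition prime_ultrafilters :: "nat set set set" where
  "prime_ultrafilters = {P \<in> ultrafilters. {p. prime p} \<in> P}"

definition pairs_over :: "('s, 't) ns_universe \<Rightarrow> nat set set \<Rightarrow> ('t \<times> 't) set" where
  "pairs_over V P = {(p, a). generates V p P \<and> a \<in> hypernats V}"

definition pair_equiv ::
    "('s, 't) ns_universe \<Rightarrow> nat set set \<Rightarrow> (('t \<times> 't) \<times> ('t \<times> 't)) set" where
  "pair_equiv V P = {((p, a), (q, b)). (p, a) \<in> pairs_over V P \<and> (q, b) \<in> pairs_over V P \<and>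
     uf_equiv (tp V (hpow V p a)) (tp V (hpow V q b))}"

definition exponent_classes :: "('s, 't) ns_universe \<Rightarrow> nat set set \<Rightarrow> ('t \<times> 't) set set" where
  "exponent_classes V P = pairs_over V P // pair_equiv V P"

text \<open>The basic class written \<open>P\<^sup>u\<close>; the class \<open>u\<close> determines \<open>P\<close>.\<close>

definition basic_class :: "('s, 't) ns_universe \<Rightarrow> ('t \<times> 't) set \<Rightarrow> nat set set set" where
  "basic_class V u = {tp V (hpow V p a) |p a. (p, a) \<in> u}"

definition basic_classes :: "('s, 't) ns_universe \<Rightarrow> nat set set set set" where
  "basic_classes V = {basic_class V u |P u. P \<in> prime_ultrafilters \<and> u \<in> exponent_classes V P}"

definition power_generates ::
    "('s, 't) ns_universe \<Rightarrow> 't \<Rightarrow> 't \<Rightarrow> nat set set set \<Rightarrow> bool" where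
  "power_generates V p a b \<longleftrightarrow>
     (\<exists>P\<in>prime_ultrafilters. \<exists>u\<in>exponent_classes V P. b = basic_class V u \<and> (p, a) \<in> u)"

definition in_basic_class :: "nat set \<Rightarrow> nat set set set \<Rightarrow> bool" where
  "in_basic_class A b \<longleftrightarrow> (\<forall>F\<in>b. A \<in> F)"

definition class_of_power :: "('s, 't) ns_universe \<Rightarrow> 't \<Rightarrow> 't \<Rightarrow> nat set set set" where
  "class_of_power V p a = basic_class V (pair_equiv V (tp V p) `` {(p, a)})"

text \<open>The classes \<open>p\<^sup>k\<close> and \<open>p\<^sup>\<omega>\<close> of a standard prime; the index \<open>\<infinity>\<close> plays the role of
  \<open>\<omega>\<close>. All infinite exponents give the same class.\<close>

fun std_power_class :: "('s, 't) ns_universe \<Rightarrow> nat \<Rightarrow> enat \<Rightarrow> nat set set set" where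
  "std_power_class V p (enat k) = class_of_power V (hnat V p) (hnat V k)"
| "std_power_class V p \<infinity> =
     class_of_power V (hnat V p) (SOME a. a \<in> infinite_hypernats V)"


section \<open>Cardinals and patterns\<close>

text \<open>An element of \<open>enat\<close> stands for a cardinal, represented by a set of that cardinality:
  \<open>\<infinity>\<close> is the common cardinality of the sets \<open>[1, z]\<close> with \<open>z\<close> infinite, not just any
  infinite cardinality. A sum of cardinals is represented by a disjoint union.\<close>

fun cardinal_set :: "('s, 't) ns_universe \<Rightarrow> enat \<Rightarrow> 't set" where
  "cardinal_set V (enat n) = hnat V ` {1..n}"
| "cardinal_set V \<infinity> = {y \<in> hypernats V. hle V y (SOME z. z \<in> infinite_hypernats V)}"

definition cardinal_sum ::
    "('s, 't) ns_universe \<Rightarrow> ('i \<Rightarrow> enat) \<Rightarrow> 'i set \<Rightarrow> ('i \<times> 't) set" where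
  "cardinal_sum V f I = (SIGMA i:I. cardinal_set V (f i))"

definition patterns :: "('s, 't) ns_universe \<Rightarrow> (nat set set set \<Rightarrow> enat) set" where
  "patterns V = {\<alpha> \<in> basic_classes V \<rightarrow>\<^sub>E UNIV.
     \<forall>p. prime p \<longrightarrow>
       cardinal_sum V (\<lambda>k. \<alpha> (std_power_class V p k)) {1..} \<lesssim> cardinal_set V 1}"

definition pattern_of :: "('s, 't) ns_universe \<Rightarrow> 't \<Rightarrow> nat set set set \<Rightarrow> enat" where
  "pattern_of V x = (\<lambda>b\<in>basic_classes V.
     THE v. {(p, a). power_generates V p a b \<and> exactly_divides V p a x} \<approx> cardinal_set V v)"

definition uf_pattern ::
    "('s, 't) ns_universe \<Rightarrow> nat set set \<Rightarrow> nat set set set \<Rightarrow> enat" where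
  "uf_pattern V F = pattern_of V (SOME x. generates V x F)"


section \<open>Closed patterns\<close>

definition prime_powers :: "nat set" where
  "prime_powers = {p ^ n |p n. prime p \<and> n \<in> posnats}"

definition dvd_convex :: "nat set \<Rightarrow> bool" where
  "dvd_convex A \<longleftrightarrow> (\<forall>a\<in>A. \<forall>b\<in>A. \<forall>c. a dvd c \<and> c dvd b \<longrightarrow> c \<in> A)"

definition convex_family :: "nat set set" where
  "convex_family = {A. A \<noteq> {} \<and> A \<subseteq> prime_powers \<and> dvd_convex A}"

definition classes_containing ::
    "('s, 't) ns_universe \<Rightarrow> nat set \<Rightarrow> nat set set set set" where
  "classes_containing V A = {b \<in> basic_classes V. in_basic_class A b}"

definition C_closed :: "('s, 't) ns_universe \<Rightarrow> (nat set set set \<Rightarrow> enat) \<Rightarrow> bool" where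
  "C_closed V \<alpha> \<longleftrightarrow>
     (\<forall>A\<in>convex_family. \<exists>v. cardinal_sum V \<alpha> (classes_containing V A) \<approx> cardinal_set V v) \<and>
     (\<forall>b\<in>basic_classes V. \<forall>n\<in>posnats.
        (\<forall>A\<in>convex_family. in_basic_class A b \<longrightarrow>
           cardinal_set V (enat n) \<lesssim> cardinal_sum V \<alpha> (classes_containing V A)) \<longrightarrow>
        enat n \<le> \<alpha> b)"

end

(* Every finite set of hypernaturals consists of values star_fun f w of standard functions at a
   single w, so transfer reduces to statements about the ultrafilter germ w. For convex A let c_A(n)
   be the number of primes p dividing n with p ^ multiplicity p n in A. A basic class b is determined
   by the convex sets that belong to it, and saturation gives: alpha_x(b) >= k iff c_A >= k holds
   germ x-almost everywhere for every convex A in b. Saturation even yields an internal set of prime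
   powers of the class that is as large, and by the isomorphism property all infinite internal sets
   have the same cardinality. Hence alpha_x takes its values in the admissible cardinals and the sum
   of alpha_x over the classes containing A is the number of prime powers p ^ a in *A that exactly
   divide x, which gives both closure conditions.

   Conversely, if beta is closed with sums v_A, saturation reduces the search for x with
   (c_A >= k iff v_A >= k) for all A and k to finitely many conditions. These are met by a product of
   powers of distinct standard primes, one for each of finitely many elements counted by beta. The
   primes can be chosen distinct since a class over an infinite hyperprime leaves infinitely many
   choices, while the pattern beta counts at most one element over each standard prime. *)

theory Submission
  imports Defs "HOL-Analysis.Abstract_Topology_2"
begin

section \<open>Bounded formulas about tuples\<close>

text \<open>Transfer covers bounded formulas only, and at a finite height only objects of low rank
  exist. It is therefore applied to a short fixed list of formulas about sets, graphs of functions
  and relations between two or three numbers. An arbitrary predicate of numbers is a single set of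
  the standard universe, so multiplicities and cardinalities never have to be expressed by formulas.

  The obstacle is that a pattern counts external sets: the pairs of one class that exactly divide x
  are cut out by infinitely many convex sets, and the isomorphism property says nothing about them
  directly. An infinite value is squeezed between an internal set found by saturation and the
  internal set of all prime powers that exactly divide x.

  Conversely, x must meet each condition c_A >= k as an equivalence: lower bounds alone could leave
  its pattern too large. Condition (C2) then bounds the pattern of x by beta from above; the bound
  from below holds because what beta counts in a class is part of the sum over every convex set in
  that class.\<close>

definition BEx :: "nat \<Rightarrow> nat \<Rightarrow> bounded_formula \<Rightarrow> bounded_formula" where
  "BEx i j \<phi> = BNeg (BAll i j (BNeg \<phi>))"

definition BImp :: "bounded_formula \<Rightarrow> bounded_formula \<Rightarrow> bounded_formula" where
  "BImp \<phi> \<psi> = BNeg (BConj \<phi> (BNeg \<psi>))"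

definition BIff :: "bounded_formula \<Rightarrow> bounded_formula \<Rightarrow> bounded_formula" where
  "BIff \<phi> \<psi> = BConj (BImp \<phi> \<psi>) (BImp \<psi> \<phi>)"

lemma bsat_connectives [simp]:
  "bsat mem (BEx i j \<phi>) e \<longleftrightarrow> (\<exists>v. mem v (e j) \<and> bsat mem \<phi> (e(i := v)))"
  "bsat mem (BImp \<phi> \<psi>) e \<longleftrightarrow> (bsat mem \<phi> e \<longrightarrow> bsat mem \<psi> e)"
  "bsat mem (BIff \<phi> \<psi>) e \<longleftrightarrow> (bsat mem \<phi> e \<longleftrightarrow> bsat mem \<psi> e)"
  by (auto simp: BEx_def BImp_def BIff_def)

text \<open>The variables from 90 on are reserved for the quantifiers inside the next formulas.\<close>

definition pair_formula :: "nat \<Rightarrow> nat \<Rightarrow> nat \<Rightarrow> bounded_formula" where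
  "pair_formula t x y =
     BEx 100 t (BEx 101 t (BConj (BConj (BMem x 100) (BAll 102 100 (BEq 102 x)))
       (BConj (BConj (BMem x 101) (BConj (BMem y 101)
          (BAll 102 101 (BImp (BNeg (BEq 102 x)) (BEq 102 y)))))
       (BAll 102 t (BImp (BNeg (BEq 102 100)) (BEq 102 101))))))"

text \<open>A bounded formula cannot mention the set of atoms. Each set involved has an element,
  though, and atoms have none, so the clause \<open>v \<notin> X\<close> of \<open>is_set_of\<close>
  comes for free. The index bounds prevent capture by the variables 100 to 102.\<close>

lemma bsat_pair_formula:
  assumes "\<forall>x\<in>X. \<forall>u. \<not> mem u x" "t < 100" "x < 100" "y < 100"
  shows "bsat mem (pair_formula t x y) e \<longleftrightarrow> is_pair mem X (e t) (e x) (e y)"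
proof -
  have "bsat mem (pair_formula t x y) e \<longleftrightarrow> (\<exists>a. mem a (e t) \<and> (\<exists>b. mem b (e t) \<and>
      (mem (e x) a \<and> (\<forall>v. mem v a \<longrightarrow> v = e x)) \<and>
      (mem (e x) b \<and> mem (e y) b \<and> (\<forall>v. mem v b \<longrightarrow> v \<noteq> e x \<longrightarrow> v = e y)) \<and>
      (\<forall>v. mem v (e t) \<longrightarrow> v \<noteq> a \<longrightarrow> v = b)))"
    using assms(2-) by (simp add: pair_formula_def)
  also have "\<dots> \<longleftrightarrow> (\<exists>a b. is_set_of mem X a {e x} \<and> is_set_of mem X b {e x, e y} \<and>
      is_set_of mem X (e t) {a, b})" (is "?L \<longleftrightarrow> ?R")
  proof
    assume ?L
    then obtain a b where ab: "mem a (e t)" "mem b (e t)"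
        "mem (e x) a" "\<forall>v. mem v a \<longrightarrow> v = e x"
        "mem (e x) b" "mem (e y) b" "\<forall>v. mem v b \<longrightarrow> v \<noteq> e x \<longrightarrow> v = e y"
        "\<forall>v. mem v (e t) \<longrightarrow> v \<noteq> a \<longrightarrow> v = b"
      by (elim exE conjE) (rule that; assumption)
    have "is_set_of mem X a {e x}"
      unfolding is_set_of_def using ab(3,4) assms(1) by blast
    moreover have "is_set_of mem X b {e x, e y}"
      unfolding is_set_of_def using ab(5-7) assms(1) by blast
    moreover have "is_set_of mem X (e t) {a, b}"
      unfolding is_set_of_def using ab(1,2,8) assms(1) by blast
    ultimately show ?R by blast
  next
    assume ?R
    then obtain a b where ab: "is_set_of mem X a {e x}" "is_set_of mem X b {e x, e y}"
        "is_set_of mem X (e t) {a, b}"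
      by (elim exE conjE) (rule that; assumption)
    then show ?L
      unfolding is_set_of_def by blast
  qed
  finally show ?thesis
    unfolding is_pair_def .
qed

definition rel2_formula :: "nat \<Rightarrow> nat \<Rightarrow> nat \<Rightarrow> bounded_formula" where
  "rel2_formula r x y = BEx 90 r (pair_formula 90 x y)"

text \<open>The tail of a triple is not an element of the Kuratowski pair but an element of an
  element. Variable 91 is the intermediate set that makes the quantifier over the tail
  bounded.\<close>

definition triple_formula :: "nat \<Rightarrow> nat \<Rightarrow> nat \<Rightarrow> nat \<Rightarrow> bounded_formula" where
  "triple_formula t x y z = BEx 91 t (BEx 92 91
     (BConj (pair_formula 92 y z) (pair_formula t x 92)))"

definition rel3_formula :: "nat \<Rightarrow> nat \<Rightarrow> nat \<Rightarrow> nat \<Rightarrow> bounded_formula" where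
  "rel3_formula r x y z = BEx 90 r (triple_formula 90 x y z)"

definition has_tuple :: "('v \<Rightarrow> 'v \<Rightarrow> bool) \<Rightarrow> 'v set \<Rightarrow> 'v \<Rightarrow> 'v list \<Rightarrow> bool" where
  "has_tuple mem X r xs \<longleftrightarrow> (\<exists>t. mem t r \<and> is_tuple mem X t xs)"

lemma bsat_rel2_formula:
  assumes "\<forall>x\<in>X. \<forall>u. \<not> mem u x" "r < 90" "x < 90" "y < 90"
  shows "bsat mem (rel2_formula r x y) e \<longleftrightarrow> has_tuple mem X (e r) [e x, e y]"
  using assms(2-) by (simp add: rel2_formula_def has_tuple_def bsat_pair_formula[OF assms(1)])

lemma bsat_triple_formula:
  assumes "\<forall>x\<in>X. \<forall>u. \<not> mem u x" "t < 91" "x < 91" "y < 91" "z < 91"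
  shows "bsat mem (triple_formula t x y z) e \<longleftrightarrow> is_tuple mem X (e t) [e x, e y, e z]"
proof -
  have *: "\<exists>b. mem b t \<and> mem s b" if "is_pair mem X t u s" for t u s
    using that unfolding is_pair_def is_set_of_def by blast
  have "bsat mem (triple_formula t x y z) e \<longleftrightarrow>
      (\<exists>b. mem b (e t) \<and> (\<exists>s. mem s b \<and> is_pair mem X s (e y) (e z) \<and> is_pair mem X (e t) (e x) s))"
    using assms(2-) by (simp add: triple_formula_def bsat_pair_formula[OF assms(1)])
  also have "\<dots> \<longleftrightarrow> is_tuple mem X (e t) [e x, e y, e z]"
    unfolding is_tuple.simps using * by blast
  finally show ?thesis .
qed

lemma bsat_rel3_formula:
  assumes "\<forall>x\<in>X. \<forall>u. \<not> mem u x" "r < 90" "x < 90" "y < 90" "z < 90"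
  shows "bsat mem (rel3_formula r x y z) e \<longleftrightarrow> has_tuple mem X (e r) [e x, e y, e z]"
  using assms(2-)
  by (simp add: rel3_formula_def has_tuple_def bsat_triple_formula[OF assms(1)] del: is_tuple.simps)

section \<open>Sets, pairs and tuples inside a superstructure\<close>

lemma is_set_of_inject: "is_set_of mem X v S \<Longrightarrow> is_set_of mem X v T \<Longrightarrow> S = T"
  unfolding is_set_of_def by blast

lemma is_pair_inject:
  assumes "is_pair mem X p x y" "is_pair mem X p x' y'"
  shows "x = x' \<and> y = y'"
proof -
  obtain a b where ab: "is_set_of mem X a {x}" "is_set_of mem X b {x, y}"
      "is_set_of mem X p {a, b}"
    using assms(1) unfolding is_pair_def by blast
  obtain a' b' where ab': "is_set_of mem X a' {x'}" "is_set_of mem X b' {x', y'}"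
      "is_set_of mem X p {a', b'}"
    using assms(2) unfolding is_pair_def by blast
  have eq: "{a, b} = {a', b'}"
    using ab(3) ab'(3) by (rule is_set_of_inject)
  then consider "a = a'" "b = b'" | "a = b'" "b = a'"
    by (auto simp: doubleton_eq_iff)
  then show ?thesis
  proof cases
    case 1
    then have "{x} = {x'}" "{x, y} = {x', y'}"
      using ab ab' is_set_of_inject by metis+
    then show ?thesis by (auto simp: doubleton_eq_iff)
  next
    case 2
    then have "{x} = {x', y'}" "{x, y} = {x'}"
      using ab ab' is_set_of_inject by metis+
    then show ?thesis by (auto simp: doubleton_eq_iff)
  qed
qed

lemma level_mono: "m \<le> n \<Longrightarrow> level mem X m \<subseteq> level mem X n"
  by (rule lift_Suc_mono_le) auto

context
  fixes h :: enat and mem :: "'v \<Rightarrow> 'v \<Rightarrow> bool" and X :: "'v set"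
  assumes sup: "superstructure h mem X" and h: "10 \<le> h"
begin

lemma atoms_empty: "\<forall>x\<in>X. \<forall>u. \<not> mem u x"
  using sup unfolding superstructure_def by (elim conjE)

lemma set_exists:
  assumes "S \<subseteq> level mem X n" "n < 10"
  shows "\<exists>v\<in>level mem X (Suc n). is_set_of mem X v S"
proof -
  have "enat n < h"
    using h assms(2) by (metis enat_ord_simps(2) numeral_eq_enat order_less_le_trans)
  then obtain v where "is_set_of mem X v S"
    using sup[unfolded superstructure_def, THEN conjunct2, THEN conjunct2, THEN conjunct1] assms(1)
    by blast
  then show ?thesis
    using assms(1) unfolding is_set_of_def by (intro bexI[of _ v]) auto
qed

lemma is_set_of_unique: "is_set_of mem X v S \<Longrightarrow> is_set_of mem X w S \<Longrightarrow> v = w"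
proof -
  assume v: "is_set_of mem X v S" and w: "is_set_of mem X w S"
  have "\<forall>u. mem u v \<longleftrightarrow> mem u w"
    using v w unfolding is_set_of_def by simp
  then show "v = w"
    using sup[unfolded superstructure_def, THEN conjunct2, THEN conjunct1] v w
    unfolding is_set_of_def by blast
qed

lemma pair_exists:
  assumes "x \<in> level mem X n" "y \<in> level mem X n" "n < 9"
  shows "\<exists>p\<in>level mem X (n + 2). is_pair mem X p x y"
proof -
  obtain a where a: "a \<in> level mem X (Suc n)" "is_set_of mem X a {x}"
    using set_exists[of "{x}" n] assms by auto
  obtain b where b: "b \<in> level mem X (Suc n)" "is_set_of mem X b {x, y}"
    using set_exists[of "{x, y}" n] assms by auto
  obtain p where "p \<in> level mem X (Suc (Suc n))" "is_set_of mem X p {a, b}"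
    using set_exists[of "{a, b}" "Suc n"] a b assms by auto
  with a b show ?thesis
    unfolding is_pair_def by auto
qed

text \<open>A pair costs two levels: pairs of atoms lie in level 2 and triples in level 4. Hence a
  set of such tuples occurs in level 5, within every height of at least 10.\<close>

lemma tuple_exists:
  assumes "set xs \<subseteq> X" "length xs = 2 \<or> length xs = 3"
  shows "\<exists>t\<in>level mem X 4. is_tuple mem X t xs"
proof -
  have mono: "level mem X 0 \<subseteq> level mem X 2" "level mem X 2 \<subseteq> level mem X 4"
    by (rule level_mono, simp)+
  from assms(2) show ?thesis
  proof
    assume "length xs = 2"
    then obtain x y where xs: "xs = [x, y]"
      by (auto simp: numeral_2_eq_2 length_Suc_conv)
    obtain t where "t \<in> level mem X 2" "is_pair mem X t x y"
      using pair_exists[of x 0 y] assms(1) xs by (auto simp del: level.simps(2) simp: numeral_2_eq_2)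
    then show ?thesis
      using mono xs by auto
  next
    assume "length xs = 3"
    then obtain x y z where xs: "xs = [x, y, z]"
      by (auto simp: numeral_3_eq_3 length_Suc_conv)
    obtain s where s: "s \<in> level mem X 2" "is_pair mem X s y z"
      using pair_exists[of y 0 z] assms(1) xs by (auto simp del: level.simps(2) simp: numeral_2_eq_2)
    moreover have "x \<in> level mem X 2"
      using mono(1) assms(1) xs by auto
    ultimately obtain t where "t \<in> level mem X 4" "is_pair mem X t x s"
      using pair_exists[of x 2 s] by auto
    then show ?thesis
      using s xs by auto
  qed
qed

text \<open>Tuples of different lengths can coincide, since a triple is also the pair of its head
  and its tail. With equal lengths the components are recovered from the outside in.\<close>

lemma is_tuple_inject:
  assumes "is_tuple mem X t xs" "is_tuple mem X t ys"
    "length xs = length ys" "length xs = 2 \<or> length xs = 3"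
  shows "xs = ys"
proof -
  obtain x y zs where xs: "xs = x # y # zs" "zs = [] \<or> (\<exists>z. zs = [z])"
    using assms(4) by (auto simp: numeral_2_eq_2 numeral_3_eq_3 length_Suc_conv)
  obtain x' y' zs' where ys: "ys = x' # y' # zs'" "length zs' = length zs"
    using assms(3) unfolding xs(1) by (metis length_Cons length_Suc_conv)
  obtain s where s: "is_tuple mem X s (y # zs)" "is_pair mem X t x s"
    using assms(1) xs by auto
  obtain s' where s': "is_tuple mem X s' (y' # zs')" "is_pair mem X t x' s'"
    using assms(2) ys by auto
  have eq: "x = x'" "s = s'"
    using is_pair_inject[OF s(2) s'(2)] by simp_all
  from xs(2) show ?thesis
  proof
    assume "zs = []"
    then show ?thesis
      using xs(1) ys s(1) s'(1) eq by simp
  next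
    assume "\<exists>z. zs = [z]"
    then obtain z z' where "zs = [z]" "zs' = [z']"
      using ys(2) by (auto simp: length_Suc_conv)
    moreover from this have "y = y' \<and> z = z'"
      using s(1) s'(1) eq(2) is_pair_inject[of mem X s y z y' z'] by simp
    ultimately show ?thesis
      using xs(1) ys(1) eq(1) by simp
  qed
qed

lemma the_relation:
  assumes "R \<subseteq> {xs. set xs \<subseteq> X \<and> (length xs = 2 \<or> length xs = 3)}"
  shows "is_relation_of mem X (THE r. is_relation_of mem X r R) R"
proof -
  have ex: "\<exists>t\<in>level mem X 4. is_tuple mem X t xs" if "xs \<in> R" for xs
    using tuple_exists assms that by blast
  have *: "is_tuple mem X t xs \<Longrightarrow> xs \<in> R \<Longrightarrow> t \<in> level mem X 4" for t xs
  proof -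
    assume t: "is_tuple mem X t xs" and "xs \<in> R"
    then obtain t' where t': "t' \<in> level mem X 4" "is_tuple mem X t' xs"
      using ex by blast
    have pu: "p = q" if "is_pair mem X p x y" "is_pair mem X q x y" for p q x y
      using that is_set_of_unique unfolding is_pair_def by metis
    have "length xs = 2 \<or> length xs = 3"
      using \<open>xs \<in> R\<close> assms by blast
    then have "t = t'"
      using t t'(2) pu by (auto simp: numeral_2_eq_2 numeral_3_eq_3 length_Suc_conv) blast+
    then show ?thesis using t' by simp
  qed
  then have "{t. \<exists>xs\<in>R. is_tuple mem X t xs} \<subseteq> level mem X 4"
    by blast
  from set_exists[OF this] obtain r where "is_set_of mem X r {t. \<exists>xs\<in>R. is_tuple mem X t xs}"
    by auto
  then have r: "is_relation_of mem X r R"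
    unfolding is_relation_of_def using ex by blast
  then show ?thesis
    by (rule theI) (use r is_set_of_unique in \<open>auto simp: is_relation_of_def\<close>)
qed

lemma has_tuple_the_relation:
  assumes "R \<subseteq> {xs. set xs \<subseteq> X \<and> length xs = k}" "k = 2 \<or> k = 3" "length xs = k"
  shows "has_tuple mem X (THE r. is_relation_of mem X r R) xs \<longleftrightarrow> xs \<in> R"
proof -
  have "is_relation_of mem X (THE r. is_relation_of mem X r R) R"
    by (rule the_relation) (use assms in auto)
  then have *: "mem t (THE r. is_relation_of mem X r R) \<longleftrightarrow> (\<exists>xs\<in>R. is_tuple mem X t xs)"
      "\<forall>xs\<in>R. \<exists>t. is_tuple mem X t xs" for t
    unfolding is_relation_of_def is_set_of_def by auto
  have "ys = xs" if "is_tuple mem X t xs" "is_tuple mem X t ys" "ys \<in> R" for ys t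
    using that assms is_tuple_inject[of t ys xs] by auto
  then show ?thesis
    unfolding has_tuple_def using * by blast
qed

lemma the_set:
  assumes "S \<subseteq> X"
  shows "is_set_of mem X (THE v. is_set_of mem X v S) S"
proof -
  obtain v where v: "is_set_of mem X v S"
    using set_exists[of S 0] assms by auto
  then show ?thesis
    by (rule theI) (rule is_set_of_unique[OF _ v])
qed

end

section \<open>Transfer as a calculus of germs\<close>

text \<open>Keeps \<open>{1..}\<close> from being rewritten to \<open>{Suc 0..}\<close>.\<close>

declare One_nat_def [simp del]

definition relation2 :: "(nat \<Rightarrow> nat \<Rightarrow> bool) \<Rightarrow> nat list set" where
  "relation2 R = {[m, n] |m n. m \<in> posnats \<and> n \<in> posnats \<and> R m n}"

definition relation3 :: "(nat \<Rightarrow> nat \<Rightarrow> nat \<Rightarrow> bool) \<Rightarrow> nat list set" where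
  "relation3 R = {[k, m, n] |k m n. k \<in> posnats \<and> m \<in> posnats \<and> n \<in> posnats \<and> R k m n}"

lemma relation2_subset: "relation2 R \<subseteq> {xs. set xs \<subseteq> posnats \<and> length xs = 2}"
  by (auto simp: relation2_def)

lemma relation3_subset: "relation3 R \<subseteq> {xs. set xs \<subseteq> posnats \<and> length xs = 3}"
  by (auto simp: relation3_def)

lemma mem_relation2: "[m, n] \<in> relation2 R \<longleftrightarrow> 1 \<le> m \<and> 1 \<le> n \<and> R m n"
  by (auto simp: relation2_def)

lemma mem_relation3: "[k, m, n] \<in> relation3 R \<longleftrightarrow> 1 \<le> k \<and> 1 \<le> m \<and> 1 \<le> n \<and> R k m n"
  by (auto simp: relation3_def)

text \<open>Makes any predicate one set of the standard universe, so that it can be transferred as a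
  parameter. The value at 0 is dropped because 0 is not an atom.\<close>

definition extent :: "(nat \<Rightarrow> bool) \<Rightarrow> nat set" where
  "extent P = {n \<in> posnats. P n}"

lemma extent_subset [simp]: "extent P \<subseteq> posnats"
  and mem_extent [simp]: "n \<in> extent P \<longleftrightarrow> 1 \<le> n \<and> P n"
  by (auto simp: extent_def)

abbreviation pos_fun :: "(nat \<Rightarrow> nat) \<Rightarrow> bool" where
  "pos_fun f \<equiv> \<forall>n\<ge>1. 1 \<le> f n"

locale saturated_extension =
  fixes h :: enat and V :: "('s, 't) ns_universe"
  assumes height: "10 \<le> h"
    and extension: "nonstandard_extension h V"
    and saturated: "continuum_plus_saturated V"
    and isomorphism: "isomorphism_property V"
begin

abbreviation "hN \<equiv> hypernats V"

definition set_code :: "nat set \<Rightarrow> 's" where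
  "set_code A = (THE v. is_set_of (std_mem V) (std_atoms V) v (std_nat V ` A))"

definition rel_code :: "nat list set \<Rightarrow> 's" where
  "rel_code R = (THE r. is_relation_of (std_mem V) (std_atoms V) r (map (std_nat V) ` R))"

lemma std_nat_inj: "inj_on (std_nat V) posnats"
  and std_superstructure: "superstructure h (std_mem V) (std_atoms V)"
  and ext_superstructure: "superstructure h (ext_mem V) hN"
  and transfer: "bsat (std_mem V) \<phi> e \<longleftrightarrow> bsat (ext_mem V) \<phi> (star V \<circ> e)"
  using extension unfolding nonstandard_extension_def by (elim conjE, simp)+

lemmas bsat_std =
  bsat_rel2_formula[OF atoms_empty[OF std_superstructure height]]
  bsat_rel3_formula[OF atoms_empty[OF std_superstructure height]]

lemmas bsat_ext =
  bsat_rel2_formula[OF atoms_empty[OF ext_superstructure height]]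
  bsat_rel3_formula[OF atoms_empty[OF ext_superstructure height]]

lemma mem_set_code:
  assumes "A \<subseteq> posnats"
  shows "std_mem V u (set_code A) \<longleftrightarrow> u \<in> std_nat V ` A"
proof -
  have "is_set_of (std_mem V) (std_atoms V) (set_code A) (std_nat V ` A)"
    unfolding set_code_def
    by (rule the_set[OF std_superstructure height]) (use assms in \<open>auto simp: std_atoms_def\<close>)
  then show ?thesis
    unfolding is_set_of_def by blast
qed

lemma std_nat_eq_iff: "1 \<le> m \<Longrightarrow> 1 \<le> n \<Longrightarrow> std_nat V m = std_nat V n \<longleftrightarrow> m = n"
  using std_nat_inj by (auto simp: inj_on_def)

lemma std_nat_mem_set_code:
  assumes "A \<subseteq> posnats" "1 \<le> n"
  shows "std_mem V (std_nat V n) (set_code A) \<longleftrightarrow> n \<in> A"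
  unfolding mem_set_code[OF assms(1)] using assms std_nat_eq_iff by fastforce

lemma ball_posnats_code:
  "(\<forall>v. std_mem V v (set_code posnats) \<longrightarrow> P v) \<longleftrightarrow> (\<forall>n\<ge>1. P (std_nat V n))"
  "(\<exists>v. std_mem V v (set_code posnats) \<and> P v) \<longleftrightarrow> (\<exists>n\<ge>1. P (std_nat V n))"
  by (auto simp: mem_set_code)

lemma map_std_nat_eq:
  assumes "set xs \<subseteq> posnats" "set ys \<subseteq> posnats"
  shows "map (std_nat V) xs = map (std_nat V) ys \<longleftrightarrow> xs = ys"
  using inj_on_map_eq_map[of "std_nat V" xs ys] inj_on_subset[OF std_nat_inj] assms
  by (metis Un_subset_iff)

lemma has_tuple_rel_code:
  assumes "R \<subseteq> {xs. set xs \<subseteq> posnats \<and> length xs = k}" "k = 2 \<or> k = 3"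
    "set xs \<subseteq> posnats" "length xs = k"
  shows "has_tuple (std_mem V) (std_atoms V) (rel_code R) (map (std_nat V) xs) \<longleftrightarrow> xs \<in> R"
proof -
  have "has_tuple (std_mem V) (std_atoms V) (rel_code R) (map (std_nat V) xs) \<longleftrightarrow>
      map (std_nat V) xs \<in> map (std_nat V) ` R"
    unfolding rel_code_def
    by (rule has_tuple_the_relation[OF std_superstructure height _ assms(2)])
      (use assms in \<open>fastforce simp: std_atoms_def\<close>)+
  also have "\<dots> \<longleftrightarrow> xs \<in> R"
    using assms map_std_nat_eq[of xs] by fastforce
  finally show ?thesis .
qed

lemma std_relation2:
  assumes "1 \<le> a" "1 \<le> b"
  shows "has_tuple (std_mem V) (std_atoms V) (rel_code (relation2 R)) [std_nat V a, std_nat V b]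
    \<longleftrightarrow> R a b"
  using has_tuple_rel_code[of "relation2 R" 2 "[a, b]"] relation2_subset assms
  by (simp add: mem_relation2)

lemma std_relation3:
  assumes "1 \<le> a" "1 \<le> b" "1 \<le> c"
  shows "has_tuple (std_mem V) (std_atoms V) (rel_code (relation3 R))
      [std_nat V a, std_nat V b, std_nat V c] \<longleftrightarrow> R a b c"
  using has_tuple_rel_code[of "relation3 R" 3 "[a, b, c]"] relation3_subset assms
  by (simp add: mem_relation3)

lemma mem_star_set: "x \<in> star_set V A \<longleftrightarrow> ext_mem V x (star V (set_code A))"
  unfolding star_set_def set_code_def by simp

lemma mem_star_rel:
  "xs \<in> star_rel V R \<longleftrightarrow> has_tuple (ext_mem V) hN (star V (rel_code R)) xs"
  unfolding star_rel_def rel_code_def has_tuple_def by auto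

text \<open>One rewrite set for both sides of \<open>transfer\<close>: the standard instance becomes
  a statement about numbers, the extended one a statement about \<open>star_set\<close> and
  \<open>star_rel\<close>.\<close>

lemmas transfer_simps = fun_upd_comp bsat_std bsat_ext ball_posnats_code std_nat_mem_set_code
  std_nat_eq_iff std_relation2 std_relation3 mem_star_set[symmetric] mem_star_rel[symmetric]

text \<open>Parameters are the variables 0, 1, and so on. Quantifiers in the transferred formulas
  use indices from 10 on and those inside the tuple formulas from 90 on, so no parameter is
  overwritten.\<close>

definition env :: "'s list \<Rightarrow> nat \<Rightarrow> 's" where
  "env vs i = (if i < length vs then vs ! i else undefined)"

lemma env_simps [simp]:
  "env (v # vs) 0 = v" "env (u # v # vs) 1 = v"
  "env (v # vs) (numeral k) = env vs (pred_numeral k)"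
  by (simp_all add: env_def numeral_eq_Suc One_nat_def)

definition star2 :: "(nat \<Rightarrow> nat \<Rightarrow> bool) \<Rightarrow> 't \<Rightarrow> 't \<Rightarrow> bool" where
  "star2 R x y \<longleftrightarrow> [x, y] \<in> star_rel V (relation2 R)"

definition star3 :: "(nat \<Rightarrow> nat \<Rightarrow> nat \<Rightarrow> bool) \<Rightarrow> 't \<Rightarrow> 't \<Rightarrow> 't \<Rightarrow> bool" where
  "star3 R x y z \<longleftrightarrow> [x, y, z] \<in> star_rel V (relation3 R)"

lemma star_set_subset:
  assumes "A \<subseteq> posnats"
  shows "star_set V A \<subseteq> hN"
proof -
  let ?e = "env [set_code posnats, set_code A]"
  have "bsat (std_mem V) (BAll 10 1 (BMem 10 0)) ?e"
    using assms by (auto simp: mem_set_code)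
  then show ?thesis
    unfolding transfer by (auto simp: mem_star_set)
qed

text \<open>Negation and conjunction are both obtained from this one connective, so a single
  transfer yields the Boolean laws of germs.\<close>

lemma star_set_nand:
  assumes "x \<in> hN"
  shows "x \<in> star_set V (extent (\<lambda>n. \<not> (P n \<and> Q n))) \<longleftrightarrow>
    \<not> (x \<in> star_set V (extent (\<lambda>n. P n)) \<and> x \<in> star_set V (extent (\<lambda>n. Q n)))"
proof -
  let ?e = "env [set_code posnats, set_code (extent (\<lambda>n. \<not> (P n \<and> Q n))),
    set_code (extent (\<lambda>n. P n)), set_code (extent (\<lambda>n. Q n))]"
  have "bsat (std_mem V) (BAll 10 0 (BIff (BMem 10 1) (BNeg (BConj (BMem 10 2) (BMem 10 3))))) ?e"
    by (auto simp: transfer_simps)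
  then show ?thesis
    unfolding transfer using assms by (auto simp: mem_star_set)
qed

lemma std_nat_mem_star_set:
  assumes "1 \<le> n" "A \<subseteq> posnats"
  shows "hnat V n \<in> star_set V A \<longleftrightarrow> n \<in> A"
proof -
  let ?e = "env [std_nat V n, set_code A]"
  have "bsat (std_mem V) (BMem 0 1) ?e \<longleftrightarrow> n \<in> A"
    using assms by (simp add: std_nat_mem_set_code)
  then show ?thesis
    unfolding transfer by (simp add: mem_star_set hnat_def)
qed

lemma star_set_singleton:
  assumes "1 \<le> n"
  shows "star_set V {n} = {hnat V n}"
proof -
  let ?e = "env [std_nat V n, set_code {n}]"
  let ?\<phi> = "BConj (BMem 0 1) (BAll 10 1 (BEq 10 0))"
  have "bsat (std_mem V) ?\<phi> ?e"
    using assms by (auto simp: mem_set_code)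
  moreover have "bsat (ext_mem V) ?\<phi> (star V \<circ> ?e) \<longleftrightarrow> hnat V n \<in> star_set V {n} \<and>
      (\<forall>v. v \<in> star_set V {n} \<longrightarrow> v = hnat V n)"
    by (simp add: mem_star_set hnat_def)
  ultimately show ?thesis
    unfolding transfer by blast
qed

section \<open>Transfer along graphs of standard functions\<close>

lemma star_graph_total:
  assumes "pos_fun f" "x \<in> hN"
  shows "\<exists>y\<in>hN. star2 (\<lambda>m n. n = f m) x y"
proof -
  let ?e = "env [set_code posnats, rel_code (relation2 (\<lambda>m n. n = f m))]"
  have "bsat (std_mem V) (BAll 10 0 (BEx 11 0 (rel2_formula 1 10 11))) ?e"
    using assms by (auto simp: transfer_simps)
  then show ?thesis
    unfolding transfer star2_def using assms by (auto simp: transfer_simps)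
qed

lemma star_graph_eq:
  assumes "w \<in> hN" "x \<in> hN" "y \<in> hN"
    and "star2 (\<lambda>m n. n = f m) w x" "star2 (\<lambda>m n. n = g m) w y"
  shows "x = y \<longleftrightarrow> w \<in> star_set V (extent (\<lambda>n. f n = g n))"
proof -
  let ?e = "env [set_code posnats, set_code (extent (\<lambda>n. f n = g n)),
    rel_code (relation2 (\<lambda>m n. n = f m)), rel_code (relation2 (\<lambda>m n. n = g m))]"
  have "bsat (std_mem V) (BAll 10 0 (BAll 11 0 (BAll 12 0
      (BImp (BConj (rel2_formula 2 10 11) (rel2_formula 3 10 12))
        (BIff (BEq 11 12) (BMem 10 1)))))) ?e"
    by (auto simp: transfer_simps)
  then show ?thesis
    unfolding transfer using assms by (simp add: transfer_simps star2_def)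
qed

lemma star_graph_mem:
  assumes "w \<in> hN" "x \<in> hN" "A \<subseteq> posnats"
    and "star2 (\<lambda>m n. n = f m) w x"
  shows "x \<in> star_set V A \<longleftrightarrow> w \<in> star_set V (extent (\<lambda>n. f n \<in> A))"
proof -
  let ?e = "env [set_code posnats, set_code (extent (\<lambda>n. f n \<in> A)), set_code A,
    rel_code (relation2 (\<lambda>m n. n = f m))]"
  have "bsat (std_mem V) (BAll 10 0 (BAll 11 0 
      (BImp (rel2_formula 3 10 11)
        (BIff (BMem 11 2) (BMem 10 1))))) ?e"
    using assms by (auto simp: transfer_simps)
  then show ?thesis
    unfolding transfer using assms by (simp add: transfer_simps star2_def)
qed

lemma star_graph_rel2:
  assumes "w \<in> hN" "x \<in> hN" "y \<in> hN"
    and "star2 (\<lambda>m n. n = f m) w x" "star2 (\<lambda>m n. n = g m) w y"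
  shows "star2 R x y \<longleftrightarrow> w \<in> star_set V (extent (\<lambda>n. R (f n) (g n)))"
proof -
  let ?e = "env [set_code posnats, set_code (extent (\<lambda>n. R (f n) (g n))),
    rel_code (relation2 (\<lambda>m n. n = f m)), rel_code (relation2 (\<lambda>m n. n = g m)),
    rel_code (relation2 R)]"
  have "bsat (std_mem V) (BAll 10 0 (BAll 11 0 (BAll 12 0
      (BImp (BConj (rel2_formula 2 10 11) (rel2_formula 3 10 12))
        (BIff (rel2_formula 4 11 12) (BMem 10 1)))))) ?e"
    by (auto simp: transfer_simps)
  then show ?thesis
    unfolding transfer using assms by (simp add: transfer_simps star2_def)
qed

lemma star_graph_rel3:
  assumes "w \<in> hN" "x \<in> hN" "y \<in> hN" "z \<in> hN"
    and "star2 (\<lambda>m n. n = f m) w x" "star2 (\<lambda>m n. n = g m) w y" "star2 (\<lambda>m n. n = k m) w z"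
  shows "star3 R x y z \<longleftrightarrow> w \<in> star_set V (extent (\<lambda>n. R (f n) (g n) (k n)))"
proof -
  let ?e = "env [set_code posnats, set_code (extent (\<lambda>n. R (f n) (g n) (k n))),
    rel_code (relation2 (\<lambda>m n. n = f m)), rel_code (relation2 (\<lambda>m n. n = g m)),
    rel_code (relation2 (\<lambda>m n. n = k m)), rel_code (relation3 R)]"
  have "bsat (std_mem V) (BAll 10 0 (BAll 11 0 (BAll 12 0 (BAll 13 0
      (BImp (BConj (rel2_formula 2 10 11) (BConj (rel2_formula 3 10 12) (rel2_formula 4 10 13)))
        (BIff (rel3_formula 5 11 12 13) (BMem 10 1))))))) ?e"
    by (auto simp: transfer_simps)
  then show ?thesis
    unfolding transfer using assms by (simp add: transfer_simps star2_def star3_def)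
qed

text \<open>As \<open>f\<close> and \<open>g\<close> jointly reach every pair of numbers, transfer
  finds a common argument for every pair of hypernaturals. This is what lets several points be
  studied at one germ.\<close>

lemma common_argument:
  assumes "x \<in> hN" "y \<in> hN"
    and "\<And>m n. 1 \<le> m \<Longrightarrow> 1 \<le> n \<Longrightarrow> \<exists>k\<ge>1. m = f k \<and> n = g k"
  shows "\<exists>w\<in>hN. star2 (\<lambda>m n. n = f m) w x \<and> star2 (\<lambda>m n. n = g m) w y"
proof -
  let ?e = "env [set_code posnats,
    rel_code (relation2 (\<lambda>m n. n = f m)), rel_code (relation2 (\<lambda>m n. n = g m))]"
  have "bsat (std_mem V) (BAll 11 0 (BAll 12 0 (BEx 10 0
      (BConj (rel2_formula 1 10 11) (rel2_formula 2 10 12))))) ?e"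
    using assms(3) by (simp add: transfer_simps cong: conj_cong)
  then show ?thesis
    unfolding transfer using assms(1,2) by (simp add: transfer_simps star2_def Bex_def)
qed

lemma rel_code_triple:
  assumes "std_mem V t (rel_code (relation3 R))"
  obtains k m n where "1 \<le> k" "1 \<le> m" "1 \<le> n"
    "is_tuple (std_mem V) (std_atoms V) t [std_nat V k, std_nat V m, std_nat V n]"
proof -
  have "is_relation_of (std_mem V) (std_atoms V) (rel_code (relation3 R))
      (map (std_nat V) ` relation3 R)"
    unfolding rel_code_def
    by (rule the_relation[OF std_superstructure height])
      (use relation3_subset[of R] in \<open>fastforce simp: std_atoms_def\<close>)
  then obtain xs where "xs \<in> relation3 R" "is_tuple (std_mem V) (std_atoms V) t (map (std_nat V) xs)"
    using assms unfolding is_relation_of_def is_set_of_def by blast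
  then show ?thesis
    using that unfolding relation3_def by auto
qed

text \<open>The definite descriptions in \<open>hmult\<close> and \<open>hpow\<close> range over the
  whole nonstandard universe; this confines their candidates to the hypernaturals. The transferred
  formula starts from the coded triples because they provide the bound for its outermost
  quantifier.\<close>

lemma star3_hypernats:
  assumes "star3 R x y z"
  shows "x \<in> hN \<and> y \<in> hN \<and> z \<in> hN"
proof -
  let ?e = "env [set_code posnats, rel_code (relation3 R)]"
  let ?\<phi> = "BAll 10 1 (BEx 11 0 (BEx 12 0 (BEx 13 0 (triple_formula 10 11 12 13))))"
  note atoms = atoms_empty[OF std_superstructure height] atoms_empty[OF ext_superstructure height]
  have "bsat (std_mem V) ?\<phi> ?e"
    by (simp add: bsat_triple_formula[OF atoms(1)] ball_posnats_code del: is_tuple.simps)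
      (blast elim: rel_code_triple)
  moreover have "bsat (ext_mem V) ?\<phi> (star V \<circ> ?e) \<longleftrightarrow>
      (\<forall>t. ext_mem V t (star V (rel_code (relation3 R))) \<longrightarrow>
        (\<exists>u\<in>hN. \<exists>v\<in>hN. \<exists>w\<in>hN. is_tuple (ext_mem V) hN t [u, v, w]))"
    by (simp add: bsat_triple_formula[OF atoms(2)] mem_star_set[symmetric] fun_upd_comp Bex_def
        del: is_tuple.simps)
  ultimately have all: "\<forall>t. ext_mem V t (star V (rel_code (relation3 R))) \<longrightarrow>
        (\<exists>u\<in>hN. \<exists>v\<in>hN. \<exists>w\<in>hN. is_tuple (ext_mem V) hN t [u, v, w])"
    unfolding transfer by blast
  obtain t where t: "is_tuple (ext_mem V) hN t [x, y, z]"
      "ext_mem V t (star V (rel_code (relation3 R)))"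
    using assms unfolding star3_def mem_star_rel has_tuple_def by blast
  then obtain u v w where uvw: "u \<in> hN" "v \<in> hN" "w \<in> hN" "is_tuple (ext_mem V) hN t [u, v, w]"
    using all by blast
  have "[x, y, z] = [u, v, w]"
    by (rule is_tuple_inject[OF ext_superstructure height t(1) uvw(4)]) simp_all
  then show ?thesis
    using uvw by simp
qed

text \<open>Comprehension with a parameter is transferred with the section quantified over the set
  \<open>P\<close> of all sets of atoms, which is level 1 without the atoms. Whatever lies in the
  extension of \<open>P\<close> is internal by definition.\<close>

lemma internal_section:
  assumes "x \<in> hN"
  shows "\<exists>v. internal V v \<and> (\<forall>y. ext_mem V y v \<longleftrightarrow> y \<in> hN \<and> star2 R x y)"
proof -
  define S where "S = {v \<in> level (std_mem V) (std_atoms V) (Suc 0). v \<notin> std_atoms V}"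
  obtain P where "is_set_of (std_mem V) (std_atoms V) P S"
    using set_exists[OF std_superstructure height, of S "Suc 0"] unfolding S_def by auto
  then have P: "std_mem V v P \<longleftrightarrow> v \<in> S" for v
    unfolding is_set_of_def by blast
  let ?e = "env [set_code posnats, rel_code (relation2 R), P]"
  have code: "\<exists>v. std_mem V v P \<and> (\<forall>y. std_mem V y v \<longrightarrow> std_mem V y (set_code posnats)) \<and>
      (\<forall>n\<ge>1. std_mem V (std_nat V n) v \<longleftrightarrow> R m n)" if "1 \<le> m" for m
  proof -
    have "set_code (extent (\<lambda>n. R m n)) \<in> S"
    proof -
      have "is_set_of (std_mem V) (std_atoms V) (set_code (extent (\<lambda>n. R m n)))
          (std_nat V ` (extent (\<lambda>n. R m n)))"
        unfolding set_code_def
        by (rule the_set[OF std_superstructure height]) (auto simp: std_atoms_def)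
      then show ?thesis
        unfolding is_set_of_def S_def by (auto simp: std_atoms_def)
    qed
    then show ?thesis
      unfolding P
      by (intro exI[of _ "set_code (extent (\<lambda>n. R m n))"]) (auto simp: mem_set_code std_nat_eq_iff)
  qed
  have "bsat (std_mem V) (BAll 10 0 (BEx 11 2 (BConj (BAll 12 11 (BMem 12 0))
      (BAll 12 0 (BIff (BMem 12 11) (rel2_formula 1 10 12)))))) ?e"
    using code by (simp add: transfer_simps)
  then obtain v where "ext_mem V v (star V P)" "\<forall>y. ext_mem V y v \<longrightarrow> y \<in> hN"
      "\<forall>y. y \<in> hN \<longrightarrow> (ext_mem V y v \<longleftrightarrow> star2 R x y)"
    unfolding transfer using assms by (auto simp: transfer_simps star2_def)
  then show ?thesis
    unfolding internal_def by blast
qed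

section \<open>The type of a hypernatural as a filter\<close>

definition germ :: "'t \<Rightarrow> nat filter" where
  "germ x = Abs_filter (\<lambda>P. x \<in> star_set V (extent P))"

lemma star_set_extent_not:
  assumes "x \<in> hN"
  shows "x \<in> star_set V (extent (\<lambda>n. \<not> P n)) \<longleftrightarrow> x \<notin> star_set V (extent P)"
  using star_set_nand[OF assms, of P P] by simp

lemma star_set_extent_conj:
  assumes "x \<in> hN"
  shows "x \<in> star_set V (extent (\<lambda>n. P n \<and> Q n)) \<longleftrightarrow>
    x \<in> star_set V (extent P) \<and> x \<in> star_set V (extent Q)"
  using star_set_nand[OF assms, of P Q] star_set_extent_not[OF assms, of "\<lambda>n. P n \<and> Q n"] by blast

lemma extent_True: "extent (\<lambda>_. True) = posnats"
  by (auto simp: extent_def)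

lemma eventually_germ:
  assumes "x \<in> hN"
  shows "eventually P (germ x) \<longleftrightarrow> x \<in> star_set V (extent P)"
proof -
  have "is_filter (\<lambda>P. x \<in> star_set V (extent P))"
  proof
    show "x \<in> star_set V (extent (\<lambda>_. True))"
      using assms by (simp add: extent_True)
  next
    fix P Q assume "x \<in> star_set V (extent P)" "x \<in> star_set V (extent Q)"
    then show "x \<in> star_set V (extent (\<lambda>n. P n \<and> Q n))"
      using star_set_extent_conj[OF assms] by blast
  next
    fix P Q :: "nat \<Rightarrow> bool" assume PQ: "\<forall>n. P n \<longrightarrow> Q n" and "x \<in> star_set V (extent P)"
    \<comment> \<open>An implication is the failure of \<open>P\<close> together with the negation
      of \<open>Q\<close>, so upward closure is also an instance of
      \<open>star_set_nand\<close>.\<close>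
    moreover have "extent (\<lambda>n. \<not> (P n \<and> \<not> Q n)) = posnats"
      using PQ by (auto simp: extent_def)
    ultimately show "x \<in> star_set V (extent Q)"
      using star_set_nand[OF assms, of P "\<lambda>n. \<not> Q n"] star_set_extent_not[OF assms, of Q] assms
      by simp
  qed
  then show ?thesis
    unfolding germ_def by (rule eventually_Abs_filter)
qed

lemma eventually_germ_not:
  assumes "x \<in> hN"
  shows "eventually (\<lambda>n. \<not> P n) (germ x) \<longleftrightarrow> \<not> eventually P (germ x)"
  by (simp add: eventually_germ assms star_set_extent_not)

lemma eventually_germ_pos:
  assumes "x \<in> hN"
  shows "eventually (\<lambda>n. 1 \<le> n) (germ x)"
proof -
  have "extent (\<lambda>n. 1 \<le> n) = posnats"
    by (auto simp: extent_def)
  then show ?thesis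
    using assms by (simp add: eventually_germ)
qed

lemma mem_star_set_iff:
  assumes "A \<subseteq> posnats"
  shows "x \<in> star_set V A \<longleftrightarrow> x \<in> hN \<and> eventually (\<lambda>n. n \<in> A) (germ x)"
proof -
  have "extent (\<lambda>n. n \<in> A) = A"
    using assms by (auto simp: extent_def)
  then show ?thesis
    using star_set_subset[OF assms] by (auto simp: eventually_germ)
qed

lemma hnat_in [simp]: "1 \<le> n \<Longrightarrow> hnat V n \<in> hN"
  by (simp add: std_nat_mem_star_set)

lemma eventually_germ_hnat [simp]:
  assumes "1 \<le> n"
  shows "eventually P (germ (hnat V n)) \<longleftrightarrow> P n"
  using assms by (simp add: eventually_germ std_nat_mem_star_set)

lemma hnat_inj: "inj_on (hnat V) posnats"
proof (rule inj_onI)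
  fix m n assume "m \<in> posnats" "n \<in> posnats" "hnat V m = hnat V n"
  then show "m = n"
    using eventually_germ_hnat[of m "\<lambda>k. k = n"] eventually_germ_hnat[of n "\<lambda>k. k = n"] by simp
qed

lemma eventually_germ_const_iff:
  assumes "x \<in> hN" "1 \<le> n"
  shows "eventually (\<lambda>k. k = n) (germ x) \<longleftrightarrow> x = hnat V n"
proof -
  have "extent (\<lambda>k. k = n) = {n}"
    using assms by (auto simp: extent_def)
  then show ?thesis
    using assms star_set_singleton by (simp add: eventually_germ)
qed

section \<open>Values of standard functions at hypernaturals\<close>

definition star_fun :: "(nat \<Rightarrow> nat) \<Rightarrow> 't \<Rightarrow> 't" where
  "star_fun f x = (THE y. y \<in> hN \<and> star2 (\<lambda>m n. n = f m) x y)"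

lemma star_fun:
  assumes "pos_fun f" "x \<in> hN"
  shows star_fun_in: "star_fun f x \<in> hN"
    and star_fun_graph: "star2 (\<lambda>m n. n = f m) x (star_fun f x)"
proof -
  obtain y where y: "y \<in> hN" "star2 (\<lambda>m n. n = f m) x y"
    using star_graph_total[OF assms] by blast
  have uniq: "z = y" if "z \<in> hN" "star2 (\<lambda>m n. n = f m) x z" for z
    using star_graph_eq[OF assms(2) that(1) y(1) that(2) y(2)] assms(2) by (simp add: extent_True)
  have "star_fun f x = y"
    unfolding star_fun_def by (rule the_equality) (use y uniq in blast)+
  with y show "star_fun f x \<in> hN" "star2 (\<lambda>m n. n = f m) x (star_fun f x)"
    by simp_all
qed

lemma star_fun_eq_iff:
  assumes "pos_fun f" "pos_fun g" "x \<in> hN"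
  shows "star_fun f x = star_fun g x \<longleftrightarrow> eventually (\<lambda>n. f n = g n) (germ x)"
  using assms by (simp add: star_graph_eq[of x _ _ f g] star_fun eventually_germ)

lemma star_fun_unique:
  assumes "pos_fun f" "x \<in> hN" "y \<in> hN" "star2 (\<lambda>m n. n = f m) x y"
  shows "y = star_fun f x"
  using star_graph_eq[of x y "star_fun f x" f f] assms star_fun[OF assms(1,2)]
  by (simp add: extent_True)

lemma eventually_germ_star_fun:
  assumes "pos_fun f" "x \<in> hN"
  shows "eventually P (germ (star_fun f x)) \<longleftrightarrow> eventually (\<lambda>n. P (f n)) (germ x)"
proof -
  have "eventually P (germ (star_fun f x)) \<longleftrightarrow> x \<in> star_set V (extent (\<lambda>n. f n \<in> extent P))"
    using star_fun[OF assms] assms(2)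
    by (simp add: eventually_germ del: mem_extent) (subst star_graph_mem[of x _ _ f], simp_all del: mem_extent)
  also have "extent (\<lambda>n. f n \<in> extent P) = extent (\<lambda>n. P (f n))"
    using assms(1) by (auto simp: extent_def)
  finally show ?thesis
    using assms(2) by (simp add: eventually_germ)
qed

lemma star2_star_fun:
  assumes "pos_fun f" "pos_fun g" "x \<in> hN"
  shows "star2 R (star_fun f x) (star_fun g x) \<longleftrightarrow> eventually (\<lambda>n. R (f n) (g n)) (germ x)"
  using star_graph_rel2[of x "star_fun f x" "star_fun g x" f g R] star_fun assms
  by (simp add: eventually_germ)

lemma star3_star_fun:
  assumes "pos_fun f" "pos_fun g" "pos_fun k" "x \<in> hN"
  shows "star3 R (star_fun f x) (star_fun g x) (star_fun k x) \<longleftrightarrow>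
    eventually (\<lambda>n. R (f n) (g n) (k n)) (germ x)"
  using star_graph_rel3[of x "star_fun f x" "star_fun g x" "star_fun k x" f g k R] star_fun assms
  by (simp add: eventually_germ)

lemma star_fun_id [simp]:
  assumes "x \<in> hN"
  shows "star_fun (\<lambda>n. n) x = x"
proof -
  let ?e = "env [set_code posnats, rel_code (relation2 (\<lambda>m n. n = m))]"
  have "bsat (std_mem V) (BAll 10 0 (rel2_formula 1 10 10)) ?e"
    by (simp add: transfer_simps)
  then have "star2 (\<lambda>m n. n = m) x x"
    unfolding transfer star2_def using assms by (simp add: transfer_simps)
  then show ?thesis
    using star_fun_unique[of "\<lambda>n. n" x x] assms by simp
qed

lemma star_fun_star_fun:
  assumes "pos_fun f" "pos_fun g" "x \<in> hN"
  shows "star_fun f (star_fun g x) = star_fun (\<lambda>n. f (g n)) x"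
proof -
  have "star2 (\<lambda>m n. n = f m) (star_fun g x) (star_fun (\<lambda>n. f (g n)) x)"
    using assms by (subst star2_star_fun) auto
  then show ?thesis
    using assms by (intro star_fun_unique[symmetric] star_fun_in) auto
qed

lemma star_fun_const:
  assumes "1 \<le> c" "x \<in> hN"
  shows "star_fun (\<lambda>_. c) x = hnat V c"
proof -
  have "eventually (\<lambda>k. k = c) (germ (star_fun (\<lambda>_. c) x))"
    using assms by (subst eventually_germ_star_fun) auto
  then show ?thesis
    using assms by (subst (asm) eventually_germ_const_iff) (auto intro: star_fun_in)
qed

text \<open>Induction on \<open>T\<close>: the new point and the old base point become the two
  coordinates of a new base point, and the old functions are composed with the first
  coordinate.\<close>

lemma star_fun_representation:
  assumes "finite T" "T \<subseteq> hN"
  shows "\<exists>w\<in>hN. \<exists>g. \<forall>y\<in>T. pos_fun (g y) \<and> y = star_fun (g y) w"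
  using assms
proof (induction T)
  case empty
  then show ?case
    using hnat_in[of 1] by blast
next
  case (insert y T)
  then obtain w g where w: "w \<in> hN" "\<forall>y\<in>T. pos_fun (g y) \<and> y = star_fun (g y) w"
    by auto
  \<comment> \<open>The inverse of the pairing function, shifted because hypernaturals correspond to
    numbers from 1 on while \<open>prod_decode\<close> starts at 0.\<close>
  define f1 f2 where "f1 = (\<lambda>k. Suc (fst (prod_decode (k - 1))))"
    and "f2 = (\<lambda>k. Suc (snd (prod_decode (k - 1))))"
  have "\<exists>k\<ge>1. m = f1 k \<and> n = f2 k" if "1 \<le> m" "1 \<le> n" for m n
    using that by (intro exI[of _ "Suc (prod_encode (m - 1, n - 1))"]) (auto simp: f1_def f2_def)
  then obtain u where u: "u \<in> hN" "star2 (\<lambda>m n. n = f1 m) u w" "star2 (\<lambda>m n. n = f2 m) u y"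
    using common_argument[of w y f1 f2] w(1) insert.prems by auto
  have pos: "pos_fun f1" "pos_fun f2"
    by (auto simp: f1_def f2_def)
  have "w = star_fun f1 u" "y = star_fun f2 u"
    using star_fun_unique u w insert.prems pos by auto
  define g' where "g' = (\<lambda>z. if z = y then f2 else (\<lambda>n. g z (f1 n)))"
  have "pos_fun (g' z) \<and> z = star_fun (g' z) u" if "z \<in> insert y T" for z
  proof (cases "z = y")
    case True
    then show ?thesis
      using \<open>y = star_fun f2 u\<close> pos by (simp add: g'_def)
  next
    case False
    then have z: "pos_fun (g z)" "z = star_fun (g z) w"
      using that w by auto
    then have "z = star_fun (\<lambda>n. g z (f1 n)) u"
      using star_fun_star_fun[of "g z" f1 u] \<open>w = star_fun f1 u\<close> pos u by simp
    then show ?thesis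
      using False z pos by (simp add: g'_def)
  qed
  then show ?case
    using u(1) by blast
qed

lemma star_fun_representation2:
  assumes "x \<in> hN" "y \<in> hN"
  obtains w f g where "w \<in> hN" "pos_fun f" "pos_fun g" "x = star_fun f w" "y = star_fun g w"
  using star_fun_representation[of "{x, y}"] assms by auto

lemma star_fun_representation3:
  assumes "x \<in> hN" "y \<in> hN" "z \<in> hN"
  obtains w f g k where "w \<in> hN" "pos_fun f" "pos_fun g" "pos_fun k"
    "x = star_fun f w" "y = star_fun g w" "z = star_fun k w"
  using star_fun_representation[of "{x, y, z}"] assms by auto

lemma star2_right:
  assumes "x \<in> hN" "pos_fun g"
  shows "star2 R x (star_fun g x) \<longleftrightarrow> eventually (\<lambda>n. R n (g n)) (germ x)"
  using star2_star_fun[of "\<lambda>n. n" g x R] assms by simp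

lemma star2_converse:
  assumes "x \<in> hN" "y \<in> hN"
  shows "star2 R x y \<longleftrightarrow> star2 (\<lambda>n m. R m n) y x"
  by (rule star_fun_representation2[OF assms]) (simp add: star2_star_fun)

text \<open>Saturation at a fixed parameter \<open>x\<close>. No cardinality hypothesis on the
  family appears, since there are only continuum many binary relations between numbers. Finite
  satisfiability is checked on standard numbers along the germ of \<open>x\<close>.\<close>

lemma saturation:
  assumes "x \<in> hN"
    and fip: "\<And>F. finite F \<Longrightarrow> F \<subseteq> \<R> \<Longrightarrow> eventually (\<lambda>m. \<exists>n\<ge>1. \<forall>R\<in>F. R m n) (germ x)"
  shows "\<exists>y\<in>hN. \<forall>R\<in>\<R>. star2 R x y"
\<comment> \<open>Some relation must be present to force the point supplied by saturation to be a
  hypernatural.\<close>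
proof (cases "\<R> = {}")
  case True
  then show ?thesis using assms by blast
next
  case False
  obtain sec where sec: "\<And>R. internal V (sec R)"
      "\<And>R y. ext_mem V y (sec R) \<longleftrightarrow> y \<in> hN \<and> star2 R x y"
    using internal_section[OF assms(1)] by metis
  have fin: "\<exists>y. \<forall>R\<in>F. ext_mem V y (sec R)" if "finite F" "F \<subseteq> \<R>" for F
  proof -
    \<comment> \<open>A Skolem function for the finite subfamily; the default 1 keeps it positive
      where no witness exists.\<close>
    define f where "f m = (if \<exists>n\<ge>1. \<forall>R\<in>F. R m n then SOME n. 1 \<le> n \<and> (\<forall>R\<in>F. R m n) else 1)" for m
    have f: "1 \<le> f m \<and> ((\<exists>n\<ge>1. \<forall>R\<in>F. R m n) \<longrightarrow> (\<forall>R\<in>F. R m (f m)))" for m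
      unfolding f_def using someI_ex[of "\<lambda>n. 1 \<le> n \<and> (\<forall>R\<in>F. R m n)"] by auto
    have "eventually (\<lambda>m. \<forall>R\<in>F. R m (f m)) (germ x)"
      using fip[OF that] by (rule eventually_mono) (use f in blast)
    then have "eventually (\<lambda>m. R m (f m)) (germ x)" if "R \<in> F" for R
      by (rule eventually_mono) (use that in blast)
    then have "star2 R x (star_fun f x)" if "R \<in> F" for R
      using that assms(1) f star2_right[of x f R] by blast
    then show ?thesis
      using sec(2) star_fun_in[of f x] f assms(1) by auto
  qed
  have "sec ` \<R> \<lesssim> (UNIV :: real set)"
  proof -
    \<comment> \<open>A binary relation is coded by the set of codes of its pairs, which bounds the
      family by the power set of the numbers.\<close>
    have "inj (\<lambda>R. {k. case_prod R (prod_decode k)})"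
    proof (rule injI)
      fix R S :: "nat \<Rightarrow> nat \<Rightarrow> bool"
      assume eq: "{k. case_prod R (prod_decode k)} = {k. case_prod S (prod_decode k)}"
      have "R m n = S m n" for m n
        using eq[unfolded set_eq_iff, rule_format, of "prod_encode (m, n)"] by simp
      then show "R = S" by blast
    qed
    then have "(UNIV :: (nat \<Rightarrow> nat \<Rightarrow> bool) set) \<lesssim> (UNIV :: nat set set)"
      unfolding lepoll_def by blast
    also have "(UNIV :: nat set set) \<lesssim> (UNIV :: real set)"
      using nat_sets_lepoll_reals01 subset_imp_lepoll[of "{0..<1::real}" UNIV] lepoll_trans by blast
    finally have "(UNIV :: (nat \<Rightarrow> nat \<Rightarrow> bool) set) \<lesssim> (UNIV :: real set)" .
    then show ?thesis
      by (meson image_lepoll lepoll_trans subset_UNIV subset_imp_lepoll)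
  qed
  moreover have "internal V A \<and> A \<notin> hN" if A: "A \<in> sec ` \<R>" for A
  proof -
    obtain R where R: "R \<in> \<R>" "A = sec R"
      using A by blast
    then obtain y where "ext_mem V y A"
      using fin[of "{R}"] by auto
    then show ?thesis
      using R sec(1) atoms_empty[OF ext_superstructure height] by blast
  qed
  moreover have "\<exists>y. \<forall>A\<in>G. ext_mem V y A" if G: "G \<subseteq> sec ` \<R>" "finite G" for G
  proof -
    obtain F where "F \<subseteq> \<R>" "finite F" "G = sec ` F"
      using finite_subset_image[OF G(2,1)] by blast
    then show ?thesis
      using fin by auto
  qed
  ultimately obtain y where y: "\<forall>A\<in>sec ` \<R>. ext_mem V y A"
    using saturated unfolding continuum_plus_saturated_def by (metis (no_types, lifting))
  moreover obtain R where "R \<in> \<R>"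
    using False by blast
  ultimately show ?thesis
    using sec(2) by auto
qed

section \<open>Sections of extended relations and their finite cardinality bounds\<close>

definition Section :: "(nat \<Rightarrow> nat \<Rightarrow> bool) \<Rightarrow> 't \<Rightarrow> 't set" where
  "Section R x = {y \<in> hN. star2 R x y}"

text \<open>Distinct points of the section are values of functions that differ almost everywhere,
  since only finitely many inequalities are involved. Conversely, injections chosen number by number
  give distinct points.\<close>

lemma lepoll_Section_iff:
  assumes x: "x \<in> hN"
  shows "{..<k::nat} \<lesssim> Section R x \<longleftrightarrow> eventually (\<lambda>n. {..<k} \<lesssim> {m. 1 \<le> m \<and> R n m}) (germ x)"
proof
  assume "{..<k} \<lesssim> Section R x"
  then obtain e where e: "inj_on e {..<k}" "e ` {..<k} \<subseteq> Section R x"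
    unfolding lepoll_def by blast
  have "finite (insert x (e ` {..<k}))" "insert x (e ` {..<k}) \<subseteq> hN"
    using e(2) x by (auto simp: Section_def)
  from star_fun_representation[OF this] obtain w g where w: "w \<in> hN"
      and g_all: "\<forall>y\<in>insert x (e ` {..<k}). pos_fun (g y) \<and> y = star_fun (g y) w"
    by (elim bexE exE) (rule that)
  note g = bspec[OF g_all]
  have pos_e: "pos_fun (g (e i))" if "i < k" for i
    using g[of "e i"] that by blast
  have 1: "eventually (\<lambda>n. \<forall>i\<in>{..<k}. R (g x n) (g (e i) n)) (germ w)"
  proof (rule eventually_ball_finite, simp, intro ballI)
    fix i assume i: "i \<in> {..<k}"
    then have "star2 R (star_fun (g x) w) (star_fun (g (e i)) w)"
      using g[of x] g[of "e i"] e(2) by (auto simp: Section_def)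
    then show "eventually (\<lambda>n. R (g x n) (g (e i) n)) (germ w)"
      using g[of x] g[of "e i"] w i by (subst (asm) star2_star_fun) auto
  qed
  have 2: "eventually (\<lambda>n. \<forall>i\<in>{..<k}. \<forall>j\<in>{..<k}. i \<noteq> j \<longrightarrow> g (e i) n \<noteq> g (e j) n) (germ w)"
  proof (intro eventually_ball_finite finite_lessThan ballI)
    fix i j assume ij: "i \<in> {..<k}" "j \<in> {..<k}"
    show "eventually (\<lambda>n. i \<noteq> j \<longrightarrow> g (e i) n \<noteq> g (e j) n) (germ w)"
    proof (cases "i = j")
      case False
      then have "star_fun (g (e i)) w \<noteq> star_fun (g (e j)) w"
        using ij e(1) g[of "e i"] g[of "e j"] by (auto simp: inj_on_def)
      then have "eventually (\<lambda>n. g (e i) n \<noteq> g (e j) n) (germ w)"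
        unfolding eventually_germ_not[OF w] using ij w pos_e star_fun_eq_iff by blast
      then show ?thesis by (rule eventually_mono) simp
    qed simp
  qed
  have "eventually (\<lambda>n. {..<k} \<lesssim> {m. 1 \<le> m \<and> R (g x n) m}) (germ w)"
    using 1 2 eventually_germ_pos[OF w]
  proof eventually_elim
    case (elim n)
    have "inj_on (\<lambda>i. g (e i) n) {..<k}"
      using elim(2) unfolding inj_on_def by blast
    moreover have "(\<lambda>i. g (e i) n) ` {..<k} \<subseteq> {m. 1 \<le> m \<and> R (g x n) m}"
      using elim(1,3) pos_e by blast
    ultimately show ?case
      unfolding lepoll_def by blast
  qed
  then show "eventually (\<lambda>n. {..<k} \<lesssim> {m. 1 \<le> m \<and> R n m}) (germ x)"
    using eventually_germ_star_fun[of "g x" w "\<lambda>n. {..<k} \<lesssim> {m. 1 \<le> m \<and> R n m}"] g[of x] w by simp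
next
  assume ev: "eventually (\<lambda>n. {..<k} \<lesssim> {m. 1 \<le> m \<and> R n m}) (germ x)"
  define E where "E n = (SOME e. inj_on e {..<k} \<and> e ` {..<k} \<subseteq> {m. 1 \<le> m \<and> R n m})" for n
  \<comment> \<open>Replaces values that are not positive by 1, since only positive functions
    extend. Nothing changes almost everywhere.\<close>
  define f where "f i n = (if 1 \<le> E n i then E n i else 1)" for i n
  have pos: "pos_fun (f i)" for i
    by (auto simp: f_def)
  have E: "eventually (\<lambda>n. inj_on (\<lambda>i. f i n) {..<k} \<and> (\<forall>i<k. R n (f i n))) (germ x)"
    using ev
  proof eventually_elim
    case (elim n)
    then have "inj_on (E n) {..<k} \<and> E n ` {..<k} \<subseteq> {m. 1 \<le> m \<and> R n m}"
      unfolding lepoll_def E_def by (rule someI_ex)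
    then show ?case
      by (auto simp: f_def inj_on_def image_subset_iff)
  qed
  have "inj_on (\<lambda>i. star_fun (f i) x) {..<k}"
  proof (rule inj_onI)
    fix i j assume ij: "i \<in> {..<k}" "j \<in> {..<k}" "star_fun (f i) x = star_fun (f j) x"
    then have "eventually (\<lambda>n. f i n = f j n) (germ x)"
      using star_fun_eq_iff[OF pos pos x] by blast
    with E have "eventually (\<lambda>n. i = j) (germ x)"
      by eventually_elim (use ij in \<open>auto simp: inj_on_def\<close>)
    then show "i = j"
      using eventually_germ_not[OF x, of "\<lambda>_. i = j"] by (cases "i = j") auto
  qed
  moreover have "star_fun (f i) x \<in> Section R x" if "i < k" for i
  proof -
    have "eventually (\<lambda>n. R n (f i n)) (germ x)"
      using E by eventually_elim (use that in auto)
    then show ?thesis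
      unfolding Section_def using star2_right[OF x pos] star_fun_in[OF pos x] by simp
  qed
  ultimately show "{..<k} \<lesssim> Section R x"
    unfolding lepoll_def by blast
qed

end

section \<open>Cardinalities of internal sets\<close>

lemma lepoll_lessThan_iff_le: "{..<k::nat} \<lesssim> {..<n::nat} \<longleftrightarrow> k \<le> n"
  by (simp add: lepoll_iff_card_le)

lemma infinite_iff_lessThan_lepoll: "infinite S \<longleftrightarrow> (\<forall>k::nat. {..<k} \<lesssim> S)"
proof
  assume "infinite S"
  then have "(UNIV :: nat set) \<lesssim> S"
    by (simp add: infinite_le_lepoll)
  then show "\<forall>k::nat. {..<k} \<lesssim> S"
    by (meson lepoll_trans subset_UNIV subset_imp_lepoll)
next
  assume all: "\<forall>k::nat. {..<k} \<lesssim> S"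
  show "infinite S"
  proof
    assume "finite S"
    then show False
      using all[rule_format, of "Suc (card S)"] by (simp add: lepoll_iff_card_le)
  qed
qed

lemma eqpoll_card_lessThan: "finite S \<Longrightarrow> S \<approx> {..<card S}"
  by (simp add: eqpoll_iff_finite_card)

section \<open>Infinite structures for the language of equality\<close>

abbreviation pure_language :: fo_language where
  "pure_language \<equiv> \<lparr>rel_arities = [], fun_arities = []\<rparr>"

text \<open>The back-and-forth step: \<open>x\<close> either equals a value already named or is new,
  and an infinite \<open>B\<close> always has room for another new value.\<close>

lemma extend_equality_type:
  assumes "infinite B" "e' ` F \<subseteq> B" "finite F" "x \<in> A" "\<forall>i\<in>F. \<forall>j\<in>F. e i = e j \<longleftrightarrow> e' i = e' j"
  shows "\<exists>y\<in>B. \<forall>j\<in>F. \<forall>k\<in>F. (e(i := x)) j = (e(i := x)) k \<longleftrightarrow> (e'(i := y)) j = (e'(i := y)) k"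
proof (cases "\<exists>j\<in>F. j \<noteq> i \<and> x = e j")
  case True
  then obtain j where "j \<in> F" "j \<noteq> i" "x = e j" by blast
  then show ?thesis
    using assms(2,5) by (intro bexI[of _ "e' j"]) auto
next
  case False
  have "infinite (B - e' ` F)"
    using assms(1,3) by (simp add: Diff_infinite_finite)
  then obtain y where "y \<in> B - e' ` F"
    using infinite_imp_nonempty by blast
  then show ?thesis
    using assms(5) False by (intro bexI[of _ y]) auto
qed

text \<open>Terms of this language are variables, so atomic formulas only compare variables. The
  quantifier step is \<open>extend_equality_type\<close>, and the finite set of relevant variables
  can be kept there.\<close>

lemma fo_sat_pure_language:
  assumes "formula_ok pure_language \<phi>"
  shows "\<exists>F. finite F \<and> (\<forall>(M :: 'a fo_structure) (N :: 'a fo_structure) e e'.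
    infinite (dom M) \<longrightarrow> infinite (dom N) \<longrightarrow> range e \<subseteq> dom M \<longrightarrow> range e' \<subseteq> dom N \<longrightarrow>
    (\<forall>i\<in>F. \<forall>j\<in>F. e i = e j \<longleftrightarrow> e' i = e' j) \<longrightarrow> (fo_sat M \<phi> e \<longleftrightarrow> fo_sat N \<phi> e'))"
    (is "\<exists>F. finite F \<and> ?D F \<phi>")
  using assms
proof (induction \<phi>)
  case (FRel r ts)
  then show ?case by simp
next
  case (FEq s t)
  then obtain i j where "s = FVar i" "t = FVar j"
    by (cases s; cases t) auto
  then show ?case
    by (intro exI[of _ "{i, j}"]) simp
next
  case (FNeg \<phi>)
  then show ?case by simp
next
  case (FConj \<phi> \<psi>)
  then have ok: "formula_ok pure_language \<phi>" "formula_ok pure_language \<psi>"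
    by simp_all
  obtain F where F: "finite F" "?D F \<phi>"
    using FConj.IH(1)[OF ok(1)] by (elim exE conjE) (rule that)
  obtain G where G: "finite G" "?D G \<psi>"
    using FConj.IH(2)[OF ok(2)] by (elim exE conjE) (rule that)
  show ?case
  proof (intro exI[of _ "F \<union> G"] conjI allI impI)
    show "finite (F \<union> G)" using F G by simp
    fix M N :: "'a fo_structure" and e e'
    assume *: "infinite (dom M)" "infinite (dom N)" "range e \<subseteq> dom M" "range e' \<subseteq> dom N"
      "\<forall>i\<in>F \<union> G. \<forall>j\<in>F \<union> G. e i = e j \<longleftrightarrow> e' i = e' j"
    have "fo_sat M \<phi> e \<longleftrightarrow> fo_sat N \<phi> e'"
      by (rule F(2)[rule_format]) (use * in blast)+
    moreover have "fo_sat M \<psi> e \<longleftrightarrow> fo_sat N \<psi> e'"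
      by (rule G(2)[rule_format]) (use * in blast)+
    ultimately show "fo_sat M (FConj \<phi> \<psi>) e \<longleftrightarrow> fo_sat N (FConj \<phi> \<psi>) e'"
      by simp
  qed
next
  case (FAll i \<phi>)
  then have ok: "formula_ok pure_language \<phi>"
    by simp
  obtain F where F: "finite F" "?D F \<phi>"
    using FAll.IH[OF ok] by (elim exE conjE) (rule that)
  \<comment> \<open>One implication is enough, as the hypotheses are symmetric in the two
    structures.\<close>
  have *: "fo_sat N (FAll i \<phi>) e'"
    if that: "infinite (dom M)" "infinite (dom N)" "range e \<subseteq> dom M" "range e' \<subseteq> dom N"
      "\<forall>i\<in>F. \<forall>j\<in>F. e i = e j \<longleftrightarrow> e' i = e' j" and sat: "fo_sat M (FAll i \<phi>) e"
    for M N :: "'a fo_structure" and e e'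
    unfolding fo_sat.simps
  proof
    fix y assume y: "y \<in> dom N"
    have "\<exists>x\<in>dom M. \<forall>j\<in>F. \<forall>k\<in>F. (e'(i := y)) j = (e'(i := y)) k \<longleftrightarrow> (e(i := x)) j = (e(i := x)) k"
      by (rule extend_equality_type[OF that(1) _ F(1) y]) (use that in auto)
    then obtain x where x: "x \<in> dom M"
        "\<forall>j\<in>F. \<forall>k\<in>F. (e(i := x)) j = (e(i := x)) k \<longleftrightarrow> (e'(i := y)) j = (e'(i := y)) k"
      by metis
    have "range (e(i := x)) \<subseteq> dom M" "range (e'(i := y)) \<subseteq> dom N"
      using that(3,4) x(1) y by auto
    then have "fo_sat M \<phi> (e(i := x)) \<longleftrightarrow> fo_sat N \<phi> (e'(i := y))"
      using F(2)[rule_format, OF that(1,2)] x(2) by blast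
    then show "fo_sat N \<phi> (e'(i := y))"
      using sat x(1) by simp
  qed
  show ?case
  proof (intro exI[of _ F] conjI allI impI F(1))
    fix M N :: "'a fo_structure" and e e'
    assume a: "infinite (dom M)" "infinite (dom N)" "range e \<subseteq> dom M" "range e' \<subseteq> dom N"
      "\<forall>i\<in>F. \<forall>j\<in>F. e i = e j \<longleftrightarrow> e' i = e' j"
    have "\<forall>i\<in>F. \<forall>j\<in>F. e' i = e' j \<longleftrightarrow> e i = e j"
      using a(5) by blast
    then show "fo_sat M (FAll i \<phi>) e \<longleftrightarrow> fo_sat N (FAll i \<phi>) e'"
      using *[OF a] *[OF a(2,1,4,3)] by blast
  qed
qed

lemma infinite_elementarily_equivalent:
  fixes M N :: "'a fo_structure"
  assumes "infinite (dom M)" "infinite (dom N)"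
  shows "elementarily_equivalent pure_language M N"
proof -
  have *: "holds_in N \<phi>" if inf: "infinite (dom M)" "infinite (dom N)"
    and ok: "formula_ok pure_language \<phi>" and M: "holds_in M \<phi>"
    for M N :: "'a fo_structure" and \<phi>
    unfolding holds_in_def
  proof (intro allI impI)
    fix e' :: "nat \<Rightarrow> 'a" assume e': "range e' \<subseteq> dom N"
    obtain F where F: "finite F" "\<forall>(M :: 'a fo_structure) (N :: 'a fo_structure) e e'.
      infinite (dom M) \<longrightarrow> infinite (dom N) \<longrightarrow> range e \<subseteq> dom M \<longrightarrow> range e' \<subseteq> dom N \<longrightarrow>
      (\<forall>i\<in>F. \<forall>j\<in>F. e i = e j \<longleftrightarrow> e' i = e' j) \<longrightarrow> (fo_sat M \<phi> e \<longleftrightarrow> fo_sat N \<phi> e')"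
      using fo_sat_pure_language[OF ok] by (elim exE conjE) (rule that)
    have "e' ` F \<lesssim> dom M"
      using F(1) inf(1) finite_lepoll_infinite by blast
    then obtain g where g: "inj_on g (e' ` F)" "g ` e' ` F \<subseteq> dom M"
      unfolding lepoll_def by blast
    obtain m where "m \<in> dom M"
      using inf(1) infinite_imp_nonempty by blast
    \<comment> \<open>Copies the finite equality pattern of \<open>e'\<close> on \<open>F\<close>
      into the other structure. The point \<open>m\<close> only fills the remaining
      variables.\<close>
    define e where "e i = (if i \<in> F then g (e' i) else m)" for i
    have e: "range e \<subseteq> dom M"
      using g(2) \<open>m \<in> dom M\<close> by (auto simp: e_def)
    have agree: "\<forall>i\<in>F. \<forall>j\<in>F. e i = e j \<longleftrightarrow> e' i = e' j"
      using g(1) by (auto simp: e_def inj_on_def)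
    have "fo_sat M \<phi> e \<longleftrightarrow> fo_sat N \<phi> e'"
      by (rule F(2)[rule_format, OF inf e e']) (use agree in blast)
    then show "fo_sat N \<phi> e'"
      using M e unfolding holds_in_def by blast
  qed
  show ?thesis
    unfolding elementarily_equivalent_def using *[OF assms] *[OF assms(2,1)] by blast
qed

context saturated_extension
begin

lemma Section_internally_presented:
  assumes "x \<in> hN" "Section R x \<noteq> {}"
  shows "internally_presented V pure_language
    \<lparr>dom = Section R x, rel = \<lambda>_ _. False, fn = \<lambda>_ _. undefined\<rparr>"
proof -
  obtain v where v: "internal V v" "\<And>y. ext_mem V y v \<longleftrightarrow> y \<in> hN \<and> star2 R x y"
    using internal_section[OF assms(1)] by blast
  moreover have "v \<notin> hN"
    using assms(2) v(2) atoms_empty[OF ext_superstructure height] unfolding Section_def by blast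
  ultimately have "is_set_of (ext_mem V) hN v (Section R x)"
    unfolding is_set_of_def Section_def by blast
  then show ?thesis
    unfolding internally_presented_def fo_structure_for_def using assms(2) v(1) by auto
qed

text \<open>Without relation and function symbols an isomorphism is just a bijection, so the
  isomorphism property becomes an equality of cardinalities.\<close>

lemma infinite_Section_eqpoll:
  assumes "x \<in> hN" "y \<in> hN" "infinite (Section R x)" "infinite (Section S y)"
  shows "Section R x \<approx> Section S y"
proof -
  let ?M = "\<lparr>dom = Section R x, rel = \<lambda>_ _. False, fn = \<lambda>_ _. undefined\<rparr> :: 't fo_structure"
  let ?N = "\<lparr>dom = Section S y, rel = \<lambda>_ _. False, fn = \<lambda>_ _. undefined\<rparr> :: 't fo_structure"
  have "elementarily_equivalent pure_language ?M ?N"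
    by (rule infinite_elementarily_equivalent) (use assms in simp_all)
  moreover have "internally_presented V pure_language ?M" "internally_presented V pure_language ?N"
    by (rule Section_internally_presented; use assms infinite_imp_nonempty in blast)+
  ultimately have "fo_isomorphic pure_language ?M ?N"
    using isomorphism unfolding isomorphism_property_def by blast
  then show ?thesis
    unfolding fo_isomorphic_def eqpoll_def by auto
qed

lemma star2_snd:
  assumes "x \<in> hN" "y \<in> hN"
  shows "star2 (\<lambda>_. P) x y \<longleftrightarrow> eventually P (germ y)"
  by (rule star_fun_representation2[OF assms]) (simp add: star2_star_fun eventually_germ_star_fun)

section \<open>Infinite hypernaturals and the admissible cardinals\<close>

lemma infinite_hypernat_exists: "\<exists>z. z \<in> infinite_hypernats V"
proof -
  \<comment> \<open>The relations ignore their first argument, so \<open>hnat V 1\<close> is a dummy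
    parameter.\<close>
  have "\<exists>z\<in>hN. \<forall>R\<in>(\<lambda>k _ n. n \<noteq> k) ` posnats. star2 R (hnat V 1) z"
  proof (rule saturation)
    fix F :: "(nat \<Rightarrow> nat \<Rightarrow> bool) set"
    assume "finite F" "F \<subseteq> (\<lambda>k _ n. n \<noteq> k) ` posnats"
    then obtain K where K: "finite K" "F = (\<lambda>k _ n. n \<noteq> k) ` K"
      using finite_subset_image by metis
    have "infinite (posnats - K)"
      using K(1) infinite_Ici by (simp add: Diff_infinite_finite)
    then obtain n where "n \<in> posnats - K"
      using infinite_imp_nonempty by blast
    then show "eventually (\<lambda>m. \<exists>n\<ge>1. \<forall>R\<in>F. R m n) (germ (hnat V 1))"
      using K(2) by auto
  qed simp
  then obtain z where z: "z \<in> hN" "\<And>k. 1 \<le> k \<Longrightarrow> star2 (\<lambda>_ n. n \<noteq> k) (hnat V 1) z"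
    by auto
  have "z \<noteq> hnat V k" if "1 \<le> k" for k
    using z(2)[OF that] z(1) that star2_snd[of "hnat V 1" z "\<lambda>n. n \<noteq> k"] by auto
  then show ?thesis
    using z(1) unfolding infinite_hypernats_def by auto
qed

lemma eventually_ge_infinite:
  assumes "z \<in> infinite_hypernats V"
  shows "eventually (\<lambda>n. k \<le> n) (germ z)"
proof -
  have z: "z \<in> hN" "\<And>j. 1 \<le> j \<Longrightarrow> z \<noteq> hnat V j"
    using assms unfolding infinite_hypernats_def by auto
  have "eventually (\<lambda>n. \<forall>j\<in>{1..<k}. n \<noteq> j) (germ z)"
  proof (intro eventually_ball_finite ballI)
    fix j assume "j \<in> {1..<k}"
    then show "eventually (\<lambda>n. n \<noteq> j) (germ z)"
      unfolding eventually_germ_not[OF z(1)] using eventually_germ_const_iff z by simp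
  qed simp
  then show ?thesis
    using eventually_germ_pos[OF z(1)] by eventually_elim (metis atLeastLessThan_iff not_le)
qed

lemma hle_eq: "hle V = star2 (\<le>)"
  by (intro ext) (simp add: hle_def star2_def relation2_def)

text \<open>The order is turned around so that the bound \<open>z\<close> is the parameter of a
  section, which makes the initial segment comparable with every other infinite section. It is
  infinite because the germ of \<open>z\<close> exceeds each standard number.\<close>

lemma cardinal_set_infinity:
  obtains z where "z \<in> hN" "cardinal_set V \<infinity> = Section (\<lambda>z y. y \<le> z) z"
    "infinite (cardinal_set V \<infinity>)"
proof
  let ?z = "SOME z. z \<in> infinite_hypernats V"
  have z: "?z \<in> infinite_hypernats V"
    using infinite_hypernat_exists by (rule someI_ex)
  then show in_hN: "?z \<in> hN"
    unfolding infinite_hypernats_def by blast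
  show eq: "cardinal_set V \<infinity> = Section (\<lambda>z y. y \<le> z) ?z"
    unfolding Section_def using star2_converse in_hN by (auto simp: hle_eq)
  have "{..<k} \<lesssim> cardinal_set V \<infinity>" for k :: nat
    unfolding eq lepoll_Section_iff[OF in_hN]
    using eventually_ge_infinite[OF z, of k]
  proof eventually_elim
    case (elim n)
    have "{m. 1 \<le> m \<and> m \<le> n} = {1..n}"
      by auto
    then show ?case
      using elim by (simp add: lepoll_iff_card_le)
  qed
  then show "infinite (cardinal_set V \<infinity>)"
    unfolding infinite_iff_lessThan_lepoll by blast
qed

lemma cardinal_set_enat: "cardinal_set V (enat n) \<approx> {..<n}"
proof -
  have "inj_on (hnat V) {1..n}"
    using hnat_inj by (rule inj_on_subset) auto
  then have "cardinal_set V (enat n) \<approx> {1..n}"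
    by (simp add: inj_on_image_eqpoll_self)
  also have "{1..n} \<approx> {..<n}"
    by (simp add: eqpoll_iff_finite_card)
  finally show ?thesis .
qed

lemma lessThan_lepoll_cardinal_set: "{..<k} \<lesssim> cardinal_set V v \<longleftrightarrow> enat k \<le> v"
proof (cases v)
  case (enat n)
  then show ?thesis
    using cardinal_set_enat[of n] lepoll_trans2[OF _ cardinal_set_enat]
      lepoll_trans2[OF _ eqpoll_sym[OF cardinal_set_enat]] lepoll_lessThan_iff_le[of k n]
    by (metis enat_ord_simps(1))
next
  case infinity
  then show ?thesis
    using cardinal_set_infinity infinite_iff_lessThan_lepoll by (metis enat_ord_code(3))
qed

lemma cardinal_set_lepoll_iff: "cardinal_set V (enat k) \<lesssim> S \<longleftrightarrow> {..<k} \<lesssim> S"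
  using lepoll_trans1[OF cardinal_set_enat[of k], of S]
    lepoll_trans1[OF eqpoll_sym[OF cardinal_set_enat[of k]], of S] by blast

text \<open>As \<infinity> is the only infinite value, an element of \<open>enat\<close> is
  determined by the finite numbers below it. This reduces comparisons of pattern values to finite
  counts.\<close>

lemma enat_leI:
  assumes "\<And>k. enat k \<le> v \<Longrightarrow> enat k \<le> w"
  shows "v \<le> w"
proof (cases w)
  case (enat n)
  then have "\<not> enat (Suc n) \<le> v"
    using assms[of "Suc n"] by auto
  then show ?thesis
    using enat by (cases v) simp_all
qed simp

lemma enat_eqI:
  assumes "\<And>k. enat k \<le> v \<longleftrightarrow> enat k \<le> w"
  shows "v = w"
  by (rule antisym; rule enat_leI) (simp_all add: assms)

lemma eqpoll_cardinal_set_iff: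
  assumes "S \<approx> cardinal_set V v"
  shows "{..<k} \<lesssim> S \<longleftrightarrow> enat k \<le> v"
  unfolding lessThan_lepoll_cardinal_set[symmetric]
  using lepoll_trans2[OF _ assms] lepoll_trans2[OF _ eqpoll_sym[OF assms]] by blast

lemma cardinal_set_eqpoll_unique:
  assumes "S \<approx> cardinal_set V v" "S \<approx> cardinal_set V w"
  shows "v = w"
  using eqpoll_cardinal_set_iff[OF assms(1)] eqpoll_cardinal_set_iff[OF assms(2)] enat_eqI by blast

lemma finite_eqpoll_cardinal_set: "finite S \<Longrightarrow> S \<approx> cardinal_set V (enat (card S))"
  by (rule eqpoll_trans[OF eqpoll_card_lessThan eqpoll_sym[OF cardinal_set_enat]])

lemma Section_cardinal:
  assumes "x \<in> hN"
  shows "\<exists>v. Section R x \<approx> cardinal_set V v"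
proof (cases "finite (Section R x)")
  case True
  then show ?thesis
    using finite_eqpoll_cardinal_set by blast
next
  case False
  obtain z where "z \<in> hN" "cardinal_set V \<infinity> = Section (\<lambda>z y. y \<le> z) z"
      "infinite (cardinal_set V \<infinity>)"
    by (rule cardinal_set_infinity)
  then show ?thesis
    using infinite_Section_eqpoll[OF assms] False by metis
qed

end

section \<open>Prime powers exactly dividing a hypernatural\<close>

text \<open>Its cardinality is the counting function c_A. The clause \<open>p dvd n\<close> excludes
  the exponent 0, in agreement with hypernatural exponents, which start at 1.\<close>

definition exact_primes :: "nat set \<Rightarrow> nat \<Rightarrow> nat set" where
  "exact_primes A n = {p. prime p \<and> p dvd n \<and> p ^ multiplicity p n \<in> A}"

lemma finite_exact_primes: "1 \<le> n \<Longrightarrow> finite (exact_primes A n)"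
  unfolding exact_primes_def by (rule finite_subset[of _ "{..n}"]) (auto dest: dvd_imp_le)

lemma exact_primes_mono: "A \<subseteq> B \<Longrightarrow> exact_primes A n \<subseteq> exact_primes B n"
  unfolding exact_primes_def by auto

lemma multiplicity_eq_iff_decomposition:
  fixes p n a :: nat
  assumes "prime p" "1 \<le> n" 
  shows "a = multiplicity p n \<longleftrightarrow> (\<exists>m\<ge>1. n = p ^ a * m \<and> \<not> p dvd m)"
proof
  assume a: "a = multiplicity p n"
  obtain m where m: "n = p ^ a * m" "\<not> p dvd m"
    using multiplicity_decompose'[of n p] assms not_prime_unit[of p] a by auto
  moreover from this have "1 \<le> m"
    using assms by (cases m) auto
  ultimately show "\<exists>m\<ge>1. n = p ^ a * m \<and> \<not> p dvd m"
    by blast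
next
  assume "\<exists>m\<ge>1. n = p ^ a * m \<and> \<not> p dvd m"
  then obtain m where "n = p ^ a * m" "\<not> p dvd m" by blast
  then show "a = multiplicity p n"
    using multiplicity_decomposeI[of n p a m] assms(1) by auto
qed

context saturated_extension
begin

text \<open>A competing value \<open>z\<close> need not be a function of \<open>w\<close>. Both are
  therefore written over a finer base point \<open>u\<close>, where the two germs can be
  compared.\<close>

lemma the_star3:
  assumes F: "\<And>m n. 1 \<le> m \<Longrightarrow> 1 \<le> n \<Longrightarrow> 1 \<le> F m n"
    and "pos_fun f" "pos_fun g" "w \<in> hN"
  shows "(THE z. star3 (\<lambda>m n k. k = F m n) (star_fun f w) (star_fun g w) z) =
    star_fun (\<lambda>n. F (f n) (g n)) w"
proof (rule the_equality)
  show "star3 (\<lambda>m n k. k = F m n) (star_fun f w) (star_fun g w) (star_fun (\<lambda>n. F (f n) (g n)) w)"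
    using assms by (subst star3_star_fun) auto
next
  fix z assume z: "star3 (\<lambda>m n k. k = F m n) (star_fun f w) (star_fun g w) z"
  have "z \<in> hN"
    using star3_hypernats[OF z] by blast
  then obtain u i k where u: "u \<in> hN" "pos_fun i" "pos_fun k" "w = star_fun i u" "z = star_fun k u"
    using star_fun_representation2[OF assms(4)] by blast
  have "star3 (\<lambda>m n k. k = F m n) (star_fun (\<lambda>n. f (i n)) u) (star_fun (\<lambda>n. g (i n)) u) (star_fun k u)"
    using z assms(2,3) u by (simp add: star_fun_star_fun)
  then have "eventually (\<lambda>n. k n = F (f (i n)) (g (i n))) (germ u)"
    using assms(2,3) u by (subst (asm) star3_star_fun) auto
  then have "z = star_fun (\<lambda>n. F (f (i n)) (g (i n))) u"
    using assms u by (subst u(5), subst star_fun_eq_iff) auto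
  also have "\<dots> = star_fun (\<lambda>n. F (f n) (g n)) w"
    using assms u by (subst u(4), subst star_fun_star_fun) auto
  finally show "z = star_fun (\<lambda>n. F (f n) (g n)) w" .
qed

lemma hmult_star_fun:
  assumes "pos_fun f" "pos_fun g" "w \<in> hN"
  shows "hmult V (star_fun f w) (star_fun g w) = star_fun (\<lambda>n. f n * g n) w"
proof -
  have "{[m, n, m * n] |m n. m \<in> posnats \<and> n \<in> posnats} = relation3 (\<lambda>m n k. k = m * n)"
    by (auto simp: relation3_def Suc_le_eq One_nat_def)
  then show ?thesis
    using the_star3[of "(*)" f g w] assms by (simp add: hmult_def star3_def Suc_le_eq One_nat_def)
qed

lemma hpow_star_fun:
  assumes "pos_fun f" "pos_fun g" "w \<in> hN"
  shows "hpow V (star_fun f w) (star_fun g w) = star_fun (\<lambda>n. f n ^ g n) w"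
proof -
  have "{[m, n, m ^ n] |m n. m \<in> posnats \<and> n \<in> posnats} = relation3 (\<lambda>m n k. k = m ^ n)"
    by (auto simp: relation3_def Suc_le_eq One_nat_def)
  then show ?thesis
    using the_star3[of "(^)" f g w] assms by (simp add: hpow_def star3_def Suc_le_eq One_nat_def)
qed

lemma hpow_in:
  assumes "x \<in> hN" "y \<in> hN"
  shows "hpow V x y \<in> hN"
  by (rule star_fun_representation2[OF assms]) (simp add: hpow_star_fun star_fun_in)

lemma hprimes_subset: "hprimes V \<subseteq> hN"
  unfolding hprimes_def by (rule star_set_subset) (auto simp: prime_ge_1_nat)

lemma star_fun_hprimes:
  assumes "pos_fun f" "w \<in> hN"
  shows "star_fun f w \<in> hprimes V \<longleftrightarrow> eventually (\<lambda>n. prime (f n)) (germ w)"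
proof -
  have "{p::nat. prime p} \<subseteq> posnats"
    by (auto simp: prime_ge_1_nat)
  then show ?thesis
    unfolding hprimes_def
    using assms mem_star_set_iff[of "{p. prime p}" "star_fun f w"]
    by (simp add: star_fun_in eventually_germ_star_fun)
qed

lemma hdvd_eq: "hdvd V = star2 (dvd)"
  by (intro ext) (simp add: hdvd_def star2_def relation2_def)

lemma exactly_divides_hypernats:
  assumes "exactly_divides V p a x"
  shows "p \<in> hN" "a \<in> hN"
  using assms hprimes_subset unfolding exactly_divides_def by auto

text \<open>The cofactor is the only hidden quantifier. Given a cofactor, it is moved with
  \<open>w\<close> to a common base point; in the other direction it is recovered as a
  quotient.\<close>

lemma exactly_divides_star_fun:
  assumes "pos_fun f" "pos_fun g" "pos_fun e" "w \<in> hN"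
  shows "exactly_divides V (star_fun g w) (star_fun e w) (star_fun f w) \<longleftrightarrow>
    eventually (\<lambda>n. prime (g n) \<and> e n = multiplicity (g n) (f n)) (germ w)"
proof
  assume "exactly_divides V (star_fun g w) (star_fun e w) (star_fun f w)"
  then obtain x' where x': "x' \<in> hN" "star_fun g w \<in> hprimes V"
      "star_fun f w = hmult V (hpow V (star_fun g w) (star_fun e w)) x'" "\<not> hdvd V (star_fun g w) x'"
    unfolding exactly_divides_def by blast
  obtain u i k where u: "u \<in> hN" "pos_fun i" "pos_fun k" "w = star_fun i u" "x' = star_fun k u"
    using star_fun_representation2[OF assms(4) x'(1)] by blast
  note comp = star_fun_star_fun[OF _ u(2,1)]
  have pos: "pos_fun (\<lambda>n. g (i n) ^ e (i n))" "pos_fun (\<lambda>n. g (i n) ^ e (i n) * k n)"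
      "pos_fun (\<lambda>n. f (i n))" "pos_fun (\<lambda>n. g (i n))" "pos_fun (\<lambda>n. e (i n))"
    using assms(1-3) u(2,3) by (auto simp: Suc_le_eq One_nat_def)
  have 1: "eventually (\<lambda>n. prime (g (i n))) (germ u)"
    using x'(2) assms(2) u(1) pos unfolding u(4) by (simp add: comp star_fun_hprimes)
  have 2: "eventually (\<lambda>n. f (i n) = g (i n) ^ e (i n) * k n) (germ u)"
    using x'(3) assms(1-3) u(1,3) pos unfolding u(4,5)
    by (simp add: comp hpow_star_fun hmult_star_fun star_fun_eq_iff)
  have 3: "eventually (\<lambda>n. \<not> g (i n) dvd k n) (germ u)"
    using x'(4) assms(2) u(1,3) pos unfolding u(4,5) eventually_germ_not[OF u(1)]
    by (simp add: comp hdvd_eq star2_star_fun)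
  have "eventually (\<lambda>n. prime (g (i n)) \<and> e (i n) = multiplicity (g (i n)) (f (i n))) (germ u)"
    using 1 2 3 eventually_germ_pos[OF u(1)]
  proof eventually_elim
    case (elim n)
    then have "1 \<le> f (i n)" "1 \<le> k n"
      using pos(3) u(3) by blast+
    then show ?case
      using elim multiplicity_eq_iff_decomposition by blast
  qed
  then show "eventually (\<lambda>n. prime (g n) \<and> e n = multiplicity (g n) (f n)) (germ w)"
    unfolding u(4) eventually_germ_star_fun[OF u(2,1)] .
next
  assume ev: "eventually (\<lambda>n. prime (g n) \<and> e n = multiplicity (g n) (f n)) (germ w)"
  \<comment> \<open>The quotient is exact almost everywhere; the maximum with 1 only makes the
    function positive elsewhere.\<close>
  define k where "k n = max 1 (f n div g n ^ e n)" for n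
  have pos: "pos_fun k" "pos_fun (\<lambda>n. g n ^ e n)" "pos_fun (\<lambda>n. g n ^ e n * k n)"
    using assms(2) by (auto simp: k_def Suc_le_eq One_nat_def)
  have *: "eventually (\<lambda>n. prime (g n) \<and> f n = g n ^ e n * k n \<and> \<not> g n dvd k n) (germ w)"
    using ev eventually_germ_pos[OF assms(4)]
  proof eventually_elim
    case (elim n)
    then obtain m where m: "m \<ge> 1" "f n = g n ^ e n * m" "\<not> g n dvd m"
      using assms(1) multiplicity_eq_iff_decomposition by blast
    have "0 < g n ^ e n"
      using elim(1) prime_gt_0_nat[of "g n"] by simp
    then have "f n div g n ^ e n = m"
      by (subst m(2)) simp
    then have "k n = m"
      using m(1) by (simp add: k_def)
    then show ?case
      using m elim by blast
  qed
  have "star_fun g w \<in> hprimes V"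
    unfolding star_fun_hprimes[OF assms(2,4)] using * by (rule eventually_mono) blast
  moreover have "star_fun f w = hmult V (hpow V (star_fun g w) (star_fun e w)) (star_fun k w)"
  proof -
    have "eventually (\<lambda>n. f n = g n ^ e n * k n) (germ w)"
      using * by (rule eventually_mono) blast
    then show ?thesis
      using assms pos by (simp add: hpow_star_fun hmult_star_fun star_fun_eq_iff)
  qed
  moreover have "\<not> hdvd V (star_fun g w) (star_fun k w)"
  proof -
    have "eventually (\<lambda>n. \<not> g n dvd k n) (germ w)"
      using * by (rule eventually_mono) blast
    then show ?thesis
      unfolding eventually_germ_not[OF assms(4)] hdvd_eq star2_star_fun[OF assms(2) pos(1) assms(4)] .
  qed
  ultimately show "exactly_divides V (star_fun g w) (star_fun e w) (star_fun f w)"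
    unfolding exactly_divides_def
    using star_fun_in[OF assms(3,4)] star_fun_in[OF pos(1) assms(4)] by blast
qed

definition exact_powers :: "nat set \<Rightarrow> 't \<Rightarrow> ('t \<times> 't) set" where
  "exact_powers A x = {(p, a). exactly_divides V p a x \<and> hpow V p a \<in> star_set V A}"

lemma exact_powers_star_fun:
  assumes "pos_fun f" "pos_fun g" "pos_fun e" "w \<in> hN" "A \<subseteq> posnats"
  shows "(star_fun g w, star_fun e w) \<in> exact_powers A (star_fun f w) \<longleftrightarrow>
    eventually (\<lambda>n. g n \<in> exact_primes A (f n) \<and> e n = multiplicity (g n) (f n)) (germ w)"
proof -
  have pos: "pos_fun (\<lambda>n. g n ^ e n)"
    using assms(2) by (auto simp: Suc_le_eq One_nat_def)
  have "(star_fun g w, star_fun e w) \<in> exact_powers A (star_fun f w) \<longleftrightarrow>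
    eventually (\<lambda>n. (prime (g n) \<and> e n = multiplicity (g n) (f n)) \<and> g n ^ e n \<in> A) (germ w)"
    using assms pos unfolding exact_powers_def
    by (simp add: exactly_divides_star_fun eventually_conj_iff hpow_star_fun
        mem_star_set_iff[OF assms(5)] star_fun_in eventually_germ_star_fun)
  also have "\<dots> \<longleftrightarrow> eventually (\<lambda>n. g n \<in> exact_primes A (f n) \<and> e n = multiplicity (g n) (f n)) (germ w)"
  proof (rule eventually_cong[OF eventually_germ_pos[OF assms(4)]])
    fix n :: nat assume "1 \<le> n"
    then have "1 \<le> e n"
      using assms(3) by blast
    then have "g n dvd f n" if "e n = multiplicity (g n) (f n)"
      using that not_dvd_imp_multiplicity_0[of "g n" "f n"] by fastforce
    then show "(prime (g n) \<and> e n = multiplicity (g n) (f n)) \<and> g n ^ e n \<in> A \<longleftrightarrow>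
        g n \<in> exact_primes A (f n) \<and> e n = multiplicity (g n) (f n)"
      unfolding exact_primes_def by auto
  qed
  finally show ?thesis .
qed

text \<open>The exponent is determined by the prime, namely as a multiplicity. Counting primes
  instead of pairs turns the set into a section of a relation between numbers, to which the
  cardinality results apply.\<close>

lemma bij_betw_exact_powers:
  assumes "x \<in> hN" "A \<subseteq> posnats"
  shows "bij_betw fst (exact_powers A x) (Section (\<lambda>n p. p \<in> exact_primes A n) x)"
proof (rule bij_betw_imageI)
  show "inj_on fst (exact_powers A x)"
  proof (rule inj_onI, clarify)
    fix p a q b
    assume D: "(p, a) \<in> exact_powers A x" "(q, b) \<in> exact_powers A x" and "fst (p, a) = fst (q, b)"
    then have "q = p" by simp
    have "finite {x, p, a, b}" "{x, p, a, b} \<subseteq> hN"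
      using D exactly_divides_hypernats assms(1) unfolding exact_powers_def by auto
    from star_fun_representation[OF this] obtain w g where w: "w \<in> hN"
        and g: "\<forall>y\<in>{x, p, a, b}. pos_fun (g y) \<and> y = star_fun (g y) w"
      by (elim bexE exE) (rule that)
    have pos: "pos_fun (g x)" "pos_fun (g p)" "pos_fun (g a)" "pos_fun (g b)"
      and eq: "star_fun (g x) w = x" "star_fun (g p) w = p" "star_fun (g a) w = a" "star_fun (g b) w = b"
      using g by simp_all
    have "eventually (\<lambda>n. g a n = multiplicity (g p n) (g x n)) (germ w)"
      using exact_powers_star_fun[OF pos(1-3) w assms(2)] D(1) eq by (simp add: eventually_conj_iff)
    moreover have "eventually (\<lambda>n. g b n = multiplicity (g p n) (g x n)) (germ w)"
      using exact_powers_star_fun[OF pos(1,2,4) w assms(2)] D(2) eq \<open>q = p\<close>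
      by (simp add: eventually_conj_iff)
    ultimately have "eventually (\<lambda>n. g a n = g b n) (germ w)"
      by eventually_elim simp
    then have "a = b"
      using star_fun_eq_iff[OF pos(3,4) w] eq by simp
    then show "p = q \<and> a = b"
      using \<open>q = p\<close> by simp
  qed
next
  show "fst ` exact_powers A x = Section (\<lambda>n p. p \<in> exact_primes A n) x"
  proof (intro equalityI subsetI)
    fix p assume "p \<in> fst ` exact_powers A x"
    then obtain a where D: "(p, a) \<in> exact_powers A x"
      by auto
    then have in_hN: "p \<in> hN" "a \<in> hN"
      using exactly_divides_hypernats unfolding exact_powers_def by auto
    obtain w f g e where w: "w \<in> hN" "pos_fun f" "pos_fun g" "pos_fun e"
        "x = star_fun f w" "p = star_fun g w" "a = star_fun e w"
      by (rule star_fun_representation3[OF assms(1) in_hN])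
    have "eventually (\<lambda>n. g n \<in> exact_primes A (f n) \<and> e n = multiplicity (g n) (f n)) (germ w)"
      using D exact_powers_star_fun[OF w(2,3,4,1) assms(2)] w(5-7) by simp
    then have "eventually (\<lambda>n. g n \<in> exact_primes A (f n)) (germ w)"
      by (rule eventually_mono) blast
    then show "p \<in> Section (\<lambda>n p. p \<in> exact_primes A n) x"
      unfolding Section_def using w in_hN by (simp add: star2_star_fun)
  next
    fix p assume "p \<in> Section (\<lambda>n p. p \<in> exact_primes A n) x"
    then have p: "p \<in> hN" "star2 (\<lambda>n p. p \<in> exact_primes A n) x p"
      unfolding Section_def by auto
    obtain w f g where w: "w \<in> hN" "pos_fun f" "pos_fun g" "x = star_fun f w" "p = star_fun g w"
      by (rule star_fun_representation2[OF assms(1) p(1)])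
    define e where "e n = max 1 (multiplicity (g n) (f n))" for n
    have e: "pos_fun e"
      by (auto simp: e_def)
    have "eventually (\<lambda>n. g n \<in> exact_primes A (f n)) (germ w)"
      using p(2) w by (simp add: star2_star_fun)
    then have "eventually (\<lambda>n. g n \<in> exact_primes A (f n) \<and> e n = multiplicity (g n) (f n)) (germ w)"
      using eventually_germ_pos[OF w(1)]
    proof eventually_elim
      case (elim n)
      then have "prime (g n)" "g n dvd f n" "f n \<noteq> 0"
        using w(2) by (auto simp: exact_primes_def)
      then have "1 \<le> multiplicity (g n) (f n)"
        using not_prime_unit by (intro multiplicity_geI) auto
      then show ?case
        using elim by (simp add: e_def)
    qed
    then have "(p, star_fun e w) \<in> exact_powers A x"
      using exact_powers_star_fun[OF w(2,3) e w(1) assms(2)] w(4,5) by simp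
    then show "p \<in> fst ` exact_powers A x"
      by force
  qed
qed

lemma exact_powers_cardinal:
  assumes "x \<in> hN" "A \<subseteq> posnats"
  shows "\<exists>v. exact_powers A x \<approx> cardinal_set V v"
proof -
  have "exact_powers A x \<approx> Section (\<lambda>n p. p \<in> exact_primes A n) x"
    using bij_betw_exact_powers[OF assms] unfolding eqpoll_def by blast
  then show ?thesis
    using Section_cardinal[OF assms(1)] eqpoll_trans by blast
qed

lemma lepoll_exact_powers_iff:
  assumes "x \<in> hN" "A \<subseteq> posnats"
  shows "{..<k::nat} \<lesssim> exact_powers A x \<longleftrightarrow> eventually (\<lambda>n. k \<le> card (exact_primes A n)) (germ x)"
proof -
  have eq: "exact_powers A x \<approx> Section (\<lambda>n p. p \<in> exact_primes A n) x"
    using bij_betw_exact_powers[OF assms] unfolding eqpoll_def by blast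
  have "{..<k} \<lesssim> exact_powers A x \<longleftrightarrow> {..<k} \<lesssim> Section (\<lambda>n p. p \<in> exact_primes A n) x"
    using lepoll_trans2[OF _ eq] lepoll_trans2[OF _ eqpoll_sym[OF eq]] by blast
  also have "\<dots> \<longleftrightarrow> eventually (\<lambda>n. {..<k} \<lesssim> {m. 1 \<le> m \<and> m \<in> exact_primes A n}) (germ x)"
    by (rule lepoll_Section_iff[OF assms(1)])
  also have "\<dots> \<longleftrightarrow> eventually (\<lambda>n. k \<le> card (exact_primes A n)) (germ x)"
  proof (rule eventually_cong[OF eventually_germ_pos[OF assms(1)]])
    fix n :: nat assume "1 \<le> n"
    moreover have "{m. 1 \<le> m \<and> m \<in> exact_primes A n} = exact_primes A n"
      by (auto simp: exact_primes_def prime_ge_1_nat)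
    ultimately show "{..<k} \<lesssim> {m. 1 \<le> m \<and> m \<in> exact_primes A n} \<longleftrightarrow> k \<le> card (exact_primes A n)"
      by (simp add: lepoll_iff_card_le finite_exact_primes)
  qed
  finally show ?thesis .
qed

end

section \<open>Types and basic classes\<close>

lemma up_closure_supset: "A \<subseteq> posnats \<Longrightarrow> A \<subseteq> up_closure A"
  unfolding up_closure_def using dvd_refl by blast

lemma up_closure_in_up_sets:
  assumes "A \<subseteq> posnats" "A \<noteq> {}"
  shows "up_closure A \<in> up_sets"
proof -
  have "up_closure (up_closure A) = up_closure A"
    unfolding up_closure_def using dvd_refl dvd_trans by blast
  then show ?thesis
    using assms up_closure_supset[OF assms(1)] unfolding up_sets_def
    by (auto simp: up_closure_def)
qed

lemma prime_powers_subset: "prime_powers \<subseteq> posnats"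
  unfolding prime_powers_def by (auto simp: prime_gt_0_nat Suc_le_eq One_nat_def)

lemma convex_family_subset: "A \<in> convex_family \<Longrightarrow> A \<subseteq> posnats"
  unfolding convex_family_def using prime_powers_subset by blast

lemma up_set_dvd:
  assumes "W \<in> up_sets" "m \<in> W" "m dvd n" "1 \<le> n"
  shows "n \<in> W"
  using assms unfolding up_sets_def up_closure_def by blast

lemma prime_power_dvd_prime_power:
  fixes c q :: nat
  assumes "prime q" "c dvd q ^ n" "c \<noteq> 1"
  shows "c \<in> prime_powers"
proof -
  obtain i where i: "i \<le> n" "c = q ^ i"
    using assms(1,2) by (auto simp: divides_primepow_nat)
  with assms(3) have "i \<noteq> 0"
    by (cases i) auto
  then show ?thesis
    using i assms(1) unfolding prime_powers_def by (auto simp: Suc_le_eq One_nat_def)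
qed

lemma prime_powers_not_1: "1 \<notin> prime_powers"
  unfolding prime_powers_def by (auto simp: prime_nat_iff)

lemma dvd_prime_power_in_prime_powers:
  assumes "a dvd c" "c dvd b" "a \<in> prime_powers" "b \<in> prime_powers"
  shows "c \<in> prime_powers"
proof -
  obtain q n where "prime q" "b = q ^ n"
    using assms(4) unfolding prime_powers_def by blast
  moreover have "c \<noteq> 1"
    using assms(1,3) prime_powers_not_1 by auto
  ultimately show ?thesis
    using assms(2) prime_power_dvd_prime_power by blast
qed

lemma dvd_convex_prime_powers: "dvd_convex prime_powers"
  unfolding dvd_convex_def using dvd_prime_power_in_prime_powers by blast

lemma dvd_convex_Int: "dvd_convex A \<Longrightarrow> dvd_convex B \<Longrightarrow> dvd_convex (A \<inter> B)"
  unfolding dvd_convex_def by blast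

lemma dvd_convex_up_set: "W \<in> up_sets \<Longrightarrow> dvd_convex (prime_powers \<inter> W)"
  unfolding dvd_convex_def
  by (metis Int_iff atLeast_iff dvd_prime_power_in_prime_powers prime_powers_subset subsetD up_set_dvd)

lemma dvd_convex_compl_up_set: "W \<in> up_sets \<Longrightarrow> dvd_convex (prime_powers - W)"
  unfolding dvd_convex_def
  by (metis Diff_iff atLeast_iff dvd_prime_power_in_prime_powers prime_powers_subset subsetD up_set_dvd)

text \<open>These convex sets test only the base of a prime power. Through them a basic class
  determines its ultrafilter of primes.\<close>

definition powers_of :: "nat set \<Rightarrow> nat set" where
  "powers_of B = {p ^ n |p n. p \<in> B \<and> prime p \<and> 1 \<le> n}"

lemma prime_power_in_powers_of_iff:
  assumes "prime p" "1 \<le> n"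
  shows "p ^ n \<in> powers_of B \<longleftrightarrow> p \<in> B"
proof
  assume "p ^ n \<in> powers_of B"
  then obtain q m where q: "p ^ n = q ^ m" "q \<in> B" "prime q" "1 \<le> m"
    unfolding powers_of_def by blast
  then have "p dvd q ^ m"
    using assms by (metis One_nat_def Suc_le_eq dvd_power)
  then have "p = q"
    using q(3) assms(1) by (metis prime_dvd_power primes_dvd_imp_eq)
  then show "p \<in> B" using q by simp
qed (use assms in \<open>auto simp: powers_of_def\<close>)

lemma powers_of_subset: "powers_of B \<subseteq> prime_powers"
  unfolding powers_of_def prime_powers_def by auto

lemma dvd_convex_powers_of: "dvd_convex (powers_of B)"
  unfolding dvd_convex_def
proof (intro ballI allI impI)
  fix a b c assume abc: "a \<in> powers_of B" "b \<in> powers_of B" "a dvd c \<and> c dvd b"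
  then obtain p n where p: "b = p ^ n" "p \<in> B" "prime p" "1 \<le> n"
    unfolding powers_of_def by blast
  obtain i where i: "c = p ^ i"
    using p abc(3) by (auto simp: divides_primepow_nat)
  have "c \<noteq> 1"
    using abc powers_of_subset[of B] prime_powers_not_1 by auto
  then have "1 \<le> i"
    using i by (cases i) (auto simp: One_nat_def)
  then show "c \<in> powers_of B"
    using i p unfolding powers_of_def by blast
qed

context saturated_extension
begin

section \<open>Ultrafilters, generators and convex sets\<close>

lemma mem_tp:
  assumes "x \<in> hN"
  shows "A \<in> tp V x \<longleftrightarrow> A \<subseteq> posnats \<and> eventually (\<lambda>n. n \<in> A) (germ x)"
  unfolding tp_def using mem_star_set_iff[of A x] assms by blast

lemma eventually_germ_eq_tp:
  assumes "x \<in> hN"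
  shows "eventually P (germ x) \<longleftrightarrow> extent P \<in> tp V x"
  unfolding tp_def using eventually_germ[OF assms] by simp

lemma eventually_germ_False: "x \<in> hN \<Longrightarrow> \<not> eventually (\<lambda>_. False) (germ x)"
  using eventually_germ_not[of x "\<lambda>_. False"] by simp

lemma tp_ultrafilter:
  assumes "x \<in> hN"
  shows "tp V x \<in> ultrafilters"
  unfolding ultrafilters_def
proof (intro CollectI conjI ballI allI impI)
  show "tp V x \<subseteq> Pow posnats"
    unfolding tp_def by blast
  show "posnats \<in> tp V x"
    using eventually_germ_pos[OF assms] by (simp add: mem_tp[OF assms])
  show "{} \<notin> tp V x"
    using eventually_germ_False[OF assms] by (simp add: mem_tp[OF assms])
next
  fix A B assume "A \<in> tp V x" "B \<in> tp V x"
  then show "A \<inter> B \<in> tp V x"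
    by (auto simp: mem_tp[OF assms] eventually_conj_iff)
next
  fix A B assume "A \<in> tp V x" "A \<subseteq> B \<and> B \<subseteq> posnats"
  then show "B \<in> tp V x"
    unfolding mem_tp[OF assms] by (auto elim: eventually_mono)
next
  fix A :: "nat set" assume A: "A \<subseteq> posnats"
  have "eventually (\<lambda>n. n \<in> posnats - A) (germ x)" if "\<not> eventually (\<lambda>n. n \<in> A) (germ x)"
    using that[folded eventually_germ_not[OF assms]] eventually_germ_pos[OF assms]
    by eventually_elim simp
  then show "A \<in> tp V x \<or> posnats - A \<in> tp V x"
    unfolding mem_tp[OF assms] using A by blast
qed

lemma ultrafilterD:
  assumes "F \<in> ultrafilters"
  shows ultrafilter_subset: "A \<in> F \<Longrightarrow> A \<subseteq> posnats"
    and ultrafilter_posnats: "posnats \<in> F"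
    and ultrafilter_empty: "{} \<notin> F"
    and ultrafilter_Int: "A \<in> F \<Longrightarrow> B \<in> F \<Longrightarrow> A \<inter> B \<in> F"
    and ultrafilter_compl: "A \<subseteq> posnats \<Longrightarrow> A \<notin> F \<Longrightarrow> posnats - A \<in> F"
proof -
  note F = assms[unfolded ultrafilters_def, THEN CollectD]
  note F2 = F[THEN conjunct2] and F3 = F[THEN conjunct2, THEN conjunct2]
  note F4 = F3[THEN conjunct2] note F6 = F4[THEN conjunct2, THEN conjunct2]
  show "A \<in> F \<Longrightarrow> A \<subseteq> posnats"
    using F[THEN conjunct1] by blast
  show "posnats \<in> F"
    by (rule F2[THEN conjunct1])
  show "{} \<notin> F"
    by (rule F3[THEN conjunct1])
  show "A \<in> F \<Longrightarrow> B \<in> F \<Longrightarrow> A \<inter> B \<in> F"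
    using F4[THEN conjunct1] by blast
  show "A \<subseteq> posnats \<Longrightarrow> A \<notin> F \<Longrightarrow> posnats - A \<in> F"
    using F6 by blast
qed

lemma ultrafilter_subset_eq:
  assumes "F \<in> ultrafilters" "G \<in> ultrafilters" "F \<subseteq> G"
  shows "F = G"
proof
  show "G \<subseteq> F"
  proof
    fix A assume A: "A \<in> G"
    have "posnats - A \<notin> G"
    proof
      assume "posnats - A \<in> G"
      from ultrafilter_Int[OF assms(2) A this] have "{} \<in> G"
        by simp
      then show False
        using ultrafilter_empty[OF assms(2)] by simp
    qed
    then show "A \<in> F"
      using ultrafilter_compl[OF assms(1) ultrafilter_subset[OF assms(2) A]] assms(3) by blast
  qed
qed (rule assms)

text \<open>Finite intersections of members of \<open>G\<close> are nonempty, so saturation gives a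
  point in all extensions at once. Its type contains \<open>G\<close> and equals it by maximality of
  ultrafilters.\<close>

lemma generator_exists:
  assumes G: "G \<in> ultrafilters"
  shows "\<exists>x. generates V x G"
proof -
  have inter: "posnats \<inter> \<Inter>\<A> \<in> G" if "finite \<A>" "\<A> \<subseteq> G" for \<A>
    using that
  proof (induction \<A>)
    case empty
    then show ?case
      using ultrafilter_posnats[OF G] by simp
  next
    case (insert A \<A>)
    then have "A \<in> G" "posnats \<inter> \<Inter>\<A> \<in> G"
      by auto
    then have "A \<inter> (posnats \<inter> \<Inter>\<A>) \<in> G"
      by (rule ultrafilter_Int[OF G])
    moreover have "A \<inter> (posnats \<inter> \<Inter>\<A>) = posnats \<inter> \<Inter>(insert A \<A>)"
      by auto
    ultimately show ?case by simp
  qed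
  have "\<exists>x\<in>hN. \<forall>R\<in>(\<lambda>A _ n. n \<in> A) ` G. star2 R (hnat V 1) x"
  proof (rule saturation)
    fix F :: "(nat \<Rightarrow> nat \<Rightarrow> bool) set"
    assume "finite F" "F \<subseteq> (\<lambda>A _ n. n \<in> A) ` G"
    then obtain \<A> where A: "finite \<A>" "\<A> \<subseteq> G" "F = (\<lambda>A _ n. n \<in> A) ` \<A>"
      by (metis finite_subset_image)
    have "posnats \<inter> \<Inter>\<A> \<noteq> {}"
      using inter[OF A(1,2)] ultrafilter_empty[OF G] by auto
    then obtain n where "n \<in> posnats \<inter> \<Inter>\<A>"
      by blast
    then have "\<exists>n\<ge>1. \<forall>R\<in>F. R m n" for m
      unfolding A(3) by (intro exI[of _ n]) auto
    then show "eventually (\<lambda>m. \<exists>n\<ge>1. \<forall>R\<in>F. R m n) (germ (hnat V 1))"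
      by simp
  qed simp
  then obtain x where x: "x \<in> hN" "\<forall>A\<in>G. star2 (\<lambda>_ n. n \<in> A) (hnat V 1) x"
    by auto
  have "G \<subseteq> tp V x"
  proof
    fix A assume A: "A \<in> G"
    then have "A \<subseteq> posnats"
      by (rule ultrafilter_subset[OF G])
    moreover have "eventually (\<lambda>n. n \<in> A) (germ x)"
      using x A star2_snd[of "hnat V 1" x "\<lambda>n. n \<in> A"] by simp
    ultimately show "A \<in> tp V x"
      unfolding mem_tp[OF x(1)] by blast
  qed
  then have "tp V x = G"
    using ultrafilter_subset_eq[OF G tp_ultrafilter[OF x(1)]] by simp
  then show ?thesis
    using x(1) unfolding generates_def by blast
qed

lemma tp_prime_iff:
  assumes "p \<in> hN"
  shows "tp V p \<in> prime_ultrafilters \<longleftrightarrow> p \<in> hprimes V"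
proof -
  have "{p. prime p} \<subseteq> posnats"
    by (auto simp: prime_ge_1_nat)
  then show ?thesis
    unfolding prime_ultrafilters_def hprimes_def using tp_ultrafilter[OF assms] by (simp add: tp_def)
qed

lemma hpow_star_set_iff:
  assumes "pos_fun f" "pos_fun g" "w \<in> hN" "A \<subseteq> posnats"
  shows "hpow V (star_fun f w) (star_fun g w) \<in> star_set V A \<longleftrightarrow>
    eventually (\<lambda>n. f n ^ g n \<in> A) (germ w)"
proof -
  have "pos_fun (\<lambda>n. f n ^ g n)"
    using assms(1) by (auto simp: Suc_le_eq One_nat_def)
  then show ?thesis
    using assms mem_star_set_iff[OF assms(4)] star_fun_in[of "\<lambda>n. f n ^ g n" w]
    by (simp only: hpow_star_fun) (simp add: eventually_germ_star_fun)
qed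

lemma hpow_powers_of_iff:
  assumes "p \<in> hprimes V" "a \<in> hN" "B \<subseteq> posnats"
  shows "hpow V p a \<in> star_set V (powers_of B) \<longleftrightarrow> p \<in> star_set V B"
proof -
  have "p \<in> hN"
    using assms(1) hprimes_subset by blast
  then obtain w f g where w: "w \<in> hN" "pos_fun f" "pos_fun g" "p = star_fun f w" "a = star_fun g w"
    using star_fun_representation2[OF _ assms(2)] by blast
  have sub: "powers_of B \<subseteq> posnats"
    using powers_of_subset prime_powers_subset by blast
  have "eventually (\<lambda>n. prime (f n)) (germ w)"
    using assms(1) w star_fun_hprimes by auto
  then have "eventually (\<lambda>n. 1 \<le> n \<and> prime (f n)) (germ w)"
    using eventually_germ_pos[OF w(1)] by eventually_elim simp
  then have "eventually (\<lambda>n. f n ^ g n \<in> powers_of B) (germ w) \<longleftrightarrow> eventually (\<lambda>n. f n \<in> B) (germ w)"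
    by (rule eventually_cong) (use w(3) prime_power_in_powers_of_iff in blast)
  then show ?thesis
    using hpow_star_set_iff[OF w(2,3,1) sub] w mem_star_set_iff[OF assms(3), of p] \<open>p \<in> hN\<close>
    by (simp add: eventually_germ_star_fun)
qed

lemma hpow_prime_powers:
  assumes "p \<in> hprimes V" "a \<in> hN"
  shows "hpow V p a \<in> star_set V prime_powers"
proof -
  have "p \<in> star_set V posnats"
    using assms(1) hprimes_subset by blast
  then have "hpow V p a \<in> star_set V (powers_of posnats)"
    using hpow_powers_of_iff[OF assms] by simp
  moreover have "powers_of posnats = prime_powers"
    unfolding powers_of_def prime_powers_def using prime_ge_1_nat by auto
  ultimately show ?thesis by simp
qed

lemma star_set_empty: "x \<notin> star_set V {}"
  using mem_star_set_iff[of "{}" x] eventually_germ_False[of x] by simp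

lemma star_set_Int:
  assumes "A \<subseteq> posnats" "B \<subseteq> posnats"
  shows "x \<in> star_set V (A \<inter> B) \<longleftrightarrow> x \<in> star_set V A \<and> x \<in> star_set V B"
proof -
  have "A \<inter> B \<subseteq> posnats" using assms by blast
  from mem_star_set_iff[OF this, of x] mem_star_set_iff[OF assms(1), of x] mem_star_set_iff[OF assms(2), of x]
  show ?thesis by (auto simp: eventually_conj_iff)
qed

lemma star_set_Diff:
  assumes "A \<subseteq> posnats" "B \<subseteq> posnats" "x \<in> star_set V A"
  shows "x \<in> star_set V (A - B) \<longleftrightarrow> x \<notin> star_set V B"
proof -
  have "A - B \<subseteq> posnats" using assms by blast
  have x: "x \<in> hN" "eventually (\<lambda>n. n \<in> A) (germ x)"
    using assms(1,3) mem_star_set_iff by blast+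
  have "eventually (\<lambda>n. n \<in> A - B) (germ x) \<longleftrightarrow> eventually (\<lambda>n. n \<notin> B) (germ x)"
    by (rule eventually_cong[OF x(2)]) simp
  then show ?thesis
    using mem_star_set_iff[OF assms(2), of x] mem_star_set_iff[OF \<open>A - B \<subseteq> posnats\<close>, of x] x(1)
      eventually_germ_not[OF x(1), of "\<lambda>n. n \<in> B"] by simp
qed

text \<open>A convex set is its upward closure minus \<open>W\<close>, the set of numbers dividing
  no element of it. Both are closed under multiples, so equivalence of the types decides membership
  in each.\<close>

lemma uf_equiv_convex:
  assumes xy: "x \<in> hN" "y \<in> hN" and equiv: "uf_equiv (tp V x) (tp V y)"
    and A: "A \<subseteq> posnats" "dvd_convex A" and x: "x \<in> star_set V A"
  shows "y \<in> star_set V A"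
proof -
  have "A \<noteq> {}"
    using x star_set_empty by blast
  define W where "W = {n \<in> posnats. \<not> (\<exists>a\<in>A. n dvd a)}"
  have W: "W \<subseteq> posnats"
    unfolding W_def by blast
  have up: "up_closure A \<in> up_sets" "up_closure A \<subseteq> posnats"
    using up_closure_in_up_sets[OF A(1) \<open>A \<noteq> {}\<close>] by (auto simp: up_closure_def)
  have "up_closure A \<in> tp V x"
    using x up_closure_supset[OF A(1)] up(2)
    unfolding mem_tp[OF xy(1)] mem_star_set_iff[OF A(1)] by (auto elim: eventually_mono)
  then have 1: "up_closure A \<in> tp V y"
    using equiv up(1) unfolding uf_equiv_def uf_dvd_def by blast
  have 2: "W \<notin> tp V y"
  proof
    \<comment> \<open>\<open>up_sets\<close> excludes the empty set; here \<open>W\<close> is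
      nonempty because it belongs to an ultrafilter.\<close>
    assume Wy: "W \<in> tp V y"
    then have "W \<noteq> {}"
      using ultrafilter_empty[OF tp_ultrafilter[OF xy(2)]] by blast
    moreover have "up_closure W = W"
    proof
      show "up_closure W \<subseteq> W"
      proof
        fix n assume "n \<in> up_closure W"
        then obtain m where "m \<in> W" "m dvd n" "n \<in> posnats"
          unfolding up_closure_def by blast
        then show "n \<in> W"
          unfolding W_def by (auto intro: dvd_trans)
      qed
    qed (rule up_closure_supset[OF W])
    ultimately have "W \<in> up_sets"
      using W unfolding up_sets_def by simp
    then have "W \<in> tp V x"
      using equiv Wy unfolding uf_equiv_def uf_dvd_def by blast
    then have "eventually (\<lambda>n. n \<in> W) (germ x)" "eventually (\<lambda>n. n \<in> A) (germ x)"
      using x unfolding mem_tp[OF xy(1)] mem_star_set_iff[OF A(1)] by blast+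
    then have "eventually (\<lambda>_. False) (germ x)"
      by eventually_elim (auto simp: W_def)
    then show False
      using eventually_germ_False[OF xy(1)] by blast
  qed
  have "eventually (\<lambda>n. n \<notin> W) (germ y)"
    unfolding eventually_germ_not[OF xy(2)] using 2 W unfolding mem_tp[OF xy(2)] by blast
  moreover have "eventually (\<lambda>n. n \<in> up_closure A) (germ y)"
    using 1 unfolding mem_tp[OF xy(2)] by blast
  ultimately have "eventually (\<lambda>n. n \<in> A) (germ y)"
  proof eventually_elim
    case (elim n)
    then obtain a b where "a \<in> A" "a dvd n" "b \<in> A" "n dvd b"
      unfolding W_def up_closure_def by blast
    then show ?case
      using A(2) unfolding dvd_convex_def by blast
  qed
  then show ?thesis
    unfolding mem_star_set_iff[OF A(1)] using xy(2) by blast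
qed

lemma convex_family_witness:
  assumes "A \<subseteq> prime_powers" "dvd_convex A" "x \<in> star_set V A"
  shows "A \<in> convex_family"
  using assms star_set_empty unfolding convex_family_def by blast

text \<open>Among prime powers an upward closed set and its complement are both convex. Testing the
  complement yields the reverse divisibility, although the hypothesis only goes from
  \<open>x\<close> to \<open>y\<close>.\<close>

lemma uf_equiv_of_convex:
  assumes "x \<in> star_set V prime_powers" "y \<in> star_set V prime_powers"
    and convex: "\<And>A. A \<in> convex_family \<Longrightarrow> x \<in> star_set V A \<Longrightarrow> y \<in> star_set V A"
  shows "uf_equiv (tp V x) (tp V y)"
proof -
  have W: "W \<subseteq> posnats" if "W \<in> up_sets" for W
    using that unfolding up_sets_def by blast
  have "y \<in> star_set V W" if "W \<in> up_sets" "x \<in> star_set V W" for W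
  proof -
    have "x \<in> star_set V (prime_powers \<inter> W)"
      using star_set_Int[OF prime_powers_subset W[OF that(1)]] assms(1) that(2) by blast
    moreover from this have "prime_powers \<inter> W \<in> convex_family"
      using convex_family_witness[of "prime_powers \<inter> W"] dvd_convex_up_set[OF that(1)] by blast
    ultimately have "y \<in> star_set V (prime_powers \<inter> W)"
      using convex by blast
    then show ?thesis
      using star_set_Int[OF prime_powers_subset W[OF that(1)]] by blast
  qed
  moreover have "x \<in> star_set V W" if "W \<in> up_sets" "y \<in> star_set V W" for W
  proof (rule ccontr)
    assume "x \<notin> star_set V W"
    then have "x \<in> star_set V (prime_powers - W)"
      using star_set_Diff[OF prime_powers_subset W[OF that(1)] assms(1)] by blast
    moreover from this have "prime_powers - W \<in> convex_family"
      using convex_family_witness[of "prime_powers - W"] dvd_convex_compl_up_set[OF that(1)] by blast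
    ultimately have "y \<in> star_set V (prime_powers - W)"
      using convex by blast
    then show False
      using star_set_Diff[OF prime_powers_subset W[OF that(1)] assms(2)] that(2) by blast
  qed
  ultimately show ?thesis
    unfolding uf_equiv_def uf_dvd_def tp_def by blast
qed

section \<open>Basic classes and the convex sets that determine them\<close>

lemma equiv_pair_equiv: "equiv (pairs_over V P) (pair_equiv V P)"
proof (rule equivI)
  show "pair_equiv V P \<subseteq> pairs_over V P \<times> pairs_over V P"
    unfolding pair_equiv_def by blast
  show "refl_on (pairs_over V P) (pair_equiv V P)"
    unfolding pair_equiv_def refl_on_def uf_equiv_def uf_dvd_def by blast
  show "sym (pair_equiv V P)"
    unfolding pair_equiv_def sym_def uf_equiv_def by blast
  show "trans (pair_equiv V P)"
    unfolding pair_equiv_def trans_def uf_equiv_def uf_dvd_def by blast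
qed

lemma hprimes_in: "p \<in> hprimes V \<Longrightarrow> p \<in> hN"
  using hprimes_subset by blast

text \<open>An equivalence class is the class of each of its pairs, so the quantified ultrafilter
  and quotient class can be eliminated.\<close>

lemma power_generates_iff:
  "power_generates V p a b \<longleftrightarrow> p \<in> hprimes V \<and> a \<in> hN \<and> b = class_of_power V p a"
proof
  assume "power_generates V p a b"
  then obtain P u where P: "P \<in> prime_ultrafilters" "u \<in> pairs_over V P // pair_equiv V P"
      "b = basic_class V u" "(p, a) \<in> u"
    unfolding power_generates_def exponent_classes_def by blast
  then have "(p, a) \<in> pairs_over V P"
    using in_quotient_imp_subset[OF equiv_pair_equiv] by blast
  then have p: "p \<in> hN" "tp V p = P" "a \<in> hN"
    unfolding pairs_over_def generates_def by auto
  have "u = pair_equiv V P `` {(p, a)}"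
  proof -
    obtain z where z: "u = pair_equiv V P `` {z}"
      using P(2) by (rule quotientE)
    then have "(z, (p, a)) \<in> pair_equiv V P"
      using P(4) by blast
    then show ?thesis
      unfolding z by (rule equiv_class_eq[OF equiv_pair_equiv])
  qed
  then show "p \<in> hprimes V \<and> a \<in> hN \<and> b = class_of_power V p a"
    using P(1,3) p tp_prime_iff[OF p(1)] unfolding class_of_power_def by blast
next
  assume *: "p \<in> hprimes V \<and> a \<in> hN \<and> b = class_of_power V p a"
  then have pair: "(p, a) \<in> pairs_over V (tp V p)"
    unfolding pairs_over_def generates_def using hprimes_in by blast
  then have "pair_equiv V (tp V p) `` {(p, a)} \<in> exponent_classes V (tp V p)"
    unfolding exponent_classes_def by (rule quotientI)
  moreover have "(p, a) \<in> pair_equiv V (tp V p) `` {(p, a)}"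
    using equiv_class_self[OF equiv_pair_equiv pair] .
  moreover have "tp V p \<in> prime_ultrafilters"
    using * tp_prime_iff[of p] hprimes_in by blast
  moreover have "b = basic_class V (pair_equiv V (tp V p) `` {(p, a)})"
    using * by (simp add: class_of_power_def)
  ultimately show "power_generates V p a b"
    unfolding power_generates_def by blast
qed

lemma basic_classes_eq: "basic_classes V = {class_of_power V p a |p a. p \<in> hprimes V \<and> a \<in> hN}"
proof -
  have "b \<in> basic_classes V \<longleftrightarrow> (\<exists>p a. power_generates V p a b)" for b
  proof
    assume "b \<in> basic_classes V"
    then obtain P u where P: "P \<in> prime_ultrafilters" "u \<in> exponent_classes V P" "b = basic_class V u"
      unfolding basic_classes_def by blast
    moreover obtain p a where "(p, a) \<in> u"
      using P(2) in_quotient_imp_non_empty[OF equiv_pair_equiv] unfolding exponent_classes_def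
      by (metis ex_in_conv surj_pair)
    ultimately show "\<exists>p a. power_generates V p a b"
      unfolding power_generates_def by blast
  next
    assume "\<exists>p a. power_generates V p a b"
    then show "b \<in> basic_classes V"
      unfolding power_generates_def basic_classes_def by blast
  qed
  then show ?thesis
    unfolding power_generates_iff by blast
qed

text \<open>The members of a basic class agree only up to equivalence under divisibility. Convexity
  lets a single generator decide for all of them.\<close>

lemma in_class_of_power_iff:
  assumes "p \<in> hprimes V" "a \<in> hN" "A \<in> convex_family"
  shows "in_basic_class A (class_of_power V p a) \<longleftrightarrow> hpow V p a \<in> star_set V A"
proof
  have "(p, a) \<in> pair_equiv V (tp V p) `` {(p, a)}"
    by (rule equiv_class_self[OF equiv_pair_equiv])
      (use assms hprimes_in in \<open>simp add: pairs_over_def generates_def\<close>)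
  then have "tp V (hpow V p a) \<in> class_of_power V p a"
    unfolding class_of_power_def basic_class_def by blast
  moreover assume "in_basic_class A (class_of_power V p a)"
  ultimately have "A \<in> tp V (hpow V p a)"
    unfolding in_basic_class_def by blast
  then show "hpow V p a \<in> star_set V A"
    unfolding tp_def by blast
next
  assume mem: "hpow V p a \<in> star_set V A"
  have sub: "A \<subseteq> posnats" "dvd_convex A"
    using assms(3) convex_family_subset unfolding convex_family_def by blast+
  show "in_basic_class A (class_of_power V p a)"
    unfolding in_basic_class_def class_of_power_def basic_class_def
  proof clarify
    fix q b assume "((p, a), (q, b)) \<in> pair_equiv V (tp V p)"
    then have qb: "q \<in> hN" "b \<in> hN" "uf_equiv (tp V (hpow V p a)) (tp V (hpow V q b))"
      unfolding pair_equiv_def pairs_over_def generates_def by auto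
    have "hpow V q b \<in> star_set V A"
      by (rule uf_equiv_convex[OF _ _ qb(3) sub mem])
        (use hpow_in assms hprimes_in qb in blast)+
    then show "A \<in> tp V (hpow V q b)"
      unfolding tp_def using sub by blast
  qed
qed

text \<open>The sets \<open>powers_of B\<close> carry the type of \<open>p\<close> over to
  \<open>q\<close>, and maximality of ultrafilters turns this inclusion into equality. The other
  convex sets give the equivalence of the powers.\<close>

lemma class_of_power_eq_iff:
  assumes "p \<in> hprimes V" "a \<in> hN" "q \<in> hprimes V" "b \<in> hN"
  shows "class_of_power V p a = class_of_power V q b \<longleftrightarrow>
    (\<forall>A\<in>convex_family. hpow V p a \<in> star_set V A \<longrightarrow> hpow V q b \<in> star_set V A)"
proof
  assume "class_of_power V p a = class_of_power V q b"
  then show "\<forall>A\<in>convex_family. hpow V p a \<in> star_set V A \<longrightarrow> hpow V q b \<in> star_set V A"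
    using in_class_of_power_iff[OF assms(1,2)] in_class_of_power_iff[OF assms(3,4)] by simp
next
  assume convex: "\<forall>A\<in>convex_family. hpow V p a \<in> star_set V A \<longrightarrow> hpow V q b \<in> star_set V A"
  have "tp V p \<subseteq> tp V q"
  proof
    fix B assume "B \<in> tp V p"
    then have B: "B \<subseteq> posnats" "p \<in> star_set V B"
      unfolding tp_def by auto
    then have "hpow V p a \<in> star_set V (powers_of B)"
      using hpow_powers_of_iff[OF assms(1,2)] by blast
    moreover from this have "powers_of B \<in> convex_family"
      by (rule convex_family_witness[OF powers_of_subset dvd_convex_powers_of])
    ultimately have "hpow V q b \<in> star_set V (powers_of B)"
      using convex by blast
    then show "B \<in> tp V q"
      using hpow_powers_of_iff[OF assms(3,4) B(1)] B(1) unfolding tp_def by blast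
  qed
  then have tp: "tp V p = tp V q"
    by (intro ultrafilter_subset_eq tp_ultrafilter hprimes_in assms)
  have "uf_equiv (tp V (hpow V p a)) (tp V (hpow V q b))"
    by (intro uf_equiv_of_convex hpow_prime_powers assms) (use convex in blast)
  then have "((p, a), (q, b)) \<in> pair_equiv V (tp V p)"
    using assms hprimes_in tp unfolding pair_equiv_def pairs_over_def generates_def by auto
  then have "pair_equiv V (tp V p) `` {(p, a)} = pair_equiv V (tp V p) `` {(q, b)}"
    by (rule equiv_class_eq[OF equiv_pair_equiv])
  then show "class_of_power V p a = class_of_power V q b"
    unfolding class_of_power_def tp by simp
qed

lemma power_generates_iff_convex:
  assumes "b \<in> basic_classes V"
  shows "power_generates V p a b \<longleftrightarrow> p \<in> hprimes V \<and> a \<in> hN \<and>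
    (\<forall>A\<in>convex_family. in_basic_class A b \<longrightarrow> hpow V p a \<in> star_set V A)"
proof -
  obtain q c where q: "q \<in> hprimes V" "c \<in> hN" "b = class_of_power V q c"
    using assms unfolding basic_classes_eq by blast
  show ?thesis
    unfolding power_generates_iff q(3)
    using class_of_power_eq_iff[OF q(1,2)] in_class_of_power_iff[OF q(1,2)] by blast
qed

lemma class_of_power_in: "p \<in> hprimes V \<Longrightarrow> a \<in> hN \<Longrightarrow> class_of_power V p a \<in> basic_classes V"
  unfolding basic_classes_eq by blast

end

section \<open>Patterns of hypernaturals\<close>

lemma exact_primes_prod:
  fixes e :: "nat \<Rightarrow> nat"
  assumes S: "finite S" "\<And>p. p \<in> S \<Longrightarrow> prime p" and e: "\<And>p. p \<in> S \<Longrightarrow> 1 \<le> e p"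
  shows "1 \<le> (\<Prod>p\<in>S. p ^ e p)"
    and "p \<in> S \<Longrightarrow> multiplicity p (\<Prod>p\<in>S. p ^ e p) = e p"
    and "exact_primes A (\<Prod>p\<in>S. p ^ e p) = {p \<in> S. p ^ e p \<in> A}"
proof -
  let ?m = "\<Prod>p\<in>S. p ^ e p"
  have pos: "0 < ?m"
    using S(2) by (intro prod_pos) (auto simp: prime_gt_0_nat)
  then show "1 \<le> ?m"
    by simp
  have mult: "multiplicity p ?m = (if p \<in> S then e p else 0)" if "prime p" for p
    using multiplicity_prod_prime_powers[OF S that, of e] by simp
  then show "p \<in> S \<Longrightarrow> multiplicity p ?m = e p"
    using S(2) by simp
  have "p dvd ?m \<longleftrightarrow> p \<in> S" if "prime p" for p
  proof -
    have "p dvd ?m \<longleftrightarrow> 0 < multiplicity p ?m"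
      using that pos prime_multiplicity_gt_zero_iff[of p ?m] by simp
    also have "\<dots> \<longleftrightarrow> p \<in> S"
      unfolding mult[OF that] using e[of p] by auto
    finally show ?thesis .
  qed
  then show "exact_primes A ?m = {p \<in> S. p ^ e p \<in> A}"
    unfolding exact_primes_def using S(2) mult by auto
qed

lemma prime_powers_in_convex_family: "prime_powers \<in> convex_family"
proof -
  have "2 ^ 1 \<in> prime_powers"
    unfolding prime_powers_def by (intro CollectI exI[of _ 2] exI[of _ 1]) simp
  then show ?thesis
    unfolding convex_family_def using dvd_convex_prime_powers by blast
qed

context saturated_extension
begin

definition class_powers :: "nat set set set \<Rightarrow> 't \<Rightarrow> ('t \<times> 't) set" where
  "class_powers b x = {(p, a). power_generates V p a b \<and> exactly_divides V p a x}"

lemma class_powers_eq: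
  assumes "b \<in> basic_classes V"
  shows "class_powers b x = {(p, a). exactly_divides V p a x \<and>
    (\<forall>A\<in>convex_family. in_basic_class A b \<longrightarrow> hpow V p a \<in> star_set V A)}"
  unfolding class_powers_def power_generates_iff_convex[OF assms]
  by (auto simp: exactly_divides_def)

lemma class_powers_subset:
  assumes "b \<in> basic_classes V" "A \<in> convex_family" "in_basic_class A b"
  shows "class_powers b x \<subseteq> exact_powers A x"
  unfolding class_powers_eq[OF assms(1)] exact_powers_def using assms(2,3) by auto

lemma in_basic_class_prime_powers:
  assumes "b \<in> basic_classes V"
  shows "in_basic_class prime_powers b"
  using assms in_class_of_power_iff[OF _ _ prime_powers_in_convex_family] hpow_prime_powers
  unfolding basic_classes_eq by auto

text \<open>Convexity passes to intersections, but nonemptiness does not in general. Here a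
  generator of \<open>b\<close> lies in the extension of the intersection.\<close>

lemma convex_family_Int:
  assumes "b \<in> basic_classes V" "A \<in> convex_family" "B \<in> convex_family"
    "in_basic_class A b" "in_basic_class B b"
  shows "A \<inter> B \<in> convex_family" "in_basic_class (A \<inter> B) b"
proof -
  obtain p a where p: "p \<in> hprimes V" "a \<in> hN" "b = class_of_power V p a"
    using assms(1) unfolding basic_classes_eq by blast
  have "hpow V p a \<in> star_set V A" "hpow V p a \<in> star_set V B"
    using in_class_of_power_iff[OF p(1,2)] assms(2-) p(3) by auto
  then have mem: "hpow V p a \<in> star_set V (A \<inter> B)"
    using star_set_Int[OF convex_family_subset convex_family_subset] assms(2,3) by blast
  show "A \<inter> B \<in> convex_family"
    by (rule convex_family_witness[OF _ _ mem])
      (use assms(2,3) dvd_convex_Int in \<open>auto simp: convex_family_def\<close>)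
  then show "in_basic_class (A \<inter> B) b"
    unfolding p(3) using in_class_of_power_iff[OF p(1,2)] mem by blast
qed

lemma convex_family_Inter:
  assumes "b \<in> basic_classes V" "finite \<A>" "\<A> \<subseteq> {A \<in> convex_family. in_basic_class A b}"
  shows "prime_powers \<inter> \<Inter>\<A> \<in> {A \<in> convex_family. in_basic_class A b}"
  using assms(2,3)
proof (induction \<A>)
  case empty
  then show ?case
    using prime_powers_in_convex_family in_basic_class_prime_powers[OF assms(1)] by simp
next
  case (insert A \<A>)
  then have "A \<inter> (prime_powers \<inter> \<Inter>\<A>) \<in> {A \<in> convex_family. in_basic_class A b}"
    using convex_family_Int[OF assms(1), of A "prime_powers \<inter> \<Inter>\<A>"] by blast
  moreover have "A \<inter> (prime_powers \<inter> \<Inter>\<A>) = prime_powers \<inter> \<Inter>(insert A \<A>)"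
    by auto
  ultimately show ?case by simp
qed

text \<open>The number \<open>m\<close> codes a finite set of exact prime powers of \<open>n\<close>
  as their product. The existence of such a set thus becomes a binary relation between numbers, as
  saturation requires.\<close>

definition exact_subdivisor :: "nat set \<Rightarrow> nat \<Rightarrow> nat \<Rightarrow> nat \<Rightarrow> bool" where
  "exact_subdivisor A k n m \<longleftrightarrow> k \<le> card (exact_primes prime_powers m) \<and>
    (\<forall>p\<in>exact_primes prime_powers m. p \<in> exact_primes A n \<and> multiplicity p m = multiplicity p n)"

text \<open>The product of all exact prime powers of \<open>n\<close> in \<open>A\<close> also meets
  every weaker requirement. This handles finitely many requirements by one for their common
  intersection and largest bound.\<close>

lemma exact_subdivisor_exists:
  assumes "1 \<le> n" "k \<le> card (exact_primes A n)"
  shows "\<exists>m\<ge>1. \<forall>B l. A \<subseteq> B \<longrightarrow> l \<le> k \<longrightarrow> exact_subdivisor B l n m"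
proof -
  let ?S = "exact_primes A n" let ?e = "\<lambda>p. multiplicity p n"
  let ?m = "\<Prod>p\<in>?S. p ^ ?e p"
  have S: "finite ?S" "\<And>p. p \<in> ?S \<Longrightarrow> prime p"
    using finite_exact_primes[OF assms(1)] by (auto simp: exact_primes_def)
  have e: "1 \<le> ?e p" if "p \<in> ?S" for p
    using that assms(1) prime_multiplicity_gt_zero_iff[of p n]
    by (auto simp: exact_primes_def Suc_le_eq One_nat_def)
  note prod = exact_primes_prod[of ?S ?e, OF S e]
  have "{p \<in> ?S. p ^ ?e p \<in> prime_powers} = ?S"
    using S(2) e unfolding prime_powers_def by auto (use S(2) e in blast)
  then have eq: "exact_primes prime_powers ?m = ?S"
    using prod(3)[of prime_powers] by simp
  have "exact_subdivisor B l n ?m" if "A \<subseteq> B" "l \<le> k" for B l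
    unfolding exact_subdivisor_def eq using assms(2) that exact_primes_mono[OF that(1)] prod(2) by auto
  then show ?thesis
    using prod(1) by blast
qed

lemma star_exact_subdivisor:
  assumes xy: "x \<in> hN" "y \<in> hN" and star: "star2 (exact_subdivisor A k) x y" and A: "A \<subseteq> posnats"
  shows "exact_powers prime_powers y \<subseteq> exact_powers A x"
    and "{..<k} \<lesssim> exact_powers prime_powers y"
proof -
  show "exact_powers prime_powers y \<subseteq> exact_powers A x"
  proof clarify
    fix p a assume D: "(p, a) \<in> exact_powers prime_powers y"
    then have "finite {x, y, p, a}" "{x, y, p, a} \<subseteq> hN"
      using exactly_divides_hypernats xy unfolding exact_powers_def by auto
    from star_fun_representation[OF this] obtain w g where w: "w \<in> hN"
        and g: "\<forall>z\<in>{x, y, p, a}. pos_fun (g z) \<and> z = star_fun (g z) w"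
      by (elim bexE exE) (rule that)
    have pos: "pos_fun (g x)" "pos_fun (g y)" "pos_fun (g p)" "pos_fun (g a)"
      and eq: "star_fun (g x) w = x" "star_fun (g y) w = y" "star_fun (g p) w = p" "star_fun (g a) w = a"
      using g by simp_all
    have "eventually (\<lambda>n. g p n \<in> exact_primes prime_powers (g y n) \<and>
        g a n = multiplicity (g p n) (g y n)) (germ w)"
      using exact_powers_star_fun[OF pos(2,3,4) w prime_powers_subset] D eq by simp
    moreover have "eventually (\<lambda>n. exact_subdivisor A k (g x n) (g y n)) (germ w)"
      using star2_star_fun[OF pos(1,2) w] star eq by simp
    ultimately have "eventually (\<lambda>n. g p n \<in> exact_primes A (g x n) \<and>
        g a n = multiplicity (g p n) (g x n)) (germ w)"
      by eventually_elim (simp add: exact_subdivisor_def)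
    then show "(p, a) \<in> exact_powers A x"
      using exact_powers_star_fun[OF pos(1,3,4) w A] eq by simp
  qed
  obtain w f g where w: "w \<in> hN" "pos_fun f" "pos_fun g" "x = star_fun f w" "y = star_fun g w"
    by (rule star_fun_representation2[OF xy])
  have "eventually (\<lambda>n. exact_subdivisor A k (f n) (g n)) (germ w)"
    using star2_star_fun[OF w(2,3,1)] star w(4,5) by simp
  then have "eventually (\<lambda>n. k \<le> card (exact_primes prime_powers (g n))) (germ w)"
    by (rule eventually_mono) (simp add: exact_subdivisor_def)
  then show "{..<k} \<lesssim> exact_powers prime_powers y"
    unfolding lepoll_exact_powers_iff[OF xy(2) prime_powers_subset]
    unfolding w(5) eventually_germ_star_fun[OF w(3,1)] .
qed

text \<open>Saturation turns the bounds for the single convex sets into one hypernatural \<open>y\<close>, all of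
  whose prime powers exactly divide \<open>x\<close> and belong to the class. The set of the latter is internal,
  although the set of all prime powers of the class that exactly divide \<open>x\<close> is not.\<close>

lemma class_powers_internal_part:
  assumes x: "x \<in> hN" and b: "b \<in> basic_classes V" and K: "K \<noteq> {}"
    and large: "\<And>k A. k \<in> K \<Longrightarrow> A \<in> convex_family \<Longrightarrow> in_basic_class A b \<Longrightarrow>
      eventually (\<lambda>n. k \<le> card (exact_primes A n)) (germ x)"
  shows "\<exists>y\<in>hN. exact_powers prime_powers y \<subseteq> class_powers b x \<and>
    (\<forall>k\<in>K. {..<k} \<lesssim> exact_powers prime_powers y)"
proof -
  let ?C = "{A \<in> convex_family. in_basic_class A b}"
  have "\<exists>y\<in>hN. \<forall>R\<in>case_prod exact_subdivisor ` (?C \<times> K). star2 R x y"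
  proof (rule saturation[OF x])
    fix F assume fin: "finite F" and sub: "F \<subseteq> case_prod exact_subdivisor ` (?C \<times> K)"
    obtain I where I: "I \<subseteq> ?C \<times> K" "finite I" "F = case_prod exact_subdivisor ` I"
      using finite_subset_image[OF fin sub] by (elim exE conjE) (rule that)
    \<comment> \<open>The factor \<open>prime_powers\<close> and the element 0 cover an empty
      \<open>I\<close>; for \<open>k = 0\<close> the required bound is trivial.\<close>
    define A where "A = prime_powers \<inter> \<Inter>(fst ` I)"
    define k where "k = Max (insert 0 (snd ` I))"
    have A: "A \<in> ?C"
      unfolding A_def by (rule convex_family_Inter[OF b]) (use I in auto)
    have "k \<in> insert 0 (snd ` I)"
      unfolding k_def using I(2) by (intro Max_in) auto
    then have "k = 0 \<or> k \<in> K"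
      using I(1) by auto
    then have "eventually (\<lambda>n. k \<le> card (exact_primes A n)) (germ x)"
      using large A by auto
    then show "eventually (\<lambda>n. \<exists>m\<ge>1. \<forall>R\<in>F. R n m) (germ x)"
      using eventually_germ_pos[OF x]
    proof eventually_elim
      case (elim n)
      then obtain m where m: "1 \<le> m" "\<And>B l. A \<subseteq> B \<Longrightarrow> l \<le> k \<Longrightarrow> exact_subdivisor B l n m"
        using exact_subdivisor_exists by blast
      have "exact_subdivisor B l n m" if "(B, l) \<in> I" for B l
      proof (rule m(2))
        show "A \<subseteq> B"
          unfolding A_def using that by force
        show "l \<le> k"
          unfolding k_def using that I(2) by (intro Max_ge) (auto intro: rev_image_eqI)
      qed
      then show ?case
        using m(1) unfolding I(3) by auto
    qed
  qed
  then obtain y where y: "y \<in> hN"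
      "\<And>A k. A \<in> ?C \<Longrightarrow> k \<in> K \<Longrightarrow> star2 (exact_subdivisor A k) x y"
    by auto
  obtain k0 where "k0 \<in> K"
    using K by blast
  have sub: "exact_powers prime_powers y \<subseteq> exact_powers A x" if "A \<in> ?C" for A
    by (rule star_exact_subdivisor(1)[OF x y(1) y(2)[OF that \<open>k0 \<in> K\<close>]])
      (use that convex_family_subset in blast)
  have pp: "prime_powers \<in> ?C"
    using prime_powers_in_convex_family in_basic_class_prime_powers[OF b] by blast
  have "exact_powers prime_powers y \<subseteq> class_powers b x"
    unfolding class_powers_eq[OF b] using sub pp unfolding exact_powers_def by blast
  moreover have "{..<k} \<lesssim> exact_powers prime_powers y" if "k \<in> K" for k
    by (rule star_exact_subdivisor(2)[OF x y(1) y(2)[OF pp that] prime_powers_subset])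
  ultimately show ?thesis
    using y(1) by blast
qed

text \<open>A finite set is settled by its finite subsets. An infinite one is enclosed between the
  exact powers of some \<open>y\<close> and those of \<open>x\<close>; both have the admissible
  infinite cardinality, since they correspond to infinite sections.\<close>

lemma class_powers_cardinal:
  assumes x: "x \<in> hN" and b: "b \<in> basic_classes V"
  shows "\<exists>v. class_powers b x \<approx> cardinal_set V v \<and>
    (\<forall>k. enat k \<le> v \<longleftrightarrow> (\<forall>A\<in>convex_family. in_basic_class A b \<longrightarrow>
      eventually (\<lambda>n. k \<le> card (exact_primes A n)) (germ x)))"
    (is "\<exists>v. _ \<and> (\<forall>k. _ \<longleftrightarrow> ?Q k)")
proof -
  have upper: "?Q k" if "{..<k} \<lesssim> class_powers b x" for k
  proof (intro ballI impI)
    fix A assume A: "A \<in> convex_family" "in_basic_class A b"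
    have "{..<k} \<lesssim> exact_powers A x"
      using that subset_imp_lepoll[OF class_powers_subset[OF b A]] by (rule lepoll_trans)
    then show "eventually (\<lambda>n. k \<le> card (exact_primes A n)) (germ x)"
      using lepoll_exact_powers_iff[OF x convex_family_subset[OF A(1)]] by blast
  qed
  have "{..<k} \<lesssim> class_powers b x" if "?Q k" for k
  proof -
    have "\<exists>y\<in>hN. exact_powers prime_powers y \<subseteq> class_powers b x \<and>
        (\<forall>l\<in>{k}. {..<l} \<lesssim> exact_powers prime_powers y)"
      by (rule class_powers_internal_part[OF x b]) (use that in auto)
    then obtain y where "exact_powers prime_powers y \<subseteq> class_powers b x"
        "{..<k} \<lesssim> exact_powers prime_powers y"
      by blast
    then show ?thesis
      using subset_imp_lepoll lepoll_trans by blast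
  qed
  with upper have Q: "?Q k \<longleftrightarrow> {..<k} \<lesssim> class_powers b x" for k
    by blast
  show ?thesis
  proof (cases "finite (class_powers b x)")
    case True
    then have "enat k \<le> enat (card (class_powers b x)) \<longleftrightarrow> ?Q k" for k
      unfolding Q by (simp add: lepoll_iff_card_le)
    then show ?thesis
      using finite_eqpoll_cardinal_set[OF True] by blast
  next
    case False
    then have all: "?Q k" for k
      unfolding Q using infinite_iff_lessThan_lepoll by blast
    have infinity: "S \<approx> cardinal_set V \<infinity>" if "S \<approx> cardinal_set V v" "\<And>k. {..<k::nat} \<lesssim> S" for S :: "('t \<times> 't) set" and v
    proof -
      have "enat k \<le> v" for k
        using eqpoll_cardinal_set_iff[OF that(1)] that(2) by blast
      then have "v = \<infinity>"
        by (intro enat_eqI) simp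
      then show ?thesis
        using that(1) by simp
    qed
    \<comment> \<open>All bounds are imposed at once: a separate \<open>y\<close> for each
      \<open>k\<close> would give only finite lower bounds, not an internal part of the full
      infinite cardinality.\<close>
    have "\<exists>y\<in>hN. exact_powers prime_powers y \<subseteq> class_powers b x \<and>
        (\<forall>k\<in>(UNIV :: nat set). {..<k} \<lesssim> exact_powers prime_powers y)"
      by (rule class_powers_internal_part[OF x b]) (use all in auto)
    then obtain y where y: "y \<in> hN" "exact_powers prime_powers y \<subseteq> class_powers b x"
        "\<And>k::nat. {..<k} \<lesssim> exact_powers prime_powers y"
      by blast
    have "exact_powers prime_powers y \<approx> cardinal_set V \<infinity>"
      using exact_powers_cardinal[OF y(1) prime_powers_subset] infinity y(3) by blast
    then have lower: "cardinal_set V \<infinity> \<lesssim> class_powers b x"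
      using y(2) by (meson eqpoll_sym lepoll_trans1 subset_imp_lepoll)
    have sub: "class_powers b x \<subseteq> exact_powers prime_powers x"
      by (rule class_powers_subset[OF b prime_powers_in_convex_family in_basic_class_prime_powers[OF b]])
    have "{..<k} \<lesssim> exact_powers prime_powers x" for k :: nat
      using all[of k] Q sub subset_imp_lepoll lepoll_trans by blast
    then have "exact_powers prime_powers x \<approx> cardinal_set V \<infinity>"
      using exact_powers_cardinal[OF x prime_powers_subset] infinity by blast
    then have "class_powers b x \<lesssim> cardinal_set V \<infinity>"
      using subset_imp_lepoll[OF sub] lepoll_trans2 by blast
    then have "class_powers b x \<approx> cardinal_set V \<infinity>"
      using lower by (rule lepoll_antisym)
    moreover have "enat k \<le> \<infinity> \<longleftrightarrow> ?Q k" for k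
      using all by simp
    ultimately show ?thesis by blast
  qed
qed

lemma pattern_of:
  assumes x: "x \<in> hN" and b: "b \<in> basic_classes V"
  shows class_powers_eqpoll_pattern: "class_powers b x \<approx> cardinal_set V (pattern_of V x b)"
    and enat_le_pattern_of_iff: "enat k \<le> pattern_of V x b \<longleftrightarrow>
      (\<forall>A\<in>convex_family. in_basic_class A b \<longrightarrow>
        eventually (\<lambda>n. k \<le> card (exact_primes A n)) (germ x))"
proof -
  obtain v where v: "class_powers b x \<approx> cardinal_set V v"
    "\<And>k. enat k \<le> v \<longleftrightarrow> (\<forall>A\<in>convex_family. in_basic_class A b \<longrightarrow>
        eventually (\<lambda>n. k \<le> card (exact_primes A n)) (germ x))"
    using class_powers_cardinal[OF assms] by blast
  have "pattern_of V x b = (THE v. class_powers b x \<approx> cardinal_set V v)"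
    unfolding pattern_of_def class_powers_def using b by simp
  also have "\<dots> = v"
    using v(1) cardinal_set_eqpoll_unique by (intro the_equality)
  finally have "pattern_of V x b = v" .
  then show "class_powers b x \<approx> cardinal_set V (pattern_of V x b)"
    and "enat k \<le> pattern_of V x b \<longleftrightarrow> (\<forall>A\<in>convex_family. in_basic_class A b \<longrightarrow>
        eventually (\<lambda>n. k \<le> card (exact_primes A n)) (germ x))"
    using v by simp_all
qed

text \<open>Every pair of a hyperprime and an exponent generates exactly one basic class, and that
  class contains a convex \<open>A\<close> iff the power lies in the extension of \<open>A\<close>.
  So the sets counted by the pattern partition \<open>exact_powers A x\<close>.\<close>

lemma pattern_sum_eqpoll:
  assumes x: "x \<in> hN" and A: "A \<in> convex_family"
  shows "cardinal_sum V (pattern_of V x) (classes_containing V A) \<approx> exact_powers A x"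
proof -
  have "cardinal_sum V (pattern_of V x) (classes_containing V A) \<approx>
      (SIGMA b:classes_containing V A. class_powers b x)"
    unfolding cardinal_sum_def
    by (rule Sigma_eqpoll_cong[where h = "\<lambda>b. b"], simp add: bij_betw_def)
      (use class_powers_eqpoll_pattern[OF x] eqpoll_sym in \<open>auto simp: classes_containing_def\<close>)
  also have "\<dots> \<approx> exact_powers A x"
  proof -
    have "bij_betw snd (SIGMA b:classes_containing V A. class_powers b x) (exact_powers A x)"
    proof (rule bij_betw_imageI)
      show "inj_on snd (SIGMA b:classes_containing V A. class_powers b x)"
        by (auto simp: inj_on_def class_powers_def power_generates_iff)
      show "snd ` (SIGMA b:classes_containing V A. class_powers b x) = exact_powers A x"
      proof (intro equalityI subsetI)
        fix z assume "z \<in> snd ` (SIGMA b:classes_containing V A. class_powers b x)"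
        then obtain b where "b \<in> basic_classes V" "in_basic_class A b" "z \<in> class_powers b x"
          unfolding classes_containing_def by auto
        then show "z \<in> exact_powers A x"
          using class_powers_subset[OF _ A] by blast
      next
        fix z assume z: "z \<in> exact_powers A x"
        obtain p a where pa: "z = (p, a)" by force
        then have D: "exactly_divides V p a x" "hpow V p a \<in> star_set V A"
          using z unfolding exact_powers_def by auto
        then have p: "p \<in> hprimes V" "a \<in> hN"
          unfolding exactly_divides_def by auto
        let ?b = "class_of_power V p a"
        have "?b \<in> classes_containing V A"
          unfolding classes_containing_def
          using class_of_power_in[OF p] in_class_of_power_iff[OF p A] D(2) by blast
        moreover have "z \<in> class_powers ?b x"
          unfolding class_powers_def power_generates_iff using p D(1) pa by simp
        ultimately show "z \<in> snd ` (SIGMA b:classes_containing V A. class_powers b x)"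
          by force
      qed
    qed
    then show ?thesis
      unfolding eqpoll_def by blast
  qed
  finally show ?thesis .
qed

lemma pattern_of_C_closed:
  assumes x: "x \<in> hN"
  shows "C_closed V (pattern_of V x)"
  unfolding C_closed_def
proof (intro conjI ballI impI)
  fix A assume A: "A \<in> convex_family"
  show "\<exists>v. cardinal_sum V (pattern_of V x) (classes_containing V A) \<approx> cardinal_set V v"
    using pattern_sum_eqpoll[OF x A] exact_powers_cardinal[OF x convex_family_subset[OF A]]
      eqpoll_trans by blast
next
  fix b n
  assume b: "b \<in> basic_classes V"
    and large: "\<forall>A\<in>convex_family. in_basic_class A b \<longrightarrow>
      cardinal_set V (enat n) \<lesssim> cardinal_sum V (pattern_of V x) (classes_containing V A)"
  show "enat n \<le> pattern_of V x b"
    unfolding enat_le_pattern_of_iff[OF x b]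
  proof (intro ballI impI)
    fix A assume A: "A \<in> convex_family" "in_basic_class A b"
    then have "cardinal_set V (enat n) \<lesssim> exact_powers A x"
      using large pattern_sum_eqpoll[OF x A(1)] lepoll_trans2 by blast
    then show "eventually (\<lambda>m. n \<le> card (exact_primes A m)) (germ x)"
      unfolding cardinal_set_lepoll_iff lepoll_exact_powers_iff[OF x convex_family_subset[OF A(1)]] .
  qed
qed

end

section \<open>Realising closed patterns\<close>

text \<open>Greedy choice: the values on \<open>F\<^sub>0\<close> are forced, and every element of
  \<open>D\<close> has infinitely many candidates, of which only finitely many are already
  taken.\<close>

lemma inj_on_choice_extend:
  assumes "finite D" "finite F\<^sub>0" "inj_on f\<^sub>0 F\<^sub>0" "F\<^sub>0 \<inter> D = {}" "\<And>j. j \<in> D \<Longrightarrow> infinite (X j)"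
  shows "\<exists>f. inj_on f (F\<^sub>0 \<union> D) \<and> (\<forall>j\<in>F\<^sub>0. f j = f\<^sub>0 j) \<and> (\<forall>j\<in>D. f j \<in> X j)"
  using assms(1,4,5)
proof (induction D)
  case empty
  then show ?case
    using assms(3) by auto
next
  case (insert d D)
  then obtain f where f: "inj_on f (F\<^sub>0 \<union> D)" "\<forall>j\<in>F\<^sub>0. f j = f\<^sub>0 j" "\<forall>j\<in>D. f j \<in> X j"
    by auto
  have "infinite (X d - f ` (F\<^sub>0 \<union> D))"
    using insert assms(2) by (simp add: Diff_infinite_finite)
  then obtain q where q: "q \<in> X d - f ` (F\<^sub>0 \<union> D)"
    using infinite_imp_nonempty by blast
  have d: "d \<notin> F\<^sub>0 \<union> D"
    using insert by blast
  have "inj_on (f(d := q)) (F\<^sub>0 \<union> insert d D)"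
    using f(1) q d by (auto simp: inj_on_def)
  moreover have "\<forall>j\<in>F\<^sub>0. (f(d := q)) j = f\<^sub>0 j"
    using f(2) d by auto
  moreover have "\<forall>j\<in>insert d D. (f(d := q)) j \<in> X j"
    using f(3) q d by auto
  ultimately show ?case by blast
qed

context saturated_extension
begin

section \<open>Standard primes and their infinite exponents\<close>

lemma finite_star_set:
  assumes "x \<in> hN" "finite X" "eventually (\<lambda>n. n \<in> X) (germ x)"
  shows "\<exists>n\<in>X. 1 \<le> n \<and> x = hnat V n"
proof (rule ccontr)
  assume contra: "\<not> ?thesis"
  have "eventually (\<lambda>n. \<forall>q\<in>X. n \<noteq> q \<or> n = 0) (germ x)"
  proof (intro eventually_ball_finite ballI assms)
    fix q assume "q \<in> X"
    show "eventually (\<lambda>n. n \<noteq> q \<or> n = 0) (germ x)"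
    proof (cases "q = 0")
      case False
      then have "\<not> eventually (\<lambda>n. n = q) (germ x)"
        using contra \<open>q \<in> X\<close> eventually_germ_const_iff[OF assms(1), of q]
        by (auto simp: Suc_le_eq One_nat_def)
      then have "eventually (\<lambda>n. n \<noteq> q) (germ x)"
        unfolding eventually_germ_not[OF assms(1)] .
      then show ?thesis
        by (rule eventually_mono) simp
    qed (auto intro!: always_eventually)
  qed
  then have "eventually (\<lambda>_. False) (germ x)"
    using assms(3) eventually_germ_pos[OF assms(1)] by eventually_elim auto
  then show False
    using eventually_germ_False[OF assms(1)] by blast
qed

lemma hnat_prime:
  assumes "prime q"
  shows "hnat V q \<in> hprimes V"
  unfolding hprimes_def
  by (subst std_nat_mem_star_set) (use assms in \<open>auto simp: prime_ge_1_nat\<close>)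

lemma eventually_germ_frequent:
  assumes "a \<in> infinite_hypernats V" "eventually P (germ a)"
  shows "\<exists>n\<ge>k. P n"
proof (rule ccontr)
  assume contra: "\<not> ?thesis"
  have a: "a \<in> hN"
    using assms(1) unfolding infinite_hypernats_def by blast
  have "eventually (\<lambda>_. False) (germ a)"
    using assms(2) eventually_ge_infinite[OF assms(1), of k] by eventually_elim (use contra in blast)
  then show False
    using eventually_germ_False[OF a] by blast
qed

lemma hpow_hnat_iff:
  assumes "1 \<le> q" "a \<in> hN" "A \<subseteq> posnats"
  shows "hpow V (hnat V q) a \<in> star_set V A \<longleftrightarrow> eventually (\<lambda>n. q ^ n \<in> A) (germ a)"
  using hpow_star_set_iff[of "\<lambda>_. q" "\<lambda>n. n" a A] assms by (simp add: star_fun_const)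

text \<open>A convex set that contains arbitrarily high powers of \<open>q\<close> contains all of
  them from some exponent on. Hence infinite exponents cannot be told apart by convex sets.\<close>

lemma class_of_power_infinite:
  assumes q: "prime q" and a: "a \<in> infinite_hypernats V" and b: "b \<in> infinite_hypernats V"
  shows "class_of_power V (hnat V q) a = class_of_power V (hnat V q) b"
proof -
  have ab: "a \<in> hN" "b \<in> hN"
    using a b unfolding infinite_hypernats_def by auto
  have q1: "1 \<le> q"
    using q by (simp add: prime_ge_1_nat)
  have "hpow V (hnat V q) b \<in> star_set V A"
    if A: "A \<in> convex_family" "hpow V (hnat V q) a \<in> star_set V A" for A
  proof -
    have ev: "eventually (\<lambda>n. q ^ n \<in> A) (germ a)"
      using hpow_hnat_iff[OF q1 ab(1) convex_family_subset[OF A(1)]] A(2) by blast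
    obtain m where m: "q ^ m \<in> A"
      using eventually_germ_frequent[OF a ev] by blast
    have "q ^ n \<in> A" if "m \<le> n" for n
    proof -
      obtain l where "n \<le> l" "q ^ l \<in> A"
        using eventually_germ_frequent[OF a ev] by blast
      then show ?thesis
        using A(1) m le_imp_power_dvd[OF that, of q] le_imp_power_dvd[OF \<open>n \<le> l\<close>, of q]
        unfolding convex_family_def dvd_convex_def by blast
    qed
    then have "eventually (\<lambda>n. q ^ n \<in> A) (germ b)"
      using eventually_ge_infinite[OF b, of m] by (rule eventually_mono[rotated])
    then show ?thesis
      using hpow_hnat_iff[OF q1 ab(2) convex_family_subset[OF A(1)]] by blast
  qed
  then show ?thesis
    using class_of_power_eq_iff[OF hnat_prime[OF q] ab(1) hnat_prime[OF q] ab(2)] by blast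
qed

lemma class_of_power_std:
  assumes "prime q" "a \<in> hN"
  shows "\<exists>k\<in>{1..}. class_of_power V (hnat V q) a = std_power_class V q k"
proof (cases "a \<in> infinite_hypernats V")
  case True
  have "(SOME a. a \<in> infinite_hypernats V) \<in> infinite_hypernats V"
    using infinite_hypernat_exists by (rule someI_ex)
  then have "class_of_power V (hnat V q) a = std_power_class V q \<infinity>"
    using class_of_power_infinite[OF assms(1) True] by simp
  then show ?thesis
    by (intro bexI[of _ \<infinity>]) simp_all
next
  case False
  then obtain n where "1 \<le> n" "a = hnat V n"
    using assms(2) unfolding infinite_hypernats_def by auto
  then show ?thesis
    by (intro bexI[of _ "enat n"]) (simp_all add: one_enat_def)
qed

text \<open>The pattern condition embeds the disjoint union over all exponents of \<open>q\<close>
  into a one-element set, so both the class and the index are forced.\<close>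

lemma pattern_std_prime_unique:
  assumes \<beta>: "\<beta> \<in> patterns V" and q: "prime q" and a: "a \<in> hN" "a' \<in> hN"
    and i: "i \<in> cardinal_set V (\<beta> (class_of_power V (hnat V q) a))"
      "i' \<in> cardinal_set V (\<beta> (class_of_power V (hnat V q) a'))"
  shows "class_of_power V (hnat V q) a = class_of_power V (hnat V q) a' \<and> i = i'"
proof -
  obtain k k' where k: "k \<in> {1..}" "class_of_power V (hnat V q) a = std_power_class V q k"
      "k' \<in> {1..}" "class_of_power V (hnat V q) a' = std_power_class V q k'"
    using class_of_power_std[OF q a(1)] class_of_power_std[OF q a(2)] by blast
  let ?S = "cardinal_sum V (\<lambda>k. \<beta> (std_power_class V q k)) {1..}"
  have "?S \<lesssim> cardinal_set V 1"
    using \<beta> q unfolding patterns_def by blast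
  moreover have "cardinal_set V 1 = {hnat V 1}"
    by (simp add: one_enat_def)
  ultimately obtain f :: "enat \<times> 't \<Rightarrow> 't" where "inj_on f ?S" "f ` ?S \<subseteq> {hnat V 1}"
    unfolding lepoll_def by auto
  moreover have "(k, i) \<in> ?S" "(k', i') \<in> ?S"
    unfolding cardinal_sum_def using k i by auto
  ultimately have "(k, i) = (k', i')"
    by (metis image_subset_iff inj_onD singletonD)
  then show ?thesis
    using k by simp
qed

definition representing_primes :: "nat set set \<Rightarrow> nat set set set \<Rightarrow> nat set" where
  "representing_primes \<A> b = {q. prime q \<and> (\<exists>e\<ge>1. \<forall>A\<in>\<A>. q ^ e \<in> A \<longleftrightarrow> in_basic_class A b)}"

text \<open>If \<open>p\<close> and \<open>a\<close> generate \<open>b\<close>, almost every value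
  of their germs represents \<open>b\<close>. So the representing primes form a set in the type of
  \<open>p\<close>, and if that set is finite, \<open>p\<close> is one of its standard
  members.\<close>

lemma representing_primes_cases:
  assumes "b \<in> basic_classes V" "finite \<A>" "\<A> \<subseteq> convex_family"
  shows "infinite (representing_primes \<A> b) \<or>
    (\<exists>q\<in>representing_primes \<A> b. \<exists>a\<in>hN. b = class_of_power V (hnat V q) a)"
proof -
  obtain p a where p: "p \<in> hprimes V" "a \<in> hN" "b = class_of_power V p a"
    using assms(1) unfolding basic_classes_eq by blast
  obtain w f g where w: "w \<in> hN" "pos_fun f" "pos_fun g" "p = star_fun f w" "a = star_fun g w"
    by (rule star_fun_representation2[OF hprimes_in[OF p(1)] p(2)])
  have "eventually (\<lambda>n. \<forall>A\<in>\<A>. f n ^ g n \<in> A \<longleftrightarrow> in_basic_class A b) (germ w)"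
  proof (intro eventually_ball_finite assms(2) ballI)
    fix A assume "A \<in> \<A>"
    then have A: "A \<in> convex_family"
      using assms(3) by blast
    have iff: "in_basic_class A b \<longleftrightarrow> eventually (\<lambda>n. f n ^ g n \<in> A) (germ w)"
      unfolding p(3) in_class_of_power_iff[OF p(1,2) A]
      unfolding w(4,5) hpow_star_set_iff[OF w(2,3,1) convex_family_subset[OF A]] ..
    show "eventually (\<lambda>n. f n ^ g n \<in> A \<longleftrightarrow> in_basic_class A b) (germ w)"
    proof (cases "in_basic_class A b")
      case True
      then show ?thesis
        using iff by simp
    next
      case False
      then have "\<not> eventually (\<lambda>n. f n ^ g n \<in> A) (germ w)"
        using iff by blast
      then have "eventually (\<lambda>n. f n ^ g n \<notin> A) (germ w)"
        unfolding eventually_germ_not[OF w(1)] .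
      then show ?thesis
        using False by simp
    qed
  qed
  moreover have "eventually (\<lambda>n. prime (f n)) (germ w)"
    using p(1) star_fun_hprimes[OF w(2,1)] w(4) by blast
  ultimately have "eventually (\<lambda>n. f n \<in> representing_primes \<A> b) (germ w)"
    using eventually_germ_pos[OF w(1)]
    by eventually_elim (use w(3) in \<open>unfold representing_primes_def, blast\<close>)
  then have ev: "eventually (\<lambda>n. n \<in> representing_primes \<A> b) (germ p)"
    unfolding w(4) eventually_germ_star_fun[OF w(2,1)] .
  show ?thesis
    using finite_star_set[OF hprimes_in[OF p(1)] _ ev] p(2,3) by blast
qed

section \<open>Realising the elements counted by a closed pattern\<close>

definition pattern_items :: "(nat set set set \<Rightarrow> enat) \<Rightarrow> (nat set set set \<times> 't) set" where
  "pattern_items \<beta> = cardinal_sum V \<beta> (basic_classes V)"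

lemma cardinal_sum_classes_containing:
  "cardinal_sum V \<beta> (classes_containing V A) = {j \<in> pattern_items \<beta>. in_basic_class A (fst j)}"
  unfolding cardinal_sum_def classes_containing_def pattern_items_def by auto

lemma finite_items_realised:
  assumes \<beta>: "\<beta> \<in> patterns V" and F: "finite F" "F \<subseteq> pattern_items \<beta>"
    and \<A>: "finite \<A>" "\<A> \<subseteq> convex_family"
  shows "\<exists>n\<ge>1. \<forall>A\<in>\<A>. card (exact_primes A n) = card {j \<in> F. in_basic_class A (fst j)}"
proof -
  \<comment> \<open>The relation says that \<open>b\<close> lies over the standard prime
    \<open>q\<close> and can be represented by a power of \<open>q\<close> itself. Such classes keep
    their own prime; all others have infinitely many candidates.\<close>
  define is_std where "is_std b q \<longleftrightarrow> q \<in> representing_primes \<A> b \<and> (\<exists>a\<in>hN. b = class_of_power V (hnat V q) a)" for b q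
  define F\<^sub>0 where "F\<^sub>0 = {j \<in> F. \<exists>q. is_std (fst j) q}"
  have "\<forall>j\<in>F\<^sub>0. \<exists>q. is_std (fst j) q"
    unfolding F\<^sub>0_def by blast
  from bchoice[OF this] obtain f\<^sub>0 where f\<^sub>0: "\<And>j. j \<in> F\<^sub>0 \<Longrightarrow> is_std (fst j) (f\<^sub>0 j)"
    by blast
  \<comment> \<open>Two items assigned the same prime lie over that standard prime, where the
    pattern counts at most one.\<close>
  have inj\<^sub>0: "inj_on f\<^sub>0 F\<^sub>0"
  proof (rule inj_onI)
    fix j j' assume j: "j \<in> F\<^sub>0" "j' \<in> F\<^sub>0" "f\<^sub>0 j = f\<^sub>0 j'"
    obtain b i b' i' where bi: "j = (b, i)" "j' = (b', i')"
      by fastforce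
    define q where "q = f\<^sub>0 j"
    have "is_std b q" "is_std b' q"
      using f\<^sub>0[OF j(1)] f\<^sub>0[OF j(2)] j(3) bi unfolding q_def by auto
    then obtain a a' where a: "prime q" "a \<in> hN" "a' \<in> hN" "b = class_of_power V (hnat V q) a"
        "b' = class_of_power V (hnat V q) a'"
      unfolding is_std_def representing_primes_def by blast
    have "i \<in> cardinal_set V (\<beta> b)" "i' \<in> cardinal_set V (\<beta> b')"
      using j(1,2) F(2) bi unfolding F\<^sub>0_def pattern_items_def cardinal_sum_def by auto
    then show "j = j'"
      using pattern_std_prime_unique[OF \<beta> a(1-3)] a(4,5) bi by auto
  qed
  have inf: "infinite (representing_primes \<A> (fst j))" if "j \<in> F - F\<^sub>0" for j
  proof -
    have "fst j \<in> basic_classes V"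
      using that F(2) unfolding pattern_items_def cardinal_sum_def by auto
    moreover have "\<not> is_std (fst j) q" for q
      using that unfolding F\<^sub>0_def by blast
    ultimately show ?thesis
      using representing_primes_cases[OF _ \<A>] unfolding is_std_def by blast
  qed
  have "\<exists>f. inj_on f (F\<^sub>0 \<union> (F - F\<^sub>0)) \<and> (\<forall>j\<in>F\<^sub>0. f j = f\<^sub>0 j) \<and>
      (\<forall>j\<in>F - F\<^sub>0. f j \<in> representing_primes \<A> (fst j))"
    by (rule inj_on_choice_extend[OF _ _ inj\<^sub>0 _ inf]) (use F(1) in \<open>auto simp: F\<^sub>0_def\<close>)
  then obtain f where f: "inj_on f (F\<^sub>0 \<union> (F - F\<^sub>0))" "\<forall>j\<in>F\<^sub>0. f j = f\<^sub>0 j"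
      "\<forall>j\<in>F - F\<^sub>0. f j \<in> representing_primes \<A> (fst j)"
    by blast
  have "F\<^sub>0 \<union> (F - F\<^sub>0) = F"
    unfolding F\<^sub>0_def by blast
  then have inj: "inj_on f F"
    using f(1) by simp
  have res: "f j \<in> representing_primes \<A> (fst j)" if "j \<in> F" for j
    using f(2,3) f\<^sub>0[of j] that unfolding is_std_def by (cases "j \<in> F\<^sub>0") auto
  then have "\<forall>j\<in>F. \<exists>e\<ge>1. \<forall>A\<in>\<A>. f j ^ e \<in> A \<longleftrightarrow> in_basic_class A (fst j)"
    unfolding representing_primes_def by blast
  then obtain e where e: "\<And>j. j \<in> F \<Longrightarrow> 1 \<le> e j"
      "\<And>j A. j \<in> F \<Longrightarrow> A \<in> \<A> \<Longrightarrow> f j ^ e j \<in> A \<longleftrightarrow> in_basic_class A (fst j)"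
    by metis
  \<comment> \<open>The product runs over primes while exponents were chosen per item; injectivity
    of \<open>f\<close> allows the reindexing.\<close>
  define e' where "e' q = e (the_inv_into F f q)" for q
  have e': "e' (f j) = e j" if "j \<in> F" for j
    unfolding e'_def using the_inv_into_f_f[OF inj that] by simp
  have S: "finite (f ` F)" "\<And>q. q \<in> f ` F \<Longrightarrow> prime q" "\<And>q. q \<in> f ` F \<Longrightarrow> 1 \<le> e' q"
    using F(1) res e(1) e' unfolding representing_primes_def by auto
  define n where "n = (\<Prod>q\<in>f ` F. q ^ e' q)"
  have "card (exact_primes A n) = card {j \<in> F. in_basic_class A (fst j)}" if "A \<in> \<A>" for A
  proof -
    have "exact_primes A n = {q \<in> f ` F. q ^ e' q \<in> A}"
      unfolding n_def by (rule exact_primes_prod(3)[OF S])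
    also have "\<dots> = f ` {j \<in> F. in_basic_class A (fst j)}"
      using e' e(2)[OF _ that] by auto
    finally show ?thesis
      using inj by (simp add: card_image inj_on_subset)
  qed
  moreover have "1 \<le> n"
    unfolding n_def by (rule exact_primes_prod(1)[OF S])
  ultimately show ?thesis by blast
qed

text \<open>For a bound that holds, \<open>k\<close> items are selected. For one that fails, the
  items of \<open>A\<close> are finitely many and all are taken, so that joining the selections for
  other conditions cannot raise the count for \<open>A\<close>.\<close>

lemma C_closed_finitely_realised:
  assumes \<beta>: "\<beta> \<in> patterns V"
    and v: "\<And>A. A \<in> convex_family \<Longrightarrow>
      cardinal_sum V \<beta> (classes_containing V A) \<approx> cardinal_set V (v A)"
    and I: "finite I" "I \<subseteq> convex_family \<times> UNIV"
  shows "\<exists>n\<ge>1. \<forall>(A, k)\<in>I. k \<le> card (exact_primes A n) \<longleftrightarrow> enat k \<le> v A"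
proof -
  let ?J = "\<lambda>A. {j \<in> pattern_items \<beta>. in_basic_class A (fst j)}"
  have J: "{..<k::nat} \<lesssim> ?J A \<longleftrightarrow> enat k \<le> v A" if "A \<in> convex_family" for A k
    using eqpoll_cardinal_set_iff[OF v[OF that]] unfolding cardinal_sum_classes_containing .
  let ?P = "\<lambda>A k T. T \<subseteq> ?J A \<and> finite T \<and> (enat k \<le> v A \<longrightarrow> k \<le> card T) \<and>
      (\<not> enat k \<le> v A \<longrightarrow> T = ?J A)"
  have ex: "\<exists>T. ?P A k T" if AC: "A \<in> convex_family" for A k
  proof (cases "enat k \<le> v A")
    case True
    then obtain f where f: "inj_on f {..<k}" "f ` {..<k} \<subseteq> ?J A"
      using J[OF AC, of k] unfolding lepoll_def by blast
    show ?thesis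
      by (intro exI[of _ "f ` {..<k}"] conjI f(2)) (use True f(1) in \<open>auto simp: card_image\<close>)
  next
    case False
    then have "finite (?J A)"
      using J[OF AC, of k] infinite_iff_lessThan_lepoll by blast
    then show ?thesis
      using False by blast
  qed
  define T where "T i = (SOME T. ?P (fst i) (snd i) T)" for i
  have T: "?P A k (T (A, k))" if "(A, k) \<in> I" for A k
  proof -
    have "A \<in> convex_family"
      using that I(2) by blast
    from someI_ex[OF ex[OF this]] show ?thesis
      unfolding T_def by simp
  qed
  define F where "F = (\<Union>i\<in>I. T i)"
  have F: "finite F" "F \<subseteq> pattern_items \<beta>"
    unfolding F_def using I(1) T by fastforce+
  have "finite (fst ` I)" "fst ` I \<subseteq> convex_family"
    using I by auto
  from finite_items_realised[OF \<beta> F this] obtain n where n: "1 \<le> n"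
      "\<And>A. A \<in> fst ` I \<Longrightarrow> card (exact_primes A n) = card {j \<in> F. in_basic_class A (fst j)}"
    by blast
  have "k \<le> card (exact_primes A n) \<longleftrightarrow> enat k \<le> v A" if Ak: "(A, k) \<in> I" for A k
  proof -
    have A: "A \<in> convex_family"
      using Ak I(2) by blast
    have card: "card (exact_primes A n) = card {j \<in> F. in_basic_class A (fst j)}"
      using n(2) Ak by force
    have sub: "T (A, k) \<subseteq> {j \<in> F. in_basic_class A (fst j)}"
      using T[OF Ak] Ak unfolding F_def by blast
    have fin: "finite {j \<in> F. in_basic_class A (fst j)}"
      using F(1) by simp
    show ?thesis
    proof (cases "enat k \<le> v A")
      case True
      then have "k \<le> card (T (A, k))"
        using T[OF Ak] by blast
      then show ?thesis
        using True card card_mono[OF fin sub] by simp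
    next
      case False
      have "{j \<in> F. in_basic_class A (fst j)} = ?J A"
        using T[OF Ak] False sub F(2) by blast
      then have "\<not> {..<k} \<lesssim> {j \<in> F. in_basic_class A (fst j)}"
        using J[OF A] False by simp
      then show ?thesis
        using False card fin by (simp add: lepoll_iff_card_le)
    qed
  qed
  then show ?thesis
    using n(1) by blast
qed

lemma C_closed_realised:
  assumes \<beta>: "\<beta> \<in> patterns V" and closed: "C_closed V \<beta>"
  shows "\<exists>G\<in>ultrafilters. uf_pattern V G = \<beta>"
proof -
  have "\<forall>A\<in>convex_family. \<exists>v. cardinal_sum V \<beta> (classes_containing V A) \<approx> cardinal_set V v"
    using closed unfolding C_closed_def by blast
  then obtain v where v: "\<And>A. A \<in> convex_family \<Longrightarrow>
      cardinal_sum V \<beta> (classes_containing V A) \<approx> cardinal_set V (v A)"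
    by metis
  let ?R = "\<lambda>(A, k) _ n. k \<le> card (exact_primes A n) \<longleftrightarrow> enat k \<le> v A"
  have "\<exists>x\<in>hN. \<forall>R\<in>?R ` (convex_family \<times> UNIV). star2 R (hnat V 1) x"
  proof (rule saturation)
    fix F :: "(nat \<Rightarrow> nat \<Rightarrow> bool) set"
    assume fin: "finite F" and sub: "F \<subseteq> ?R ` (convex_family \<times> UNIV)"
    obtain I where I: "I \<subseteq> convex_family \<times> UNIV" "finite I" "F = ?R ` I"
      using finite_subset_image[OF fin sub] by (elim exE conjE) (rule that)
    obtain n where "1 \<le> n" "\<forall>(A, k)\<in>I. k \<le> card (exact_primes A n) \<longleftrightarrow> enat k \<le> v A"
      using C_closed_finitely_realised[OF \<beta> v I(2,1)] by blast
    then have "\<exists>n\<ge>1. \<forall>R\<in>F. R m n" for m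
      unfolding I(3) by (intro exI[of _ n]) auto
    then show "eventually (\<lambda>m. \<exists>n\<ge>1. \<forall>R\<in>F. R m n) (germ (hnat V 1))"
      by simp
  qed simp
  then obtain x where x: "x \<in> hN" "\<And>A k. A \<in> convex_family \<Longrightarrow>
      star2 (\<lambda>_ n. k \<le> card (exact_primes A n) \<longleftrightarrow> enat k \<le> v A) (hnat V 1) x"
    by fastforce
  define G where "G = tp V x"
  have G: "G \<in> ultrafilters"
    unfolding G_def by (rule tp_ultrafilter[OF x(1)])
  \<comment> \<open>The pattern of \<open>G\<close> is computed at a chosen generator, possibly not
    \<open>x\<close>; the counts agree because they depend only on the type.\<close>
  define y where "y = (SOME y. generates V y G)"
  have "generates V y G"
    unfolding y_def using generator_exists[OF G] by (rule someI_ex)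
  then have y: "y \<in> hN" "tp V y = tp V x"
    unfolding generates_def G_def by auto
  have count: "eventually (\<lambda>n. k \<le> card (exact_primes A n)) (germ y) \<longleftrightarrow> enat k \<le> v A"
    if A: "A \<in> convex_family" for A k
  proof -
    have ev: "eventually (\<lambda>n. k \<le> card (exact_primes A n) \<longleftrightarrow> enat k \<le> v A) (germ x)"
      using x(2)[OF A] star2_snd[OF _ x(1)] by simp
    have "eventually (\<lambda>n. k \<le> card (exact_primes A n)) (germ y) \<longleftrightarrow>
        eventually (\<lambda>n. k \<le> card (exact_primes A n)) (germ x)"
      unfolding eventually_germ_eq_tp[OF y(1)] eventually_germ_eq_tp[OF x(1)] y(2) ..
    also have "\<dots> \<longleftrightarrow> eventually (\<lambda>n. enat k \<le> v A) (germ x)"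
      by (rule eventually_cong[OF ev])
    also have "\<dots> \<longleftrightarrow> enat k \<le> v A"
      using eventually_germ_False[OF x(1)] by (cases "enat k \<le> v A") auto
    finally show ?thesis .
  qed
  have "pattern_of V y b = \<beta> b" for b
  proof (cases "b \<in> basic_classes V")
    case b: True
    have "enat k \<le> pattern_of V y b \<longleftrightarrow> enat k \<le> \<beta> b" for k
    proof -
      have "enat k \<le> pattern_of V y b \<longleftrightarrow>
          (\<forall>A\<in>convex_family. in_basic_class A b \<longrightarrow> enat k \<le> v A)"
        unfolding enat_le_pattern_of_iff[OF y(1) b] using count by blast
      also have "\<dots> \<longleftrightarrow> enat k \<le> \<beta> b"
      proof
        assume large: "\<forall>A\<in>convex_family. in_basic_class A b \<longrightarrow> enat k \<le> v A"
        show "enat k \<le> \<beta> b"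
        \<comment> \<open>Closure speaks of positive bounds only, so 0 is treated apart.\<close>
        proof (cases "k = 0")
          case False
          have "cardinal_set V (enat k) \<lesssim> cardinal_sum V \<beta> (classes_containing V A)"
            if "A \<in> convex_family" "in_basic_class A b" for A
            unfolding cardinal_set_lepoll_iff eqpoll_cardinal_set_iff[OF v[OF that(1)]]
            using large that by blast
          moreover have "k \<in> posnats"
            using False by (simp add: Suc_le_eq One_nat_def)
          ultimately show ?thesis
            using closed b unfolding C_closed_def by blast
        qed (simp add: zero_enat_def[symmetric])
      next
        assume k: "enat k \<le> \<beta> b"
        show "\<forall>A\<in>convex_family. in_basic_class A b \<longrightarrow> enat k \<le> v A"
        proof (intro ballI impI)
          fix A assume A: "A \<in> convex_family" "in_basic_class A b"
          have "{..<k} \<lesssim> cardinal_set V (\<beta> b)"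
            using k lessThan_lepoll_cardinal_set by blast
          \<comment> \<open>The elements counted in the class \<open>b\<close> are one summand of
            the sum over the classes containing \<open>A\<close>.\<close>
          also have "cardinal_set V (\<beta> b) \<lesssim> cardinal_sum V \<beta> (classes_containing V A)"
            unfolding lepoll_def
            by (rule exI[of _ "\<lambda>i. (b, i)"])
              (use A b in \<open>auto simp: inj_on_def cardinal_sum_def classes_containing_def\<close>)
          finally show "enat k \<le> v A"
            using eqpoll_cardinal_set_iff[OF v[OF A(1)]] by blast
        qed
      qed
      finally show ?thesis .
    qed
    then show ?thesis
      by (rule enat_eqI)
  next
    \<comment> \<open>Outside the basic classes both functions take the default value of extensional
      functions.\<close>
    case False
    then show ?thesis
      using \<beta> unfolding patterns_def pattern_of_def PiE_def extensional_def by auto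
  qed
  then have "uf_pattern V G = \<beta>"
    unfolding uf_pattern_def y_def[symmetric] by blast
  then show ?thesis
    using G by blast
qed

lemma uf_pattern_C_closed:
  assumes "G \<in> ultrafilters"
  shows "C_closed V (uf_pattern V G)"
proof -
  have "generates V (SOME x. generates V x G) G"
    using generator_exists[OF assms] by (rule someI_ex)
  then show ?thesis
    unfolding uf_pattern_def generates_def using pattern_of_C_closed by blast
qed

end

theorem corollary4p7:
  fixes h :: enat and V :: "('s, 't) ns_universe"
  assumes "10 \<le> h"
    and "nonstandard_extension h V"
    and "continuum_plus_saturated V"
    and "isomorphism_property V"
  shows "\<forall>\<beta>\<in>patterns V. (\<exists>G\<in>ultrafilters. uf_pattern V G = \<beta>) \<longleftrightarrow> C_closed V \<beta>"
proof -
  interpret saturated_extension h V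
    by unfold_locales (fact assms)+
  show ?thesis
    using C_closed_realised uf_pattern_C_closed by blast
qed

end
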